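(* All finitely generated nilpotent groups are logspace embeddable.
   Context: A group is logspace embeddable if it embeds in a (finitely generated) group which has a logspace normal form. A deterministic logspace transducer is a deterministic machine with a finite state control and three tapes: a read-only input tape storing the input word; a read-write work tape restricted to at most $c\log n$ squares, where $n$ is the length of the input word and $c$ is a fixed constant; and a write-only output tape written from left to right. In each transition it may modify the work tape, change state, move the input read-head, and write at most a fixed constant number of letters to the output tape. For finite alphabets $X,Y$, a function $f:X^*\to Y^*$ is logspace computable if some deterministic logspace transducer outputs $f(w)$ on every input $w\in X^*$ ($X^*$ is the set of finite words over $X$, including the empty word $\lambda$). Let $G$ be a group with finite symmetric (closed under inverses) generating set $X$; for $w\in X^*$ let $\overline{w}\in G$ denote the element it represents. A normal form for $(G,X)$ is a subset $L\subseteq X^*$ such that $w\mapsto\overline{w}$ restricts to a bijection $L\to G$. A logspace normal form function for $(G,X)$ is a logspace computable $f:X^*\to X^*$ such that, for some normal form $L$, $f(w)$ is the unique element of $L$ with $\overline{f(w)}=\overline{w}$, for all $w\in X^*$. $(G,X)$ has a logspace normal form if it has a logspace normal form function; $G$ has a logspace normal form if $(G,X)$ does for some finite symmetric generating set $X$. *)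

theory Defs
  imports Complex_Main "HOL-Algebra.Generated_Groups"
begin

section \<open>Deterministic logspace transducers\<close>

text \<open>
  The input tape holds \<open>w\<close> in cells 1, ..., \<open>length w\<close>, between two end markers.  The work tape is
  infinite to the right, initially blank; a left move in its first cell has no effect.  States and
  work symbols are natural numbers, of which a machine uses only finitely many.
\<close>

datatype 'x input_symbol = Left_End | Letter 'x | Right_End

datatype direction = Move_Left | Stay | Move_Right

record ('x, 'y) transducer =
  states :: "nat set"
  work_symbols :: "nat set"
  start_state :: nat
  final_states :: "nat set"
  blank :: nat
  trans :: "nat \<Rightarrow> 'x input_symbol \<Rightarrow> nat \<Rightarrow> nat \<times> nat \<times> direction \<times> direction \<times> 'y list"
    \<comment> \<open>state, scanned input symbol, scanned work symbol; gives new state, written work symbol,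
       input head move, work head move, letters appended to the output\<close>

definition transducer :: "'x set \<Rightarrow> 'y set \<Rightarrow> ('x, 'y) transducer \<Rightarrow> bool" where
  "transducer X Y M \<longleftrightarrow>
     finite (states M) \<and> finite (work_symbols M) \<and>
     start_state M \<in> states M \<and> final_states M \<subseteq> states M \<and> blank M \<in> work_symbols M \<and>
     (\<exists>k. \<forall>q \<in> states M. \<forall>s \<in> insert Left_End (insert Right_End (Letter ` X)). \<forall>a \<in> work_symbols M.
        case trans M q s a of (q', b, d, e, out) \<Rightarrow>
          q' \<in> states M \<and> b \<in> work_symbols M \<and> out \<in> lists Y \<and> length out \<le> k)"

record 'y config =
  state :: nat
  in_pos :: nat
  work_tape :: "nat \<Rightarrow> nat"
  work_pos :: nat
  out_tape :: "'y list"

definition initial :: "('x, 'y) transducer \<Rightarrow> 'y config" where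
  "initial M = \<lparr>state = start_state M, in_pos = 0, work_tape = (\<lambda>_. blank M), work_pos = 0, out_tape = []\<rparr>"

definition scanned :: "'x list \<Rightarrow> nat \<Rightarrow> 'x input_symbol" where
  "scanned w i = (if i = 0 then Left_End else if i \<le> length w then Letter (w ! (i - 1)) else Right_End)"

fun move :: "direction \<Rightarrow> nat \<Rightarrow> nat" where
  "move Move_Left i = i - 1"
| "move Stay i = i"
| "move Move_Right i = i + 1"

text \<open>The machine halts by entering a final state, and then its configuration no longer changes.\<close>

definition step :: "('x, 'y) transducer \<Rightarrow> 'x list \<Rightarrow> 'y config \<Rightarrow> 'y config" where
  "step M w c =
     (if state c \<in> final_states M then c
      else case trans M (state c) (scanned w (in_pos c)) (work_tape c (work_pos c)) of
        (q, b, d, e, out) \<Rightarrow>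
          \<lparr>state = q,
           in_pos = min (move d (in_pos c)) (length w + 1),
           work_tape = (work_tape c)(work_pos c := b),
           work_pos = move e (work_pos c),
           out_tape = out_tape c @ out\<rparr>)"

definition run :: "('x, 'y) transducer \<Rightarrow> 'x list \<Rightarrow> nat \<Rightarrow> 'y config" where
  "run M w t = (step M w ^^ t) (initial M)"

definition outputs :: "('x, 'y) transducer \<Rightarrow> 'x list \<Rightarrow> 'y list \<Rightarrow> bool" where
  "outputs M w v \<longleftrightarrow> (\<exists>t. state (run M w t) \<in> final_states M \<and> out_tape (run M w t) = v)"

text \<open>
  The bound is \<open>c log n\<close> squares.  Since \<open>log n\<close> is undefined or 0 for inputs of length
  \<open>n < 2\<close>, while the head always occupies a square, such inputs are allowed as much space as those
  of length 2.
\<close>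

definition logspace_bounded :: "real \<Rightarrow> ('x, 'y) transducer \<Rightarrow> 'x list \<Rightarrow> bool" where
  "logspace_bounded c M w \<longleftrightarrow>
     (\<forall>t. real (work_pos (run M w t) + 1) \<le> c * log 2 (real (max 2 (length w))))"

definition logspace_computable :: "'x set \<Rightarrow> 'y set \<Rightarrow> ('x list \<Rightarrow> 'y list) \<Rightarrow> bool" where
  "logspace_computable X Y f \<longleftrightarrow>
     finite X \<and> finite Y \<and> f \<in> lists X \<rightarrow> lists Y \<and>
     (\<exists>M c. transducer X Y M \<and> (\<forall>w \<in> lists X. outputs M w (f w) \<and> logspace_bounded c M w))"

section \<open>Logspace normal forms\<close>

definition word_value :: "('a, 'm) monoid_scheme \<Rightarrow> 'a list \<Rightarrow> 'a" where
  "word_value G w = foldr (mult G) w (one G)"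

definition symmetric_generating_set :: "('a, 'm) monoid_scheme \<Rightarrow> 'a set \<Rightarrow> bool" where
  "symmetric_generating_set G X \<longleftrightarrow>
     X \<subseteq> carrier G \<and> (\<forall>x \<in> X. inv\<^bsub>G\<^esub> x \<in> X) \<and> generate G X = carrier G"

definition normal_form :: "('a, 'm) monoid_scheme \<Rightarrow> 'a set \<Rightarrow> 'a list set \<Rightarrow> bool" where
  "normal_form G X L \<longleftrightarrow> L \<subseteq> lists X \<and> bij_betw (word_value G) L (carrier G)"

definition logspace_normal_form_function ::
    "('a, 'm) monoid_scheme \<Rightarrow> 'a set \<Rightarrow> ('a list \<Rightarrow> 'a list) \<Rightarrow> bool" where
  "logspace_normal_form_function G X f \<longleftrightarrow>
     logspace_computable X X f \<and>
     (\<exists>L. normal_form G X L \<and> (\<forall>w \<in> lists X. f w \<in> L \<and> word_value G (f w) = word_value G w))"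

definition has_logspace_normal_form :: "('a, 'm) monoid_scheme \<Rightarrow> bool" where
  "has_logspace_normal_form G \<longleftrightarrow>
     (\<exists>X f. finite X \<and> symmetric_generating_set G X \<and> logspace_normal_form_function G X f)"

text \<open>
  The ambient group may be taken to have elements of type \<^typ>\<open>nat\<close>: a group with a logspace
  normal form is finitely generated, hence countable, hence isomorphic to a group whose carrier is
  a set of natural numbers, and having a logspace normal form is invariant under isomorphism.
\<close>

definition logspace_embeddable :: "('a, 'm) monoid_scheme \<Rightarrow> bool" where
  "logspace_embeddable G \<longleftrightarrow>
     (\<exists>H :: nat monoid. group H \<and> has_logspace_normal_form H \<and> (\<exists>\<phi>. \<phi> \<in> mon G H))"

section \<open>Finitely generated nilpotent groups\<close>

definition finitely_generated :: "('a, 'm) monoid_scheme \<Rightarrow> bool" where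
  "finitely_generated G \<longleftrightarrow> (\<exists>S \<subseteq> carrier G. finite S \<and> generate G S = carrier G)"

text \<open>\<open>lower_central G k\<close> is the term usually written \<open>\<gamma>\<^sub>k\<^sub>+\<^sub>1(G)\<close>.\<close>

fun lower_central :: "('a, 'm) monoid_scheme \<Rightarrow> nat \<Rightarrow> 'a set" where
  "lower_central G 0 = carrier G"
| "lower_central G (Suc k) =
     generate G {x \<otimes>\<^bsub>G\<^esub> y \<otimes>\<^bsub>G\<^esub> inv\<^bsub>G\<^esub> x \<otimes>\<^bsub>G\<^esub> inv\<^bsub>G\<^esub> y | x y. x \<in> lower_central G k \<and> y \<in> carrier G}"

definition nilpotent :: "('a, 'm) monoid_scheme \<Rightarrow> bool" where
  "nilpotent G \<longleftrightarrow> (\<exists>k. lower_central G k = {\<one>\<^bsub>G\<^esub>})"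

end

theory Submission
  imports Defs "HOL-Library.Countable_Set"
begin

text \<open>
  A finitely generated nilpotent group \<open>G\<close> has a logspace normal form itself, so that the only
  embedding needed is a renaming of its elements by natural numbers.

  Coordinates.  There are subgroups \<open>G = N\<^sub>0 \<supseteq> N\<^sub>1 \<supseteq> \<dots> \<supseteq> N\<^sub>r = T\<close> with \<open>T\<close> finite, in which
  each \<open>N\<^sub>i\<close> with \<open>i > 0\<close> is the kernel of a homomorphism from its predecessor onto the integers:
  an infinite subgroup of \<open>G\<close> maps onto the integers by a transfer argument
  (\<open>infinite_has_surjection\<close>), and the Hirsch length drops from a subgroup to the kernel
  (\<open>infinite_factors_kernel\<close>).  If \<open>t\<^sub>i\<close> is sent to 1, every element of \<open>G\<close> is the product of a power
  of \<open>t\<^sub>1\<close>, a power of \<open>t\<^sub>2\<close>, ..., a power of \<open>t\<^sub>r\<close> and an element of \<open>T\<close>; this is the normal form.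
  Two facts make it computable (\<open>tower_exists\<close>).  First, the homomorphisms extend to functions
  \<open>e\<^sub>i\<close> on \<open>G\<close> that are polynomial, i.e. are annihilated by sufficiently many left difference
  operators \<open>f \<mapsto> f (x \<cdot>) - f\<close>; this is where nilpotency enters (\<open>wpoly_conj_diff\<close>,
  \<open>poly_extend\<close>).  Secondly, some subgroup \<open>K\<close> of finite index meets \<open>T\<close> trivially, so that an
  element of \<open>T\<close> is known from its coset of \<open>K\<close>.

  Machines.  The iterated differences of the \<open>e\<^sub>i\<close> with respect to generators form a finite set
  \<open>\<Phi>\<close>, and \<open>\<phi> (x g) = \<phi> g + (diff x \<phi>) g\<close>.  Hence left multiplication of \<open>g\<close> by a generator
  changes the vector \<open>(\<phi> g)\<close> by a fixed linear map and permutes the cosets \<open>g K\<close>.  A machine that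
  keeps this vector and this coset reads a word from right to left to obtain them for the element
  \<open>g\<close> that the word represents.  Then it repeatedly takes the first \<open>i\<close> with \<open>e\<^sub>i g \<noteq> 0\<close>, prints
  \<open>t\<^sub>i\<close> or its inverse according to the sign, and divides it off on the left.  Once all \<open>e\<^sub>i g\<close> are
  0, the remaining element of \<open>T\<close> is printed.  What is printed depends on \<open>g\<close> only.

  Space.  A polynomial function grows polynomially in the word length (\<open>poly_growth\<close>), and so do
  the numbers of letters divided off (\<open>grow_polynomial\<close>).  Therefore the entries of the vector
  always have \<open>O(log n)\<close> digits.  A transducer can store them in balanced ternary, one tape square for
  each digit position, and apply a fixed affine map in one sweep over the tape, because the carries
  are bounded (\<open>logspace_computable_if_polynomial\<close>).
\<close>

section \<open>Runs of a step function\<close>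

text \<open>
  The predicate \<open>P\<close> is required of every configuration on the way, endpoints included.  In this
  form space bounds, and bounds on vectors, compose along with the runs.
\<close>

inductive leads :: "('c \<Rightarrow> 'c) \<Rightarrow> ('c \<Rightarrow> bool) \<Rightarrow> 'c \<Rightarrow> 'c \<Rightarrow> bool" for f P where
  refl: "P c \<Longrightarrow> leads f P c c"
| step: "P c \<Longrightarrow> leads f P (f c) d \<Longrightarrow> leads f P c d"

lemma leads_trans: "leads f P a b \<Longrightarrow> leads f P b c \<Longrightarrow> leads f P a c"
  by (induction rule: leads.induct) (auto intro: leads.step)

lemma leads_funpow:
  assumes "leads f P c d"
  shows "\<exists>n. (f ^^ n) c = d \<and> (\<forall>k\<le>n. P ((f ^^ k) c))"
  using assms
proof induction
  case (refl c)
  then show ?case by (intro exI[of _ 0]) auto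
next
  case (step c d)
  then obtain n where n: "(f ^^ n) (f c) = d" "\<forall>k\<le>n. P ((f ^^ k) (f c))" by blast
  have "P ((f ^^ k) c)" if "k \<le> Suc n" for k
    using that n step.hyps by (cases k) (auto simp: funpow_swap1)
  with n show ?case by (intro exI[of _ "Suc n"]) (auto simp: funpow_swap1)
qed

lemma leads_mono: "leads f P c d \<Longrightarrow> (\<And>x. P x \<Longrightarrow> Q x) \<Longrightarrow> leads f Q c d"
  by (induction rule: leads.induct) (auto intro: leads.intros)

section \<open>Transducers with arbitrary states and work symbols\<close>

definition tape_alphabet :: "'x set \<Rightarrow> 'x input_symbol set" where
  "tape_alphabet X = insert Left_End (insert Right_End (Letter ` X))"

lemma scanned_in_alphabet: "w \<in> lists X \<Longrightarrow> scanned w i \<in> tape_alphabet X"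
  by (auto simp: scanned_def tape_alphabet_def in_lists_conv_set)

text \<open>
  Finite sets of states and work symbols of any types can be numbered.  The closure condition is
  confined to states that are not final, since \<open>coded\<close> below lets final states idle.
\<close>

locale abstract_transducer =
  fixes X :: "'x set" and Y :: "'y set"
    and Q :: "'q set" and S :: "'s set" and q0 :: 'q and F :: "'q set" and bl :: 's
    and \<delta> :: "'q \<Rightarrow> 'x input_symbol \<Rightarrow> 's \<Rightarrow> 'q \<times> 's \<times> direction \<times> direction \<times> 'y list"
    and k :: nat
  assumes finite_Q: "finite Q" and finite_S: "finite S"
    and q0: "q0 \<in> Q" and F: "F \<subseteq> Q" and bl: "bl \<in> S"
    and closed: "\<lbrakk>q \<in> Q - F; s \<in> tape_alphabet X; a \<in> S; \<delta> q s a = (q', b, d, e, out)\<rbrakk> \<Longrightarrow>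
      q' \<in> Q \<and> b \<in> S \<and> out \<in> lists Y \<and> length out \<le> k"
begin

definition state_code :: "'q \<Rightarrow> nat" where
  "state_code = (SOME f. inj_on f Q)"

definition symbol_code :: "'s \<Rightarrow> nat" where
  "symbol_code = (SOME f. inj_on f S)"

lemma inj_state_code: "inj_on state_code Q"
  unfolding state_code_def
  using finite_imp_inj_to_nat_seg[OF finite_Q] someI_ex[of "\<lambda>f. inj_on f Q"] by metis

lemma inj_symbol_code: "inj_on symbol_code S"
  unfolding symbol_code_def
  using finite_imp_inj_to_nat_seg[OF finite_S] someI_ex[of "\<lambda>f. inj_on f S"] by metis

definition coded :: "('x, 'y) transducer" where
  "coded = \<lparr>states = state_code ` Q, work_symbols = symbol_code ` S, start_state = state_code q0,
     final_states = state_code ` F, blank = symbol_code bl,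
     trans = (\<lambda>q s a.
       let q' = inv_into Q state_code q in
       if q' \<in> F then (q, a, Stay, Stay, []) else
       case \<delta> q' s (inv_into S symbol_code a) of
         (r, b, d, e, out) \<Rightarrow> (state_code r, symbol_code b, d, e, out))\<rparr>"

definition conf :: "'q \<Rightarrow> nat \<Rightarrow> (nat \<Rightarrow> 's) \<Rightarrow> nat \<Rightarrow> 'y list \<Rightarrow> 'y config" where
  "conf q i T p out = \<lparr>state = state_code q, in_pos = i, work_tape = symbol_code \<circ> T,
     work_pos = p, out_tape = out\<rparr>"

lemma transducer_coded: "transducer X Y coded"
proof -
  have closed_coded: "case trans coded q s a of (q', b, d, e, out) \<Rightarrow>
          q' \<in> states coded \<and> b \<in> work_symbols coded \<and> out \<in> lists Y \<and> length out \<le> k"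
    if hq: "q \<in> states coded" and s: "s \<in> insert Left_End (insert Right_End (Letter ` X))"
      and a: "a \<in> work_symbols coded" for q s a
  proof -
    obtain q' where q': "q' \<in> Q" "q = state_code q'" using hq by (auto simp: coded_def)
    obtain a' where a': "a' \<in> S" "a = symbol_code a'" using a by (auto simp: coded_def)
    obtain r b d e out where r: "\<delta> q' s a' = (r, b, d, e, out)" by (rule prod_cases5)
    show ?thesis
    proof (cases "q' \<in> F")
      case True
      then have "trans coded q s a = (q, a, Stay, Stay, [])"
        by (simp add: coded_def q' Let_def inv_into_f_f[OF inj_state_code])
      then show ?thesis using hq a by simp
    next
      case False
      have "r \<in> Q \<and> b \<in> S \<and> out \<in> lists Y \<and> length out \<le> k"
        using closed[OF _ _ _ r] q' a' s False by (simp add: tape_alphabet_def)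
      moreover have "trans coded q s a = (state_code r, symbol_code b, d, e, out)"
        using False by (simp add: coded_def q' a' r Let_def inv_into_f_f[OF inj_state_code]
            inv_into_f_f[OF inj_symbol_code])
      ultimately show ?thesis by (simp add: coded_def)
    qed
  qed
  have "\<exists>k. \<forall>q \<in> states coded. \<forall>s \<in> insert Left_End (insert Right_End (Letter ` X)).
      \<forall>a \<in> work_symbols coded. case trans coded q s a of (q', b, d, e, out) \<Rightarrow>
        q' \<in> states coded \<and> b \<in> work_symbols coded \<and> out \<in> lists Y \<and> length out \<le> k"
    by (intro exI[of _ k] ballI) (rule closed_coded)
  moreover have "finite (states coded)" "finite (work_symbols coded)" "start_state coded \<in> states coded"
    "final_states coded \<subseteq> states coded" "blank coded \<in> work_symbols coded"
    using finite_Q finite_S q0 image_mono[OF F] bl by (simp_all add: coded_def)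
  ultimately show ?thesis unfolding transducer_def by (intro conjI)
qed

lemma initial_coded: "initial coded = conf q0 0 (\<lambda>_. bl) 0 []"
  by (auto simp: initial_def coded_def conf_def)

lemma final_conf: "q \<in> Q \<Longrightarrow> state (conf q i T p out) \<in> final_states coded \<longleftrightarrow> q \<in> F"
  using inj_on_image_mem_iff[OF inj_state_code _ F] by (simp add: conf_def coded_def)

lemma step_conf:
  assumes "q \<in> Q - F" "T p \<in> S" "\<delta> q (scanned w i) (T p) = (q', b, d, e, out')"
  shows "step coded w (conf q i T p out) =
    conf q' (min (move d i) (length w + 1)) (T(p := b)) (move e p) (out @ out')"
proof -
  have "state_code q \<notin> state_code ` F" using assms(1) inj_on_image_mem_iff[OF inj_state_code _ F] by simp
  then show ?thesis
    using assms
    by (simp add: step_def conf_def coded_def inv_into_f_f[OF inj_state_code]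
          inv_into_f_f[OF inj_symbol_code] Let_def fun_upd_comp)
qed

lemma leads_final:
  assumes "leads (step coded w) (\<lambda>c. work_pos c \<le> W) (initial coded) c"
    and "state c \<in> final_states coded"
  shows "outputs coded w (out_tape c)" and "work_pos (run coded w t) \<le> W"
proof -
  obtain n where n: "(step coded w ^^ n) (initial coded) = c"
    "\<forall>k\<le>n. work_pos ((step coded w ^^ k) (initial coded)) \<le> W"
    using leads_funpow[OF assms(1)] by blast
  show "outputs coded w (out_tape c)"
    using n assms(2) unfolding outputs_def run_def by blast
  have stable: "(step coded w ^^ m) c = c" for m
    by (induction m) (use assms(2) in \<open>auto simp: step_def\<close>)
  show "work_pos (run coded w t) \<le> W"
  proof (cases "t \<le> n")
    case True
    then show ?thesis using n by (simp add: run_def)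
  next
    case False
    then have "(step coded w ^^ ((t - n) + n)) (initial coded) = (step coded w ^^ (t - n)) c"
      unfolding n(1)[symmetric] funpow_add by simp
    with False have "run coded w t = (step coded w ^^ (t - n)) c"
      by (simp add: run_def)
    then show ?thesis using stable n by auto
  qed
qed

end

section \<open>Balanced ternary\<close>

text \<open>
  The digits are -1, 0 and 1.  Negative numbers then need neither a sign nor infinitely many
  digits, and signs can be read off: the leading nonzero digit is the sign.
\<close>

definition digit :: "int \<Rightarrow> int" where "digit t = (t + 1) mod 3 - 1"
definition carry :: "int \<Rightarrow> int" where "carry t = (t + 1) div 3"

lemma digit_carry: "t = digit t + 3 * carry t"
  using mult_div_mod_eq[of 3 "t + 1"] unfolding digit_def carry_def by linarith

lemma digit_range: "digit t \<in> {-1..1}"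
proof -
  have "0 \<le> (t + 1) mod 3" "(t + 1) mod 3 < 3" by simp_all
  then show ?thesis unfolding digit_def atLeastAtMost_iff by linarith
qed

lemma digit_0 [simp]: "digit 0 = 0" and carry_0 [simp]: "carry 0 = 0"
  by (simp_all add: digit_def carry_def)

lemma carry_bound: "\<bar>t\<bar> \<le> 2 * B \<Longrightarrow> 1 \<le> B \<Longrightarrow> \<bar>carry t\<bar> \<le> B"
  using digit_carry[of t] digit_range[of t] by auto

text \<open>
  The head of the list is the least significant position; a digit is a whole vector of digits, one
  for each coordinate.
\<close>

fun tern :: "('i \<Rightarrow> int) list \<Rightarrow> 'i \<Rightarrow> int" where
  "tern [] i = 0"
| "tern (d # ds) i = d i + 3 * tern ds i"

lemma tern_Nil: "tern [] = (\<lambda>_. 0)"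
  by (rule ext) simp

lemma tern_append: "tern (xs @ ys) i = tern xs i + 3 ^ length xs * tern ys i"
  by (induction xs) (auto simp: algebra_simps)

lemma tern_bound: "(\<And>d. d \<in> set ds \<Longrightarrow> d i \<in> {-1..1}) \<Longrightarrow> 2 * \<bar>tern ds i\<bar> < 3 ^ length ds"
proof (induction ds)
  case (Cons d ds)
  have "\<bar>d i\<bar> \<le> 1" using Cons.prems[of d] by auto
  moreover have "2 * \<bar>tern ds i\<bar> < 3 ^ length ds" using Cons by auto
  moreover have "\<bar>d i + 3 * tern ds i\<bar> \<le> \<bar>d i\<bar> + 3 * \<bar>tern ds i\<bar>"
    using abs_triangle_ineq[of "d i" "3 * tern ds i"] by (simp add: abs_mult)
  ultimately show ?case by simp
qed auto

text \<open>
  The digits below position \<open>k\<close> contribute less than half of \<open>3^k\<close>, so that they cannot outweigh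
  a nonzero digit there.
\<close>

lemma sgn_leading_digit:
  fixes d a :: int
  assumes "d \<in> {-1..1}" "2 * \<bar>a\<bar> < 3 ^ k"
  shows "sgn (a + 3 ^ k * d) = (if d = 0 then sgn a else d)"
proof -
  have "d = -1 \<or> d = 0 \<or> d = 1" using assms by auto
  then show ?thesis using assms(2) by (auto simp: sgn_if)
qed

section \<open>Linear machines\<close>

text \<open>
  \<open>Rest p \<sigma>\<close> is the state between two steps of a linear machine, with the work head on the
  marker in square 0; \<open>\<sigma>\<close> is the vector of signs that its next step may consult.  A step is a
  \<open>Sweep\<close> to the right, whose last argument is the carry, followed by a \<open>Return\<close> to the marker that
  collects the new signs.
\<close>

datatype ('p, 'u, 'i) ctrl =
  Boot | Rest 'p "'i \<Rightarrow> int" | Sweep 'p 'u "'i \<Rightarrow> int" | Return 'p "'i \<Rightarrow> int"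

datatype 'i cell = Blank | Mark | Dig "'i \<Rightarrow> int"

text \<open>
  Apart from its finite control, such a machine holds an integer vector indexed by \<open>I\<close>.  In one step
  it consults its control state, the scanned input symbol and the signs of the coordinates, and
  then replaces the vector \<open>v\<close> by \<open>A u v + b u\<close> with \<open>u\<close> from the finite set \<open>U\<close>.
\<close>

locale linear_machine =
  fixes X :: "'x set" and Y :: "'y set"
    and P :: "'p set" and p0 :: 'p and PF :: "'p set"
    and I :: "'i set" and U :: "'u set"
    and A :: "'u \<Rightarrow> 'i \<Rightarrow> 'i \<Rightarrow> int" and b :: "'u \<Rightarrow> 'i \<Rightarrow> int"
    and \<Delta> :: "'p \<Rightarrow> 'x input_symbol \<Rightarrow> ('i \<Rightarrow> int) \<Rightarrow> 'p \<times> 'u \<times> direction \<times> 'y list"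
    and k :: nat
  assumes finite_X: "finite X" and finite_Y: "finite Y"
    and finite_P: "finite P" and finite_I: "finite I" and finite_U: "finite U"
    and p0: "p0 \<in> P" and PF: "PF \<subseteq> P"
    and closed_\<Delta>: "\<lbrakk>p \<in> P - PF; s \<in> tape_alphabet X; \<Delta> p s \<sigma> = (p', u, d, out)\<rbrakk> \<Longrightarrow>
      p' \<in> P \<and> u \<in> U \<and> out \<in> lists Y \<and> length out \<le> k"
begin

definition update :: "'u \<Rightarrow> ('i \<Rightarrow> int) \<Rightarrow> ('i \<Rightarrow> int) \<Rightarrow> 'i \<Rightarrow> int" where
  "update u v c = (\<lambda>i. if i \<in> I then (\<Sum>j\<in>I. A u i j * v j) + c i else 0)"

definition offset :: "'u \<Rightarrow> 'i \<Rightarrow> int" where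
  "offset u = (\<lambda>i. if i \<in> I then b u i else 0)"

fun mstep :: "'x list \<Rightarrow> 'p \<times> nat \<times> ('i \<Rightarrow> int) \<times> 'y list \<Rightarrow> 'p \<times> nat \<times> ('i \<Rightarrow> int) \<times> 'y list" where
  "mstep w (p, i, v, out) = (if p \<in> PF then (p, i, v, out) else
     (case \<Delta> p (scanned w i) (\<lambda>j. sgn (v j)) of
       (p', u, d, out') \<Rightarrow> (p', min (move d i) (length w + 1), update u v (offset u), out @ out')))"

text \<open>
  An absolute bound \<open>B\<close> for all carries.  It exceeds every absolute row sum, so that
  a carry up to \<open>B\<close> gives an intermediate value up to \<open>2 B\<close> and hence again a carry up to \<open>B\<close>.
\<close>

definition bound :: int where
  "bound = 1 + (\<Sum>u\<in>U. \<Sum>i\<in>I. \<bar>b u i\<bar> + (\<Sum>j\<in>I. \<bar>A u i j\<bar>))"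

definition vectors :: "int \<Rightarrow> ('i \<Rightarrow> int) set" where
  "vectors B = {v. \<forall>i. (i \<in> I \<longrightarrow> v i \<in> {-B..B}) \<and> (i \<notin> I \<longrightarrow> v i = 0)}"

lemma finite_vectors: "finite (vectors B)"
  unfolding vectors_def using finite_set_of_finite_funs[OF finite_I, of "{-B..B}" 0] by simp

lemma row_bound:
  assumes "u \<in> U" "i \<in> I"
  shows "\<bar>b u i\<bar> + (\<Sum>j\<in>I. \<bar>A u i j\<bar>) < bound"
proof -
  let ?f = "\<lambda>u i. \<bar>b u i\<bar> + (\<Sum>j\<in>I. \<bar>A u i j\<bar>)"
  have nn: "0 \<le> ?f u i" for u i by (simp add: sum_nonneg)
  have "?f u i \<le> (\<Sum>i\<in>I. ?f u i)"
    using assms finite_I nn by (intro member_le_sum) auto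
  also have "\<dots> \<le> (\<Sum>u\<in>U. \<Sum>i\<in>I. ?f u i)"
    using assms finite_U nn by (intro member_le_sum[of u U "\<lambda>u. \<Sum>i\<in>I. ?f u i"]) (auto intro!: sum_nonneg)
  finally show ?thesis by (simp add: bound_def)
qed

lemma bound_ge_1: "1 \<le> bound"
  by (simp add: bound_def sum_nonneg)

lemma offset_in: "u \<in> U \<Longrightarrow> offset u \<in> vectors bound"
proof -
  assume u: "u \<in> U"
  have "\<bar>b u i\<bar> \<le> bound" if "i \<in> I" for i
  proof -
    have "0 \<le> (\<Sum>j\<in>I. \<bar>A u i j\<bar>)" by (simp add: sum_nonneg)
    then show ?thesis using row_bound[OF u that] by linarith
  qed
  then show ?thesis by (fastforce simp: offset_def vectors_def)
qed

lemma update_digit_bound: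
  assumes "u \<in> U" "d \<in> vectors 1" "c \<in> vectors bound"
  shows "\<bar>update u d c i\<bar> \<le> 2 * bound"
proof (cases "i \<in> I")
  case True
  have "\<bar>\<Sum>j\<in>I. A u i j * d j\<bar> \<le> (\<Sum>j\<in>I. \<bar>A u i j * d j\<bar>)" by (rule sum_abs)
  also have "\<dots> \<le> (\<Sum>j\<in>I. \<bar>A u i j\<bar>)"
  proof (rule sum_mono)
    fix j assume "j \<in> I"
    then have "\<bar>d j\<bar> \<le> 1" using assms(2) by (auto simp: vectors_def abs_le_iff)
    then show "\<bar>A u i j * d j\<bar> \<le> \<bar>A u i j\<bar>" by (simp add: abs_mult mult_left_le)
  qed
  also have "\<dots> \<le> bound" using row_bound[OF assms(1) True] by simp
  finally have "\<bar>\<Sum>j\<in>I. A u i j * d j\<bar> \<le> bound" .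
  moreover have "\<bar>c i\<bar> \<le> bound" using assms(3) True by (auto simp: vectors_def abs_le_iff)
  ultimately show ?thesis using True by (simp add: update_def)
qed (use bound_ge_1 in \<open>simp add: update_def\<close>)

lemma update_outside: "i \<notin> I \<Longrightarrow> update u d c i = 0"
  by (simp add: update_def)

lemma carry_in:
  assumes "u \<in> U" "d \<in> vectors 1" "c \<in> vectors bound"
  shows "carry \<circ> update u d c \<in> vectors bound"
  using carry_bound[OF update_digit_bound[OF assms] bound_ge_1]
  by (auto simp: vectors_def update_outside abs_le_iff) (metis minus_le_iff)+

lemma digit_in: "digit \<circ> update u d c \<in> vectors 1"
  using digit_range by (auto simp: vectors_def update_outside)

text \<open>
  One step of the sweep: the lowest digits of the result are final, and what remains to be computed
  is an update of the remaining digits, with the carry in place of the constant vector.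
\<close>

lemma update_tern_Cons:
  "update u (tern (d # ds)) c i =
     digit (update u d c i) + 3 * update u (tern ds) (carry \<circ> update u d c) i"
proof (cases "i \<in> I")
  case True
  have "update u (tern (d # ds)) c i = update u d c i + 3 * (\<Sum>j\<in>I. A u i j * tern ds j)"
    using True by (simp add: update_def algebra_simps sum.distrib sum_distrib_left)
  then show ?thesis
    using digit_carry[of "update u d c i"] True by (simp add: update_def[of u "tern ds"])
qed (simp add: update_def)

section \<open>The transducer of a linear machine\<close>

fun \<delta> :: "('p, 'u, 'i) ctrl \<Rightarrow> 'x input_symbol \<Rightarrow> 'i cell \<Rightarrow>
    ('p, 'u, 'i) ctrl \<times> 'i cell \<times> direction \<times> direction \<times> 'y list" where
  "\<delta> Boot s a = (Rest p0 (\<lambda>_. 0), Mark, Stay, Stay, [])"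
| "\<delta> (Rest p \<sigma>) s a = (case \<Delta> p s \<sigma> of (p', u, d, out) \<Rightarrow>
      (Sweep p' u (offset u), a, d, Move_Right, out))"
| "\<delta> (Sweep p u c) s (Dig d) =
      (Sweep p u (carry \<circ> update u d c), Dig (digit \<circ> update u d c), Stay, Move_Right, [])"
| "\<delta> (Sweep p u c) s a = (if c = (\<lambda>_. 0) then (Return p (\<lambda>_. 0), a, Stay, Move_Left, [])
      else (Sweep p u (carry \<circ> update u (\<lambda>_. 0) c), Dig (digit \<circ> update u (\<lambda>_. 0) c),
            Stay, Move_Right, []))"
| "\<delta> (Return p \<sigma>) s (Dig d) =
      (Return p (\<lambda>i. if \<sigma> i = 0 then d i else \<sigma> i), Dig d, Stay, Move_Left, [])"
| "\<delta> (Return p \<sigma>) s a = (Rest p \<sigma>, a, Stay, Stay, [])"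

definition states_of :: "('p, 'u, 'i) ctrl set" where
  "states_of = insert Boot
     (case_prod Rest ` (P \<times> vectors 1) \<union> case_prod Return ` (P \<times> vectors 1) \<union>
      (\<lambda>(p, u, c). Sweep p u c) ` (P \<times> U \<times> vectors bound))"

definition cells :: "'i cell set" where
  "cells = insert Blank (insert Mark (Dig ` vectors 1))"

lemma states_simps:
  "Boot \<in> states_of"
  "Rest p \<sigma> \<in> states_of \<longleftrightarrow> p \<in> P \<and> \<sigma> \<in> vectors 1"
  "Return p \<sigma> \<in> states_of \<longleftrightarrow> p \<in> P \<and> \<sigma> \<in> vectors 1"
  "Sweep p u c \<in> states_of \<longleftrightarrow> p \<in> P \<and> u \<in> U \<and> c \<in> vectors bound"
  by (auto simp: states_of_def image_iff)

lemma cells_simps: "Blank \<in> cells" "Mark \<in> cells" "Dig d \<in> cells \<longleftrightarrow> d \<in> vectors 1"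
  by (auto simp: cells_def)

lemma zero_in: "(\<lambda>_. 0) \<in> vectors B \<longleftrightarrow> 0 \<le> B \<or> I = {}"
  by (auto simp: vectors_def)

lemma merge_in: "\<sigma> \<in> vectors 1 \<Longrightarrow> d \<in> vectors 1 \<Longrightarrow> (\<lambda>i. if \<sigma> i = 0 then d i else \<sigma> i) \<in> vectors 1"
  by (auto simp: vectors_def)

definition final_of :: "('p, 'u, 'i) ctrl set" where
  "final_of = case_prod Rest ` (PF \<times> vectors 1)"

sublocale abstract_transducer X Y states_of cells Boot final_of Blank \<delta> k
proof
  show "finite states_of" "finite cells"
    by (auto simp: states_of_def cells_def finite_vectors finite_P finite_U)
  show "Boot \<in> states_of" "Blank \<in> cells" by (simp_all add: states_simps cells_simps)
  show "final_of \<subseteq> states_of" using PF by (auto simp: final_of_def states_simps)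
  fix q s a q' e d d' out
  assume q: "q \<in> states_of - final_of" and s: "s \<in> tape_alphabet X" and a: "a \<in> cells"
    and step: "\<delta> q s a = (q', e, d, d', out)"
  have z: "(\<lambda>_. 0) \<in> vectors 1" "(\<lambda>_. 0) \<in> vectors bound" using bound_ge_1 by (auto simp: zero_in)
  show "q' \<in> states_of \<and> e \<in> cells \<and> out \<in> lists Y \<and> length out \<le> k"
  proof (cases q)
    case Boot
    then show ?thesis using step p0 z by (auto simp: states_simps cells_simps)
  next
    case (Rest p \<sigma>)
    then have p: "p \<in> P - PF" using q by (auto simp: states_simps final_of_def)
    obtain p' u d1 out' where r: "\<Delta> p s \<sigma> = (p', u, d1, out')" by (rule prod_cases4)
    show ?thesis
      using closed_\<Delta>[OF p s r] step Rest r a offset_in by (auto simp: states_simps)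
  next
    case (Sweep p u c)
    then have h: "p \<in> P" "u \<in> U" "c \<in> vectors bound" using q by (auto simp: states_simps)
    show ?thesis
    proof (cases "(\<exists>d. a = Dig d) \<or> c \<noteq> (\<lambda>_. 0)")
      case True
      then obtain d where d: "d \<in> vectors 1" and
        "\<delta> q s a = (Sweep p u (carry \<circ> update u d c), Dig (digit \<circ> update u d c), Stay, Move_Right, [])"
        using Sweep a z by (cases a) (auto simp: cells_simps)
      then have "q' = Sweep p u (carry \<circ> update u d c)" "e = Dig (digit \<circ> update u d c)" "out = []"
        using step by auto
      then show ?thesis using h carry_in[OF h(2) d h(3)] digit_in by (simp add: states_simps cells_simps)
    next
      case False
      then have "\<delta> q s a = (Return p (\<lambda>_. 0), a, Stay, Move_Left, [])" using Sweep by (cases a) auto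
      then show ?thesis using step h a z by (auto simp: states_simps)
    qed
  next
    case (Return p \<sigma>)
    then show ?thesis using step q a merge_in
      by (cases a) (auto simp: states_simps cells_simps)
  qed
qed

text \<open>
  Square 0 carries the marker that stops the leftward move of the head.
\<close>

definition tape :: "('i \<Rightarrow> int) list \<Rightarrow> nat \<Rightarrow> 'i cell" where
  "tape ds n = (if n = 0 then Mark else if n \<le> length ds then Dig (ds ! (n - 1)) else Blank)"

lemma tape_0: "tape ds 0 = Mark"
  by (simp add: tape_def)

lemma tape_Suc: "tape (xs @ d # ys) (Suc (length xs)) = Dig d"
  by (simp add: tape_def)

lemma tape_end: "tape ds (Suc (length ds)) = Blank"
  by (simp add: tape_def)

lemma tape_write: "(tape (xs @ d # ys))(Suc (length xs) := Dig d') = tape (xs @ d' # ys)"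
  by (rule ext) (auto simp: tape_def nth_append nth_Cons')

lemma tape_extend: "(tape xs)(Suc (length xs) := Dig d) = tape (xs @ [d])"
  by (rule ext) (auto simp: tape_def nth_append)

lemma tape_rewrite: "(tape xs)(0 := Mark) = tape xs" "(tape xs)(Suc (length xs) := Blank) = tape xs"
  by (rule ext; simp add: tape_def)+

lemma nonrest: "Boot \<notin> final_of" "Sweep p u c \<notin> final_of" "Return p \<sigma> \<notin> final_of"
  by (auto simp: final_of_def)

lemma step_Sweep_Dig:
  assumes "p \<in> P" "u \<in> U" "c \<in> vectors bound" "d \<in> vectors 1"
  shows "step coded w (conf (Sweep p u c) i (tape (xs @ d # ys)) (Suc (length xs)) out) =
    conf (Sweep p u (carry \<circ> update u d c)) (min i (length w + 1))
      (tape (xs @ (digit \<circ> update u d c) # ys)) (Suc (Suc (length xs))) out"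
  using step_conf[of "Sweep p u c" "tape (xs @ d # ys)" "Suc (length xs)" w i] assms
  by (simp add: states_simps nonrest tape_Suc cells_simps tape_write)

lemma step_Sweep_Blank:
  assumes "p \<in> P" "u \<in> U" "c \<in> vectors bound" "c \<noteq> (\<lambda>_. 0)"
  shows "step coded w (conf (Sweep p u c) i (tape xs) (Suc (length xs)) out) =
    conf (Sweep p u (carry \<circ> update u (\<lambda>_. 0) c)) (min i (length w + 1))
      (tape (xs @ [digit \<circ> update u (\<lambda>_. 0) c])) (Suc (Suc (length xs))) out"
  using step_conf[of "Sweep p u c" "tape xs" "Suc (length xs)" w i] assms
  by (simp add: states_simps nonrest tape_end cells_simps tape_extend)

lemma step_Sweep_turn:
  assumes "p \<in> P" "u \<in> U" "c \<in> vectors bound" "c = (\<lambda>_. 0)"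
  shows "step coded w (conf (Sweep p u c) i (tape xs) (Suc (length xs)) out) =
    conf (Return p (\<lambda>_. 0)) (min i (length w + 1)) (tape xs) (length xs) out"
  using step_conf[of "Sweep p u c" "tape xs" "Suc (length xs)" w i] assms
  by (simp add: states_simps nonrest tape_end cells_simps tape_rewrite)

lemma conf_work_pos [simp]: "work_pos (conf q i T n out) = n"
  by (simp add: conf_def)

abbreviation runs_within :: "'x list \<Rightarrow> nat \<Rightarrow> 'y config \<Rightarrow> 'y config \<Rightarrow> bool" where
  "runs_within w W \<equiv> leads (step coded w) (\<lambda>c. work_pos c \<le> W)"

text \<open>
  The part of the result that is still to be written is a number below \<open>3^L/2\<close> in absolute value,
  and each written digit divides it by 3.  After \<open>L\<close> digits it is 0, and then so is the carry.
  Therefore a carry that runs beyond the old digits never extends the tape further than the size of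
  the result demands.
\<close>

lemma sweep:
  assumes "p \<in> P" "u \<in> U" "i \<le> length w + 1"
  shows "\<lbrakk>c \<in> vectors bound; set ys \<subseteq> vectors 1; length ys \<le> L;
      \<forall>j. 2 * \<bar>update u (tern ys) c j\<bar> < 3 ^ L\<rbrakk> \<Longrightarrow>
    \<exists>zs. set zs \<subseteq> vectors 1 \<and> length zs \<le> L \<and> tern zs = update u (tern ys) c \<and>
      runs_within w (length xs + L + 1)
        (conf (Sweep p u c) i (tape (xs @ ys)) (Suc (length xs)) out)
        (conf (Return p (\<lambda>_. 0)) i (tape (xs @ zs)) (length (xs @ zs)) out)"
proof (induction L arbitrary: c xs ys)
  case 0
  have turn: "c = (\<lambda>_. 0)"
  proof
    fix j show "c j = 0"
    proof (cases "j \<in> I")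
      case True
      have "ys = []" "2 * \<bar>update u (tern ys) c j\<bar> < 1" using 0 by (simp_all add: tern_Nil)
      then show ?thesis using True by (simp add: update_def tern_Nil)
    qed (use 0 in \<open>simp add: vectors_def\<close>)
  qed
  have "runs_within w (length xs + 0 + 1)
      (conf (Sweep p u c) i (tape (xs @ ys)) (Suc (length xs)) out)
      (conf (Return p (\<lambda>_. 0)) i (tape xs) (length xs) out)"
    using step_Sweep_turn[OF assms(1,2) 0(1) turn, of w i xs out] 0 assms(3)
    by - (rule leads.step, auto intro: leads.refl)
  moreover have "tern [] = update u (tern ys) c"
    using 0 turn by (auto simp: update_def tern_Nil)
  ultimately show ?case by (intro exI[of _ "[]"]) auto
next
  case (Suc L)
  show ?case
  proof (cases "ys = [] \<and> c = (\<lambda>_. 0)")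
    case True
    have "runs_within w (length xs + Suc L + 1)
        (conf (Sweep p u c) i (tape (xs @ ys)) (Suc (length xs)) out)
        (conf (Return p (\<lambda>_. 0)) i (tape xs) (length xs) out)"
      using step_Sweep_turn[OF assms(1,2) Suc(2) conjunct2[OF True], of w i xs out] True assms(3)
      by - (rule leads.step, auto intro: leads.refl)
    moreover have "tern [] = update u (tern ys) c"
      using True by (auto simp: update_def tern_Nil)
    ultimately show ?thesis by (intro exI[of _ "[]"]) auto
  next
    case False
    define d where "d = (case ys of [] \<Rightarrow> (\<lambda>_. 0) | d # _ \<Rightarrow> d)"
    define c' where "c' = carry \<circ> update u d c"
    define d' where "d' = digit \<circ> update u d c"
    have d: "d \<in> vectors 1" using Suc.prems by (auto simp: d_def zero_in split: list.splits)
    have "step coded w (conf (Sweep p u c) i (tape (xs @ ys)) (Suc (length xs)) out) =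
        conf (Sweep p u c') i (tape ((xs @ [d']) @ tl ys)) (Suc (length (xs @ [d']))) out"
    proof (cases ys)
      case Nil
      then show ?thesis using step_Sweep_Blank[OF assms(1,2) Suc(2)] False assms(3)
        by (simp add: d_def c'_def d'_def)
    next
      case (Cons y ys')
      then show ?thesis using step_Sweep_Dig[OF assms(1,2) Suc(2), of y] d assms(3)
        by (simp add: d_def c'_def d'_def)
    qed
    note step1 = this
    have tl: "tern ys = tern (d # tl ys)" by (cases ys) (auto simp: d_def)
    have upd: "update u (tern ys) c j = d' j + 3 * update u (tern (tl ys)) c' j" for j
      unfolding tl update_tern_Cons d'_def c'_def by simp
    have d': "d' \<in> vectors 1" unfolding d'_def by (rule digit_in)
    have "c' \<in> vectors bound" unfolding c'_def by (rule carry_in[OF assms(2) d Suc(2)])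
    moreover have "set (tl ys) \<subseteq> vectors 1" using Suc.prems by (cases ys) auto
    moreover have "length (tl ys) \<le> L" using Suc.prems by auto
    moreover have "\<forall>j. 2 * \<bar>update u (tern (tl ys)) c' j\<bar> < 3 ^ L"
    proof
      fix j
      have "\<bar>d' j\<bar> \<le> 1" using d' by (cases "j \<in> I") (auto simp: vectors_def abs_le_iff)
      moreover have "2 * \<bar>update u (tern ys) c j\<bar> < 3 * 3 ^ L" using Suc.prems by simp
      moreover have "3 * \<bar>update u (tern (tl ys)) c' j\<bar> \<le> \<bar>update u (tern ys) c j\<bar> + \<bar>d' j\<bar>"
        using abs_triangle_ineq[of "update u (tern ys) c j" "- d' j"] by (simp add: upd abs_mult)
      ultimately have "2 * \<bar>update u (tern (tl ys)) c' j\<bar> \<le> 3 ^ L" by simp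
      \<comment> \<open>Rounding leaves only the weak inequality; it is strict because \<open>3 ^ L\<close> is odd.\<close>
      moreover have "2 * \<bar>update u (tern (tl ys)) c' j\<bar> \<noteq> 3 ^ L"
      proof
        assume "2 * \<bar>update u (tern (tl ys)) c' j\<bar> = 3 ^ L"
        then have "even (3 ^ L :: int)" by (intro dvdI) (rule sym)
        then show False by simp
      qed
      ultimately show "2 * \<bar>update u (tern (tl ys)) c' j\<bar> < 3 ^ L" by linarith
    qed
    ultimately obtain zs where zs: "set zs \<subseteq> vectors 1" "length zs \<le> L"
        "tern zs = update u (tern (tl ys)) c'"
        "runs_within w (length (xs @ [d']) + L + 1)
          (conf (Sweep p u c') i (tape ((xs @ [d']) @ tl ys)) (Suc (length (xs @ [d']))) out)
          (conf (Return p (\<lambda>_. 0)) i (tape ((xs @ [d']) @ zs)) (length ((xs @ [d']) @ zs)) out)"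
      using Suc.IH[of c' "tl ys" "xs @ [d']"] by blast
    have "runs_within w (length xs + Suc L + 1)
          (conf (Sweep p u c) i (tape (xs @ ys)) (Suc (length xs)) out)
          (conf (Return p (\<lambda>_. 0)) i (tape (xs @ d' # zs)) (length (xs @ d' # zs)) out)"
      using zs(4) step1 by - (rule leads.step, auto)
    moreover have "tern (d' # zs) = update u (tern ys) c"
      using upd zs(3) by auto
    ultimately show ?thesis using zs d' by (intro exI[of _ "d' # zs"]) auto
  qed
qed

lemma step_Return_Dig:
  assumes "p \<in> P" "\<sigma> \<in> vectors 1" "d \<in> vectors 1"
  shows "step coded w (conf (Return p \<sigma>) i (tape (xs @ d # ys)) (Suc (length xs)) out) =
    conf (Return p (\<lambda>i. if \<sigma> i = 0 then d i else \<sigma> i)) (min i (length w + 1))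
      (tape (xs @ d # ys)) (length xs) out"
  using step_conf[of "Return p \<sigma>" "tape (xs @ d # ys)" "Suc (length xs)" w i] assms
  by (simp add: states_simps nonrest tape_Suc cells_simps tape_write)

lemma step_Return_Mark:
  assumes "p \<in> P" "\<sigma> \<in> vectors 1"
  shows "step coded w (conf (Return p \<sigma>) i (tape ds) 0 out) =
    conf (Rest p \<sigma>) (min i (length w + 1)) (tape ds) 0 out"
  using step_conf[of "Return p \<sigma>" "tape ds" "0" w i] assms
  by (simp add: states_simps nonrest tape_0 cells_simps tape_rewrite)

text \<open>
  The head comes from the high end, so that the first nonzero digit that it meets in a coordinate is
  the leading one.
\<close>

lemma return:
  assumes "p \<in> P" "i \<le> length w + 1"
  shows "\<lbrakk>set (xs @ ys) \<subseteq> vectors 1; \<sigma> \<in> vectors 1; length xs \<le> W\<rbrakk> \<Longrightarrow>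
    runs_within w W
        (conf (Return p \<sigma>) i (tape (xs @ ys)) (length xs) out)
        (conf (Rest p (\<lambda>i. if \<sigma> i = 0 then sgn (tern xs i) else \<sigma> i)) i (tape (xs @ ys)) 0 out)"
proof (induction xs arbitrary: \<sigma> ys rule: rev_induct)
  case Nil
  have "(\<lambda>i. if \<sigma> i = 0 then sgn (tern [] i) else \<sigma> i) = \<sigma>" by (rule ext) simp
  then show ?case using step_Return_Mark[OF assms(1) Nil(2)] assms(2)
    by - (rule leads.step, auto intro: leads.refl)
next
  case (snoc d xs)
  let ?\<sigma> = "\<lambda>i. if \<sigma> i = 0 then d i else \<sigma> i"
  have d: "d \<in> vectors 1" using snoc.prems by simp
  have s: "?\<sigma> \<in> vectors 1" using snoc.prems d by (auto intro: merge_in)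
  have "(if ?\<sigma> i = 0 then sgn (tern xs i) else ?\<sigma> i) =
      (if \<sigma> i = 0 then sgn (tern (xs @ [d]) i) else \<sigma> i)" for i
  proof -
    have "e i \<in> {-1..1}" if "e \<in> vectors 1" for e
      using that by (cases "i \<in> I") (auto simp: vectors_def)
    then have "d i \<in> {-1..1}" "2 * \<bar>tern xs i\<bar> < 3 ^ length xs"
      using d snoc.prems by (blast, intro tern_bound) auto
    from sgn_leading_digit[OF this] show ?thesis by (simp add: tern_append)
  qed
  then have eq: "(\<lambda>i. if ?\<sigma> i = 0 then sgn (tern xs i) else ?\<sigma> i) =
      (\<lambda>i. if \<sigma> i = 0 then sgn (tern (xs @ [d]) i) else \<sigma> i)" by (rule ext)
  have "runs_within w W
      (conf (Return p ?\<sigma>) i (tape (xs @ d # ys)) (length xs) out)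
      (conf (Rest p (\<lambda>i. if ?\<sigma> i = 0 then sgn (tern xs i) else ?\<sigma> i)) i (tape (xs @ d # ys)) 0 out)"
    using snoc.IH[of "d # ys" ?\<sigma>] snoc.prems s by auto
  then show ?case
    using step_Return_Dig[OF assms(1) snoc.prems(2) d, of w i xs ys out] assms(2) snoc.prems(3)
    unfolding eq by - (rule leads.step, auto)
qed

definition simulates :: "nat \<Rightarrow> 'x list \<Rightarrow> 'p \<times> nat \<times> ('i \<Rightarrow> int) \<times> 'y list \<Rightarrow> 'y config \<Rightarrow> bool" where
  "simulates L w m c \<longleftrightarrow> (case m of (p, i, v, out) \<Rightarrow>
     p \<in> P \<and> i \<le> length w + 1 \<and> (\<exists>ds. set ds \<subseteq> vectors 1 \<and> length ds \<le> L \<and> tern ds = v \<and>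
       c = conf (Rest p (\<lambda>j. sgn (v j))) i (tape ds) 0 out))"

definition small :: "nat \<Rightarrow> 'p \<times> nat \<times> ('i \<Rightarrow> int) \<times> 'y list \<Rightarrow> bool" where
  "small L m \<longleftrightarrow> (case m of (p, i, v, out) \<Rightarrow> \<forall>j. 2 * \<bar>v j\<bar> < 3 ^ L)"

lemma sgn_in: "set ds \<subseteq> vectors 1 \<Longrightarrow> (\<lambda>j. sgn (tern ds j)) \<in> vectors 1"
proof -
  assume *: "set ds \<subseteq> vectors 1"
  have "tern ds j = 0" if "j \<notin> I" for j using * that by (induction ds) (auto simp: vectors_def)
  then show ?thesis by (auto simp: vectors_def sgn_if)
qed

lemma simulate_step:
  assumes sim: "simulates L w m c" and small: "small L (mstep w m)" and w: "w \<in> lists X"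
  shows "\<exists>c'. runs_within w (L + 1) c c' \<and> simulates L w (mstep w m) c'"
proof -
  obtain p i v out where m: "m = (p, i, v, out)" by (rule prod_cases4)
  obtain ds where ds: "set ds \<subseteq> vectors 1" "length ds \<le> L" "tern ds = v"
      "c = conf (Rest p (\<lambda>j. sgn (v j))) i (tape ds) 0 out" and p: "p \<in> P" and i: "i \<le> length w + 1"
    using sim m by (auto simp: simulates_def)
  show ?thesis
  proof (cases "p \<in> PF")
    case True
    then show ?thesis using sim m ds by (intro exI[of _ c]) (auto intro: leads.refl)
  next
    case False
    obtain p' u d out' where \<Delta>: "\<Delta> p (scanned w i) (\<lambda>j. sgn (v j)) = (p', u, d, out')"
      by (rule prod_cases4)
    define i' where "i' = min (move d i) (length w + 1)"
    have m': "mstep w m = (p', i', update u v (offset u), out @ out')"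
      using False \<Delta> by (simp add: m i'_def)
    have cl: "p' \<in> P" "u \<in> U" using closed_\<Delta>[OF _ scanned_in_alphabet[OF w] \<Delta>] p False by auto
    have \<sigma>: "(\<lambda>j. sgn (v j)) \<in> vectors 1" using sgn_in[OF ds(1)] ds(3) by simp
    then have "Rest p (\<lambda>j. sgn (v j)) \<in> states_of - final_of"
      using p False by (auto simp: states_simps final_of_def)
    then have 1: "step coded w c =
        conf (Sweep p' u (offset u)) i' (tape ([] @ ds)) (Suc (length ([]::('i \<Rightarrow> int) list))) (out @ out')"
      using step_conf[of "Rest p (\<lambda>j. sgn (v j))" "tape ds" 0 w i] \<Delta>
      by (simp add: ds(4) tape_0 cells_simps tape_rewrite i'_def)
    have i': "i' \<le> length w + 1" by (simp add: i'_def)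
    have "\<forall>j. 2 * \<bar>update u (tern ds) (offset u) j\<bar> < 3 ^ L"
      using small unfolding m' small_def ds(3) by simp
    from sweep[OF cl i' offset_in[OF cl(2)] ds(1,2) this, of "[]"] obtain zs where
      zs: "set zs \<subseteq> vectors 1" "length zs \<le> L" "tern zs = update u v (offset u)" and
      2: "runs_within w (L + 1) (step coded w c)
        (conf (Return p' (\<lambda>_. 0)) i' (tape zs) (length zs) (out @ out'))"
      unfolding 1 ds(3) by auto
    have 3: "runs_within w (L + 1)
        (conf (Return p' (\<lambda>_. 0)) i' (tape zs) (length zs) (out @ out'))
        (conf (Rest p' (\<lambda>i. sgn (tern zs i))) i' (tape zs) 0 (out @ out'))"
      using return[OF cl(1) i', of zs "[]" "\<lambda>_. 0" "L + 1" "out @ out'"] zs by (simp add: zero_in)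
    have "runs_within w (L + 1) c
        (conf (Rest p' (\<lambda>i. sgn (tern zs i))) i' (tape zs) 0 (out @ out'))"
      using leads.step[of _ c, OF _ leads_trans[OF 2 3]] ds(4) by simp
    moreover have "simulates L w (mstep w m)
        (conf (Rest p' (\<lambda>i. sgn (tern zs i))) i' (tape zs) 0 (out @ out'))"
      using zs cl i' by (auto simp: m' simulates_def)
    ultimately show ?thesis by blast
  qed
qed

lemma simulate:
  assumes "leads (mstep w) (small L) m m'" and w: "w \<in> lists X"
  shows "simulates L w m c \<Longrightarrow>
    \<exists>c'. runs_within w (L + 1) c c' \<and> simulates L w m' c'"
  using assms(1)
proof (induction arbitrary: c)
  case (refl m)
  then have "work_pos c \<le> L + 1" by (auto simp: simulates_def)
  then show ?case using refl by (intro exI[of _ c] conjI leads.refl)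
next
  case (step m m')
  have "small L (mstep w m)" by (rule leads.cases[OF step.hyps(2)]) simp_all
  from simulate_step[OF step.prems this w] obtain c1 where
    c1: "runs_within w (L + 1) c c1" "simulates L w (mstep w m) c1" by blast
  from step.IH[OF c1(2)] obtain c2 where
    "runs_within w (L + 1) c1 c2" "simulates L w m' c2" by blast
  with leads_trans[OF c1(1)] show ?case by blast
qed

definition start :: "'p \<times> nat \<times> ('i \<Rightarrow> int) \<times> 'y list" where
  "start = (p0, 0, \<lambda>_. 0, [])"

lemma run_simulated:
  assumes m: "leads (mstep w) (small L) start (p, i, v, out)" and p: "p \<in> PF" and w: "w \<in> lists X"
  shows "outputs coded w out" and "work_pos (run coded w t) \<le> L + 1"
proof -
  have blank: "(\<lambda>_. Blank)(0 := Mark) = tape []" by (rule ext) (simp add: tape_def)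
  have st: "step coded w (initial coded) = conf (Rest p0 (\<lambda>_. 0)) 0 (tape []) 0 []"
    unfolding initial_coded using step_conf[of Boot "\<lambda>_. Blank" 0 w 0]
    by (simp add: states_simps nonrest cells_simps blank)
  have "simulates L w start (step coded w (initial coded))"
    unfolding st using p0 by (auto simp: simulates_def start_def intro!: exI[of _ "[]"])
  from simulate[OF m w this] obtain c' where
    c': "runs_within w (L + 1) (step coded w (initial coded)) c'"
      "simulates L w (p, i, v, out) c'" by blast
  have l: "runs_within w (L + 1) (initial coded) c'"
    using c'(1) by - (rule leads.step, auto simp: initial_coded)
  from c'(2) obtain ds where ds: "set ds \<subseteq> vectors 1" "tern ds = v"
      "c' = conf (Rest p (\<lambda>j. sgn (v j))) i (tape ds) 0 out" by (auto simp: simulates_def)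
  then have "(\<lambda>j. sgn (v j)) \<in> vectors 1" using sgn_in by blast
  then have "state c' \<in> final_states coded"
    unfolding ds(3) using p PF by (subst final_conf) (auto simp: states_simps final_of_def)
  from leads_final[OF l this] show "outputs coded w out" "work_pos (run coded w t) \<le> L + 1"
    by (simp_all add: ds conf_def)
qed

text \<open>
  Numbers up to \<open>C * (n + 1) ^ D\<close> have \<open>O(log n)\<close> ternary digits; the summand 2 accounts for the
  marker and for the blank square at which a sweep turns.
\<close>

lemma logarithmic_width:
  fixes C D :: nat
  shows "\<exists>c. \<forall>n. \<exists>L. 2 * (C * (n + 1) ^ D) < 3 ^ L \<and> real (L + 2) \<le> c * log 2 (real (max 2 n))"
proof -
  define c :: real where "c = real (2 * C + 3 * D + 3)"
  have "\<exists>L. 2 * (C * (n + 1) ^ D) < 3 ^ L \<and> real (L + 2) \<le> c * log 2 (real (max 2 n))" for n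
  proof -
    define N where "N = max 2 n"
    define l where "l = nat \<lceil>log 2 (real N)\<rceil>"
    have N: "N \<ge> 2" "n \<le> N" by (auto simp: N_def)
    have log1: "1 \<le> log 2 (real N)" using N by (simp add: le_log_iff)
    have l: "real l \<le> 2 * log 2 (real N)" using log1 unfolding l_def by linarith
    have "real N = 2 powr log 2 (real N)" using N by simp
    also have "\<dots> \<le> 2 powr real l"
      by (rule powr_mono) (use log1 in \<open>auto simp: l_def real_nat_ceiling_ge\<close>)
    finally have "real N \<le> real (2 ^ l)" by (simp add: powr_realpow)
    then have "N \<le> 2 ^ l" by linarith
    then have "n + 1 \<le> 2 ^ (l + 1)" using N by simp
    then have "(n + 1) ^ D \<le> (2 ^ (l + 1)) ^ D" by (rule power_mono) simp
    then have "(n + 1) ^ D \<le> 2 ^ ((l + 1) * D)" by (simp only: power_mult)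
    then have "2 * C * (n + 1) ^ D < 2 ^ (2 * C) * 2 ^ ((l + 1) * D)"
      by (rule mult_less_le_imp_less[OF less_exp]) simp_all
    then have "2 * C * (n + 1) ^ D < 2 ^ (2 * C + (l + 1) * D)" by (simp only: power_add)
    moreover have "(2::nat) ^ (2 * C + (l + 1) * D) \<le> 3 ^ (2 * C + (l + 1) * D)"
      by (rule power_mono) simp_all
    ultimately have "2 * C * (n + 1) ^ D < 3 ^ (2 * C + (l + 1) * D)" by (rule less_le_trans)
    then have 1: "2 * (C * (n + 1) ^ D) < 3 ^ (2 * C + (l + 1) * D)" by (simp only: mult.assoc)
    have "real l * real D \<le> 2 * log 2 (real N) * real D"
      by (rule mult_right_mono[OF l]) simp
    moreover have "real (2 * C + D + 2) * 1 \<le> real (2 * C + D + 2) * log 2 (real N)"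
      by (rule mult_left_mono[OF log1]) simp
    ultimately have "real (2 * C + (l + 1) * D + 2) \<le> c * log 2 (real N)"
      using log1 unfolding c_def by (simp add: algebra_simps)
    with 1 show ?thesis unfolding N_def by blast
  qed
  then show ?thesis by blast
qed

theorem logspace_computable_if_polynomial:
  fixes C D :: nat
  assumes f: "f \<in> lists X \<rightarrow> lists Y"
    and run: "\<And>w. w \<in> lists X \<Longrightarrow> \<exists>p i v. p \<in> PF \<and>
      leads (mstep w) (\<lambda>(p, i, v, out). \<forall>j. \<bar>v j\<bar> \<le> int (C * (length w + 1) ^ D))
        start (p, i, v, f w)"
  shows "logspace_computable X Y f"
proof -
  obtain c where c: "\<And>n. \<exists>L. 2 * (C * (n + 1) ^ D) < 3 ^ L \<and>
      real (L + 2) \<le> c * log 2 (real (max 2 n))"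
    using logarithmic_width[of C D] by (elim exE) (rule that, erule spec)
  have "outputs coded w (f w) \<and> logspace_bounded c coded w" if w: "w \<in> lists X" for w
  proof -
    obtain L where L: "2 * (C * (length w + 1) ^ D) < 3 ^ L"
        "real (L + 2) \<le> c * log 2 (real (max 2 (length w)))" using c by blast
    obtain p i v where p: "p \<in> PF" and
      l: "leads (mstep w) (\<lambda>(p, i, v, out). \<forall>j. \<bar>v j\<bar> \<le> int (C * (length w + 1) ^ D)) start (p, i, v, f w)"
      using run[OF w] by blast
    have "int (2 * (C * (length w + 1) ^ D)) < int (3 ^ L)" using L(1) by (simp only: of_nat_less_iff)
    then have L': "2 * int (C * (length w + 1) ^ D) < 3 ^ L" by simp
    have "leads (mstep w) (small L) start (p, i, v, f w)"
    proof (rule leads_mono[OF l])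
      fix m :: "'p \<times> nat \<times> ('i \<Rightarrow> int) \<times> 'y list"
      assume m: "case m of (p, i, v, out) \<Rightarrow> \<forall>j. \<bar>v j\<bar> \<le> int (C * (length w + 1) ^ D)"
      obtain p i v out where [simp]: "m = (p, i, v, out)" by (rule prod_cases4)
      have "2 * \<bar>v j\<bar> < 3 ^ L" for j
      proof -
        have "\<bar>v j\<bar> \<le> int (C * (length w + 1) ^ D)" using m by simp
        with L' show ?thesis by linarith
      qed
      then show "small L m" by (simp add: small_def)
    qed
    from run_simulated[OF this p w] have o: "outputs coded w (f w)"
      and b: "\<And>t. work_pos (run coded w t) \<le> L + 1" by auto
    have "real (work_pos (run coded w t) + 1) \<le> c * log 2 (real (max 2 (length w)))" for t
      using b[of t] L(2) by linarith
    with o show ?thesis by (simp add: logspace_bounded_def)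
  qed
  then show ?thesis
    using f finite_X finite_Y transducer_coded unfolding logspace_computable_def by blast
qed

end

section \<open>Commutators\<close>

context group
begin

definition commutator :: "'a \<Rightarrow> 'a \<Rightarrow> 'a" where
  "commutator x y = x \<otimes> y \<otimes> inv x \<otimes> inv y"

lemma inv_cancel:
  "\<lbrakk>x \<in> carrier G; z \<in> carrier G\<rbrakk> \<Longrightarrow> inv x \<otimes> (x \<otimes> z) = z"
  "\<lbrakk>x \<in> carrier G; z \<in> carrier G\<rbrakk> \<Longrightarrow> x \<otimes> (inv x \<otimes> z) = z"
  by (simp_all flip: m_assoc)

lemmas group_simps = m_assoc inv_mult_group inv_cancel

lemma commutator_closed [simp]:
  "\<lbrakk>x \<in> carrier G; y \<in> carrier G\<rbrakk> \<Longrightarrow> commutator x y \<in> carrier G"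
  by (simp add: commutator_def)

lemma commutator_one [simp]:
  "x \<in> carrier G \<Longrightarrow> commutator x \<one> = \<one>" "x \<in> carrier G \<Longrightarrow> commutator \<one> x = \<one>"
  by (simp_all add: commutator_def)

lemma inv_commutator:
  "\<lbrakk>x \<in> carrier G; y \<in> carrier G\<rbrakk> \<Longrightarrow> inv (commutator x y) = commutator y x"
  by (simp add: commutator_def group_simps)

lemma conj_eq_commutator:
  "\<lbrakk>g \<in> carrier G; x \<in> carrier G\<rbrakk> \<Longrightarrow> g \<otimes> x \<otimes> inv g = commutator g x \<otimes> x"
  by (simp add: commutator_def group_simps)

lemma commutator_mult_right:
  "\<lbrakk>x \<in> carrier G; y \<in> carrier G; z \<in> carrier G\<rbrakk> \<Longrightarrow>
    commutator x (y \<otimes> z) = commutator x y \<otimes> (y \<otimes> commutator x z \<otimes> inv y)"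
  by (simp add: commutator_def group_simps)

lemma commutator_inv_right:
  "\<lbrakk>x \<in> carrier G; y \<in> carrier G\<rbrakk> \<Longrightarrow>
    commutator x (inv y) = inv y \<otimes> inv (commutator x y) \<otimes> inv (inv y)"
  by (simp add: commutator_def group_simps)

text \<open>
  By \<open>[x, y z] = [x, y] \<cdot> y [x, z] y\<^sup>-\<^sup>1\<close>, the elements \<open>y\<close> with \<open>[x, y]\<close> in a normal subgroup form a
  subgroup.
\<close>

lemma commutator_generate_right:
  assumes H: "subgroup H G" and conj: "\<And>g h. g \<in> carrier G \<Longrightarrow> h \<in> H \<Longrightarrow> g \<otimes> h \<otimes> inv g \<in> H"
    and S: "S \<subseteq> carrier G" and x: "x \<in> carrier G" and c: "\<And>y. y \<in> S \<Longrightarrow> commutator x y \<in> H"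
    and y: "y \<in> generate G S"
  shows "commutator x y \<in> H"
  using y
proof induction
  case one
  then show ?case using x subgroup.one_closed[OF H] by simp
next
  case (incl y)
  then show ?case by (rule c)
next
  case (inv y)
  then show ?case
    using conj[of "inv y" "inv (commutator x y)"] c[of y] S x subgroup.m_inv_closed[OF H]
    by (subst commutator_inv_right) auto
next
  case (eng y z)
  then have "y \<in> carrier G" "z \<in> carrier G" using generate_in_carrier[OF S] by auto
  then show ?case
    using conj[of y "commutator x z"] eng x subgroup.m_closed[OF H] by (subst commutator_mult_right) auto
qed

lemma commutator_generate_left:
  assumes H: "subgroup H G" and conj: "\<And>g h. g \<in> carrier G \<Longrightarrow> h \<in> H \<Longrightarrow> g \<otimes> h \<otimes> inv g \<in> H"
    and S: "S \<subseteq> carrier G" and y: "y \<in> carrier G" and c: "\<And>x. x \<in> S \<Longrightarrow> commutator x y \<in> H"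
    and x: "x \<in> generate G S"
  shows "commutator x y \<in> H"
proof -
  have "x \<in> carrier G" using x generate_in_carrier[OF S] by blast
  have c': "commutator y z \<in> H" if "z \<in> S" for z
    using subgroup.m_inv_closed[OF H c[OF that]] S y that by (subst (asm) inv_commutator) auto
  have "commutator y x \<in> H" by (rule commutator_generate_right[OF H conj S y c' x])
  then show ?thesis
    using subgroup.m_inv_closed[OF H] inv_commutator[OF y \<open>x \<in> carrier G\<close>] by fastforce
qed

section \<open>The lower central series\<close>

lemma lower_central_Suc:
  "lower_central G (Suc k) =
    generate G {commutator x y | x y. x \<in> lower_central G k \<and> y \<in> carrier G}"
  by (simp add: commutator_def)

declare lower_central.simps(2) [simp del]

lemma lower_central_props:
  "subgroup (lower_central G k) G \<and>
   (\<forall>g\<in>carrier G. \<forall>x\<in>lower_central G k. g \<otimes> x \<otimes> inv g \<in> lower_central G k)"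
proof (induction k)
  case 0
  then show ?case by (simp add: subgroup_self)
next
  case (Suc k)
  let ?L = "lower_central G k" and ?M = "lower_central G (Suc k)"
  let ?S = "{commutator x y | x y. x \<in> ?L \<and> y \<in> carrier G}"
  have L: "subgroup ?L G" and conj: "\<And>g x. g \<in> carrier G \<Longrightarrow> x \<in> ?L \<Longrightarrow> g \<otimes> x \<otimes> inv g \<in> ?L"
    using Suc by auto
  have Lc: "?L \<subseteq> carrier G" by (rule subgroup.subset[OF L])
  have "commutator x y \<in> ?L" if "x \<in> ?L" "y \<in> carrier G" for x y
  proof -
    have "commutator x y = x \<otimes> (y \<otimes> inv x \<otimes> inv y)"
      using that Lc by (auto simp: commutator_def m_assoc)
    then show ?thesis using that conj subgroup.m_closed[OF L] subgroup.m_inv_closed[OF L] by simp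
  qed
  then have "?S \<subseteq> ?L" by blast
  then have sub: "?M \<subseteq> ?L" unfolding lower_central_Suc by (rule generate_subgroup_incl[OF _ L])
  have M: "subgroup ?M G"
    unfolding lower_central_Suc using Lc by (intro generate_is_subgroup) auto
  have "g \<otimes> x \<otimes> inv g \<in> ?M" if "g \<in> carrier G" "x \<in> ?M" for g x
  proof -
    have x: "x \<in> ?L" "x \<in> carrier G" using that sub Lc by auto
    then have "commutator x g \<in> ?M"
      unfolding lower_central_Suc using that by (intro generate.incl) blast
    then have "commutator g x \<in> ?M"
      using subgroup.m_inv_closed[OF M] inv_commutator[OF x(2) that(1)] by fastforce
    then show ?thesis
      using conj_eq_commutator[OF that(1) x(2)] subgroup.m_closed[OF M] that by simp
  qed
  then show ?case using M by blast
qed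

lemmas lower_central_subgroup = conjunct1[OF lower_central_props]

lemma lower_central_conj:
  "\<lbrakk>g \<in> carrier G; x \<in> lower_central G k\<rbrakk> \<Longrightarrow> g \<otimes> x \<otimes> inv g \<in> lower_central G k"
  using lower_central_props[of k] by blast

lemma lower_central_carrier: "x \<in> lower_central G k \<Longrightarrow> x \<in> carrier G"
  by (rule subgroup.mem_carrier[OF lower_central_subgroup])

lemma commutator_lower_central:
  "\<lbrakk>x \<in> lower_central G k; y \<in> carrier G\<rbrakk> \<Longrightarrow> commutator x y \<in> lower_central G (Suc k)"
  unfolding lower_central_Suc by (intro generate.incl) blast

lemma commutator_lower_central':
  "\<lbrakk>x \<in> lower_central G k; y \<in> carrier G\<rbrakk> \<Longrightarrow> commutator y x \<in> lower_central G (Suc k)"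
  using subgroup.m_inv_closed[OF lower_central_subgroup commutator_lower_central, of x k y]
    inv_commutator[OF lower_central_carrier, of x k y] by simp

lemma lower_central_antimono: "lower_central G (Suc k) \<subseteq> lower_central G k"
  unfolding lower_central_Suc
proof (rule generate_subgroup_incl[OF _ lower_central_subgroup], clarify)
  fix x y assume *: "x \<in> lower_central G k" "y \<in> carrier G"
  note L = lower_central_subgroup[of k]
  have "commutator x y = x \<otimes> (y \<otimes> inv x \<otimes> inv y)"
    using * lower_central_carrier by (auto simp: commutator_def m_assoc)
  then show "commutator x y \<in> lower_central G k"
    using * lower_central_conj subgroup.m_closed[OF L] subgroup.m_inv_closed[OF L] by simp
qed

text \<open>
  Modulo \<open>\<gamma>\<^sub>k\<^sub>+\<^sub>2\<close> the commutator map from \<open>\<gamma>\<^sub>k \<times> G\<close> to \<open>\<gamma>\<^sub>k\<^sub>+\<^sub>1\<close> is bilinear and kills \<open>\<gamma>\<^sub>k\<^sub>+\<^sub>1 \<times> G\<close>.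
  Hence the commutators of generators of \<open>\<gamma>\<^sub>k\<close> modulo \<open>\<gamma>\<^sub>k\<^sub>+\<^sub>1\<close> with generators of \<open>G\<close> generate
  \<open>\<gamma>\<^sub>k\<^sub>+\<^sub>1\<close> modulo \<open>\<gamma>\<^sub>k\<^sub>+\<^sub>2\<close>.
\<close>

lemma lower_central_finitely_generated:
  assumes S: "finite S" "S \<subseteq> carrier G" "generate G S = carrier G"
  shows "\<exists>T. finite T \<and> T \<subseteq> lower_central G k \<and>
    lower_central G k \<subseteq> generate G (T \<union> lower_central G (Suc k))"
proof (induction k)
  case 0
  show ?case
    using S mono_generate[of S "S \<union> lower_central G (Suc 0)"]
    by (intro exI[of _ S]) auto
next
  case (Suc k)
  then obtain T where T: "finite T" "T \<subseteq> lower_central G k"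
    "lower_central G k \<subseteq> generate G (T \<union> lower_central G (Suc k))" by blast
  let ?L = "lower_central G k" and ?M = "lower_central G (Suc k)" and ?N = "lower_central G (Suc (Suc k))"
  define T' where "T' = (\<lambda>(x, y). commutator x y) ` (T \<times> S)"
  define P where "P = generate G (T' \<union> ?N)"
  have T'M: "T' \<subseteq> ?M" using T S by (auto simp: T'_def intro!: commutator_lower_central)
  have sub: "T' \<union> ?N \<subseteq> carrier G" using T'M lower_central_carrier by blast
  have P: "subgroup P G" unfolding P_def by (rule generate_is_subgroup[OF sub])
  have PM: "P \<subseteq> ?M" unfolding P_def
    using T'M lower_central_antimono by (intro generate_subgroup_incl lower_central_subgroup) auto
  have NP: "?N \<subseteq> P" and TP: "T' \<subseteq> P" unfolding P_def by (auto intro: generate.incl)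
  have conj: "g \<otimes> x \<otimes> inv g \<in> P" if "g \<in> carrier G" "x \<in> P" for g x
  proof -
    have x: "x \<in> ?M" "x \<in> carrier G" using that PM lower_central_carrier by auto
    have "commutator g x \<in> P" using commutator_lower_central'[OF x(1) that(1)] NP by blast
    then show ?thesis using conj_eq_commutator[OF that(1) x(2)] subgroup.m_closed[OF P] that by simp
  qed
  have 1: "commutator x y \<in> P" if "x \<in> T" "y \<in> carrier G" for x y
  proof (rule commutator_generate_right[OF P conj S(2)])
    show "x \<in> carrier G" using that T lower_central_carrier by blast
    show "y \<in> generate G S" using that S by simp
    show "commutator x z \<in> P" if "z \<in> S" for z
      using TP \<open>x \<in> T\<close> that by (auto simp: T'_def)
  qed
  have 2: "commutator x y \<in> P" if x: "x \<in> ?L" and y: "y \<in> carrier G" for x y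
  proof (rule commutator_generate_left[OF P conj _ y])
    show "T \<union> ?M \<subseteq> carrier G" using T lower_central_carrier by blast
    show "x \<in> generate G (T \<union> ?M)" using T x by blast
    show "commutator z y \<in> P" if "z \<in> T \<union> ?M" for z
      using that 1[OF _ y] commutator_lower_central[OF _ y] NP by blast
  qed
  have "?M \<subseteq> P" unfolding lower_central_Suc[of k]
    using 2 by (intro generate_subgroup_incl P) auto
  then show ?case using T S T'M unfolding P_def by (intro exI[of _ T']) (auto simp: T'_def)
qed

text \<open>
  The list enumerates generators of the successive factors of the lower central series, beginning
  with the last nontrivial term.
\<close>

lemma central_generators:
  assumes S: "finite S" "S \<subseteq> carrier G" "generate G S = carrier G"
    and c: "lower_central G c = {\<one>}"
  shows "\<exists>bs. set bs \<subseteq> carrier G \<and> generate G (set bs) = carrier G \<and>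
    (\<forall>j<length bs. \<forall>g\<in>carrier G. commutator g (bs ! j) \<in> generate G (set (take j bs)))"
proof -
  have "\<exists>bs. set bs \<subseteq> carrier G \<and> generate G (set bs) = lower_central G (c - k) \<and>
    (\<forall>j<length bs. \<forall>g\<in>carrier G. commutator g (bs ! j) \<in> generate G (set (take j bs)))"
    if "k \<le> c" for k
    using that
  proof (induction k)
    case 0
    then show ?case using c generate_empty by (intro exI[of _ "[]"]) auto
  next
    case (Suc k)
    then obtain bs where bs: "set bs \<subseteq> carrier G" "generate G (set bs) = lower_central G (c - k)"
      "\<And>j g. j < length bs \<Longrightarrow> g \<in> carrier G \<Longrightarrow> commutator g (bs ! j) \<in> generate G (set (take j bs))"
      by auto
    define l where "l = c - Suc k"
    have l: "c - k = Suc l" using Suc.prems by (simp add: l_def)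
    obtain T where T: "finite T" "T \<subseteq> lower_central G l"
      "lower_central G l \<subseteq> generate G (T \<union> lower_central G (Suc l))"
      using lower_central_finitely_generated[OF S] by blast
    obtain ts where ts: "set ts = T" using T(1) finite_list by blast
    have sub: "set (bs @ ts) \<subseteq> carrier G" using bs T lower_central_carrier by (auto simp: ts)
    have bsub: "generate G (set bs) \<subseteq> generate G (set (bs @ ts))"
      by (rule mono_generate) auto
    have "lower_central G l \<subseteq> generate G (set (bs @ ts))"
    proof -
      have "T \<union> lower_central G (Suc l) \<subseteq> generate G (set (bs @ ts))"
        using bsub bs(2) ts unfolding l by (auto intro: generate.incl)
      then have "generate G (T \<union> lower_central G (Suc l)) \<subseteq> generate G (set (bs @ ts))"
        by (rule generate_subgroup_incl[OF _ generate_is_subgroup[OF sub]])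
      then show ?thesis using T by blast
    qed
    moreover have "generate G (set (bs @ ts)) \<subseteq> lower_central G l"
    proof (rule generate_subgroup_incl[OF _ lower_central_subgroup])
      have "set bs \<subseteq> lower_central G (Suc l)" using bs(2) l generate.incl by fastforce
      then show "set (bs @ ts) \<subseteq> lower_central G l"
        using T ts lower_central_antimono[of l] by auto
    qed
    moreover have "commutator g ((bs @ ts) ! j) \<in> generate G (set (take j (bs @ ts)))"
      if "j < length (bs @ ts)" "g \<in> carrier G" for j g
    proof (cases "j < length bs")
      case True
      then show ?thesis using bs(3) that by (simp add: nth_append)
    next
      case False
      then have "(bs @ ts) ! j \<in> lower_central G l"
        using that T ts by (auto simp: nth_append intro!: subsetD[OF T(2)])
      then have "commutator g ((bs @ ts) ! j) \<in> generate G (set bs)"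
        using commutator_lower_central' that bs(2) l by simp
      moreover have "generate G (set bs) \<subseteq> generate G (set (take j (bs @ ts)))"
        using False by (intro mono_generate) auto
      ultimately show ?thesis by blast
    qed
    ultimately show ?case using sub unfolding l_def by (intro exI[of _ "bs @ ts"]) blast
  qed
  from this[of c] show ?thesis by simp
qed

end

section \<open>Central series with cyclic factors\<close>

text \<open>
  The series is indexed upwards and its factors are cyclic: \<open>a j\<close> generates \<open>C (Suc j)\<close> modulo
  \<open>C j\<close>.  From \<open>s\<close> on it is constant, which spares side conditions on indices.
\<close>

locale central_series = group +
  fixes C :: "nat \<Rightarrow> 'a set" and a :: "nat \<Rightarrow> 'a" and s :: nat
  assumes C_0: "C 0 = {\<one>}" and C_s: "C s = carrier G"
    and C_subgroup: "subgroup (C j) G" and C_mono: "C j \<subseteq> C (Suc j)"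
    and a_in: "a j \<in> C (Suc j)"
    and C_cyclic: "x \<in> C (Suc j) \<Longrightarrow> \<exists>k::int. \<exists>c\<in>C j. x = a j [^] k \<otimes> c"
    and C_central: "\<lbrakk>g \<in> carrier G; x \<in> C (Suc j)\<rbrakk> \<Longrightarrow> commutator g x \<in> C j"

lemma (in group) central_series_exists:
  assumes "finitely_generated G" "nilpotent G"
  shows "\<exists>C a s. central_series G C a s"
proof -
  obtain S where S: "S \<subseteq> carrier G" "finite S" "generate G S = carrier G"
    using assms(1) unfolding finitely_generated_def by auto
  obtain c where c: "lower_central G c = {\<one>}"
    using assms(2) unfolding nilpotent_def by auto
  obtain bs where bs: "set bs \<subseteq> carrier G" "generate G (set bs) = carrier G"
    "\<And>j g. j < length bs \<Longrightarrow> g \<in> carrier G \<Longrightarrow> commutator g (bs ! j) \<in> generate G (set (take j bs))"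
    using central_generators[OF S(2,1,3) c] by auto
  define C where "C j = generate G (set (take j bs))" for j
  define a where "a j = (if j < length bs then bs ! j else \<one>)" for j
  have tb: "set (take j bs) \<subseteq> carrier G" for j using bs(1) set_take_subset[of j bs] by blast
  have C: "subgroup (C j) G" for j unfolding C_def by (rule generate_is_subgroup[OF tb])
  have mono: "C i \<subseteq> C j" if "i \<le> j" for i j
    unfolding C_def by (rule mono_generate[OF set_take_subset_set_take[OF that]])
  have ac: "a j \<in> carrier G" for j using bs(1) by (auto simp: a_def)
  have comm: "commutator g (a i) \<in> C j" if "g \<in> carrier G" "i \<le> j" for g i j
  proof (cases "i < length bs")
    case True
    then have "commutator g (a i) \<in> C i" using bs(3)[of i g] that unfolding C_def a_def by simp
    then show ?thesis using mono[OF that(2)] by blast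
  next
    case False
    then show ?thesis using that subgroup.one_closed[OF C, of j] by (simp add: a_def)
  qed
  have take: "\<exists>i<j. x = a i" if "x \<in> set (take j bs)" for x j
  proof -
    obtain i where i: "i < length (take j bs)" "take j bs ! i = x"
      using \<open>x \<in> set (take j bs)\<close> unfolding in_set_conv_nth by blast
    then show ?thesis by (intro exI[of _ i]) (simp add: a_def)
  qed
  have aC: "a i \<in> C j" if "i < j" for i j
  proof (cases "i < length bs")
    case True
    then have "bs ! i \<in> set (take j bs)"
      unfolding in_set_conv_nth using that by (intro exI[of _ i]) simp
    then show ?thesis using True unfolding C_def a_def by (simp add: generate.incl)
  qed (use subgroup.one_closed[OF C, of j] in \<open>simp add: a_def\<close>)
  have conj: "g \<otimes> x \<otimes> inv g \<in> C j" if g: "g \<in> carrier G" and x: "x \<in> C j" for g x j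
  proof -
    have "g \<otimes> x \<otimes> inv g \<in> C j" if "x \<in> generate G (set (take j bs))"
      using that
    proof induction
      case one
      then show ?case using g subgroup.one_closed[OF C] by simp
    next
      case (incl h)
      then obtain i where "i < j" "h = a i" using take by blast
      then show ?case
        using conj_eq_commutator[OF g ac] comm[OF g, of i j] aC subgroup.m_closed[OF C] by simp
    next
      case (inv h)
      then obtain i where i: "i < j" "h = a i" using take by blast
      then have "g \<otimes> h \<otimes> inv g \<in> C j"
        using conj_eq_commutator[OF g ac] comm[OF g, of i j] aC subgroup.m_closed[OF C] by simp
      from subgroup.m_inv_closed[OF C this] show ?case using g ac i by (simp add: group_simps)
    next
      case (eng h1 h2)
      then have "h1 \<in> carrier G" "h2 \<in> carrier G" using generate_in_carrier[OF tb] by auto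
      then show ?case using subgroup.m_closed[OF C eng.IH] g by (simp add: group_simps)
    qed
    then show ?thesis using x by (simp add: C_def)
  qed
  have central: "commutator g x \<in> C j" if g: "g \<in> carrier G" and x: "x \<in> C (Suc j)" for g x j
  proof (rule commutator_generate_right[OF C conj tb g])
    show "x \<in> generate G (set (take (Suc j) bs))" using x by (simp add: C_def)
    show "commutator g y \<in> C j" if "y \<in> set (take (Suc j) bs)" for y
      using take[OF that] comm[OF g] by auto
  qed
  have cyclic: "\<exists>k::int. \<exists>c\<in>C j. x = a j [^] k \<otimes> c" if x: "x \<in> C (Suc j)" for x j
  proof -
    have "\<exists>k::int. \<exists>c\<in>C j. x = a j [^] k \<otimes> c" if "x \<in> generate G (set (take (Suc j) bs))"
      using that
    proof induction
      case one
      then show ?case using subgroup.one_closed[OF C] by (intro exI[of _ 0] bexI[of _ \<one>]) auto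
    next
      case (incl h)
      then obtain i where i: "i < Suc j" "h = a i" using take by blast
      show ?case
      proof (cases "i = j")
        case True
        then show ?thesis using i ac subgroup.one_closed[OF C]
          by (intro exI[of _ 1] bexI[of _ \<one>]) (auto simp: int_pow_1)
      next
        case False
        then show ?thesis using i ac aC[of i j] by (intro exI[of _ 0] bexI[of _ h]) auto
      qed
    next
      case (inv h)
      then obtain i where i: "i < Suc j" "h = a i" using take by blast
      show ?case
      proof (cases "i = j")
        case True
        then show ?thesis using i ac subgroup.one_closed[OF C]
          by (intro exI[of _ "-1"] bexI[of _ \<one>]) (auto simp: int_pow_neg)
      next
        case False
        then show ?thesis using i ac subgroup.m_inv_closed[OF C aC[of i j]]
          by (intro exI[of _ 0] bexI[of _ "inv h"]) auto
      qed
    next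
      case (eng x y)
      then obtain k l :: int and c d where *: "c \<in> C j" "x = a j [^] k \<otimes> c" "d \<in> C j" "y = a j [^] l \<otimes> d"
        by blast
      have cd: "c \<in> carrier G" "d \<in> carrier G" using * subgroup.mem_carrier[OF C] by auto
      have p: "a j [^] l \<in> carrier G" "a j [^] k \<in> carrier G" using ac by auto
      have "x \<otimes> y = a j [^] (k + l) \<otimes> ((inv (a j [^] l) \<otimes> c \<otimes> inv (inv (a j [^] l))) \<otimes> d)"
        using cd p ac[of j] by (simp add: * group_simps int_pow_mult)
      moreover have "(inv (a j [^] l) \<otimes> c \<otimes> inv (inv (a j [^] l))) \<otimes> d \<in> C j"
        using conj[of "inv (a j [^] l)" c j] p * subgroup.m_closed[OF C] by simp
      ultimately show ?case by blast
    qed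
    then show ?thesis using x by (simp add: C_def)
  qed
  have "central_series G C a (length bs)"
  proof (intro central_series.intro central_series_axioms.intro group_axioms)
    show "C 0 = {\<one>}" unfolding C_def using generate_empty by simp
    show "C (length bs) = carrier G" using bs(2) by (simp add: C_def)
    show "C j \<subseteq> C (Suc j)" for j by (rule mono) simp
  qed (use aC in \<open>auto intro: C cyclic central\<close>)
  then show ?thesis by blast
qed

context central_series
begin

section \<open>Polynomial functions\<close>

definition diff :: "'a \<Rightarrow> ('a \<Rightarrow> int) \<Rightarrow> 'a \<Rightarrow> int" where
  "diff n f = (\<lambda>x. f (n \<otimes> x) - f x)"

text \<open>
  All \<open>d\<close>-fold differences vanish on \<open>N\<close>, so that \<open>f\<close> is a polynomial function of degree less
  than \<open>d\<close>.
\<close>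

fun poly :: "'a set \<Rightarrow> nat \<Rightarrow> ('a \<Rightarrow> int) \<Rightarrow> bool" where
  "poly N 0 f \<longleftrightarrow> (\<forall>x\<in>N. f x = 0)"
| "poly N (Suc d) f \<longleftrightarrow> (\<forall>n\<in>N. poly N d (diff n f))"

text \<open>
  The weighted variant: a difference in the direction of an element of \<open>C (s - i)\<close> has to lower the
  weight by \<open>i + 1\<close>, so that elements deeper in the central series count more.  For a conjugation
  \<open>\<tau>\<close> the function \<open>f \<circ> \<tau> - f\<close> then has smaller weight than \<open>f\<close>, whereas its degree may be the same.
\<close>

fun wpoly :: "'a set \<Rightarrow> nat \<Rightarrow> ('a \<Rightarrow> int) \<Rightarrow> bool" where
  "wpoly N 0 f \<longleftrightarrow> (\<forall>x\<in>N. f x = 0)"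
| "wpoly N (Suc w) f \<longleftrightarrow> (\<forall>i. \<forall>n\<in>N \<inter> C (s - i). wpoly N (w - i) (diff n f))"

lemma C_carrier: "x \<in> C j \<Longrightarrow> x \<in> carrier G"
  by (rule subgroup.mem_carrier[OF C_subgroup])

lemma C_conj:
  assumes "g \<in> carrier G" "x \<in> C j"
  shows "g \<otimes> x \<otimes> inv g \<in> C j"
proof (cases j)
  case 0
  then show ?thesis using assms by (simp add: C_0)
next
  case (Suc i)
  then have "commutator g x \<in> C j" using C_central[of g x i] C_mono[of i] assms by blast
  then show ?thesis
    using conj_eq_commutator[OF assms(1) C_carrier[OF assms(2)]] subgroup.m_closed[OF C_subgroup] assms
    by simp
qed

lemma commutator_filtration:
  assumes "g \<in> carrier G" "x \<in> C (s - i)"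
  shows "commutator g x \<in> C (s - Suc i)"
proof (cases "s - i")
  case 0
  then show ?thesis using assms by (simp add: C_0)
next
  case (Suc j)
  then have "s - Suc i = j" by simp
  then show ?thesis using C_central[of g x j] assms Suc by simp
qed

lemma poly_cong:
  assumes N: "subgroup N G"
  shows "poly N d f \<Longrightarrow> (\<And>x. x \<in> N \<Longrightarrow> f x = g x) \<Longrightarrow> poly N d g"
proof (induction d arbitrary: f g)
  case (Suc d)
  show ?case unfolding poly.simps
  proof
    fix n assume n: "n \<in> N"
    show "poly N d (diff n g)"
    proof (rule Suc.IH)
      show "poly N d (diff n f)" using Suc.prems n by simp
      show "diff n f x = diff n g x" if "x \<in> N" for x
        using Suc.prems(2) subgroup.m_closed[OF N n that] that by (simp add: diff_def)
    qed
  qed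
qed simp

lemma poly_Suc: "subgroup N G \<Longrightarrow> poly N d f \<Longrightarrow> poly N (Suc d) f"
proof (induction d arbitrary: f)
  case 0
  then show ?case by (simp add: diff_def subgroup.m_closed)
next
  case (Suc d)
  have "poly N (Suc d) (diff n f)" if "n \<in> N" for n
    using Suc.IH[OF Suc.prems(1)] Suc.prems(2) that by simp
  then show ?case by simp
qed

lemma poly_mono:
  assumes "d \<le> d'" "subgroup N G" "poly N d f"
  shows "poly N d' f"
  using assms(1) by (induction rule: dec_induct) (use assms poly_Suc in blast)+

lemma poly_hom:
  assumes N: "subgroup N G" and hom: "\<And>x y. x \<in> N \<Longrightarrow> y \<in> N \<Longrightarrow> e (x \<otimes> y) = e x + e y"
  shows "poly N 2 e"
  using assms by (simp add: numeral_2_eq_2 diff_def subgroup.m_closed)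

lemma wpoly_cong:
  assumes N: "subgroup N G"
  shows "wpoly N w f \<Longrightarrow> (\<And>x. x \<in> N \<Longrightarrow> f x = g x) \<Longrightarrow> wpoly N w g"
proof (induction w arbitrary: f g rule: less_induct)
  case (less w)
  show ?case
  proof (cases w)
    case 0
    then show ?thesis using less.prems by simp
  next
    case (Suc v)
    have "wpoly N (v - i) (diff n g)" if n: "n \<in> N" "n \<in> C (s - i)" for i n
    proof (rule less.IH)
      show "v - i < w" using Suc by simp
      show "wpoly N (v - i) (diff n f)" using less.prems(1) n Suc by simp
      show "diff n f x = diff n g x" if "x \<in> N" for x
        using less.prems(2) subgroup.m_closed[OF N n(1) that] that by (simp add: diff_def)
    qed
    then show ?thesis by (simp add: Suc)
  qed
qed

lemma wpoly_0: "subgroup N G \<Longrightarrow> (\<And>x. x \<in> N \<Longrightarrow> f x = 0) \<Longrightarrow> wpoly N w f"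
proof (induction w arbitrary: f rule: less_induct)
  case (less w)
  show ?case
  proof (cases w)
    case (Suc v)
    have "wpoly N (v - i) (diff n f)" if "n \<in> N" for i n
    proof (rule less.IH[OF _ less.prems(1)])
      show "v - i < w" by (simp add: Suc)
      show "diff n f x = 0" if "x \<in> N" for x
        using less.prems(2) subgroup.m_closed[OF less.prems(1) \<open>n \<in> N\<close> that] that by (simp add: diff_def)
    qed
    then show ?thesis by (simp add: Suc)
  qed (use less.prems in simp)
qed

lemma wpoly_add:
  "wpoly N w f \<Longrightarrow> wpoly N w g \<Longrightarrow> wpoly N w (\<lambda>x. f x + g x)"
proof (induction w arbitrary: f g rule: less_induct)
  case (less w)
  show ?case
  proof (cases w)
    case (Suc v)
    have "wpoly N (v - i) (diff n (\<lambda>x. f x + g x))" if n: "n \<in> N" "n \<in> C (s - i)" for i n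
    proof -
      have "wpoly N (v - i) (\<lambda>x. diff n f x + diff n g x)"
        by (rule less.IH) (use less.prems n in \<open>simp_all add: Suc\<close>)
      moreover have "(\<lambda>x. diff n f x + diff n g x) = diff n (\<lambda>x. f x + g x)"
        by (simp add: diff_def algebra_simps)
      ultimately show ?thesis by simp
    qed
    then show ?thesis by (simp add: Suc)
  qed (use less.prems in simp)
qed

lemma wpoly_mono: "subgroup N G \<Longrightarrow> wpoly N w f \<Longrightarrow> w \<le> v \<Longrightarrow> wpoly N v f"
proof (induction v arbitrary: w f rule: less_induct)
  case (less v)
  show ?case
  proof (cases w)
    case 0
    then show ?thesis using less.prems wpoly_0 by simp
  next
    case (Suc w')
    then obtain v' where v: "v = Suc v'" "w' \<le> v'" using less.prems(3) by (cases v) auto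
    have "wpoly N (v' - i) (diff n f)" if "n \<in> N" "n \<in> C (s - i)" for i n
    proof (rule less.IH)
      show "v' - i < v" by (simp add: v)
      show "wpoly N (w' - i) (diff n f)" using less.prems(2) that by (simp add: Suc)
      show "w' - i \<le> v' - i" using v by simp
    qed (rule less.prems(1))
    then show ?thesis by (simp add: v)
  qed
qed

lemma wpoly_diff:
  assumes N: "subgroup N G" and "wpoly N w f" "n \<in> N"
  shows "wpoly N w (diff n f)"
proof (cases w)
  case 0
  then show ?thesis using assms by (simp add: diff_def subgroup.m_closed)
next
  case (Suc v)
  have "n \<in> C (s - 0)" using assms C_s subgroup.mem_carrier[OF N] by simp
  then have "wpoly N (v - 0) (diff n f)" using assms(2,3) unfolding Suc wpoly.simps by blast
  then show ?thesis using wpoly_mono[OF N, of v _ w] Suc by simp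
qed

text \<open>
  One difference lowers the weight by at most \<open>s + 1\<close>, unless its direction is trivial.
\<close>

lemma poly_imp_wpoly:
  assumes N: "subgroup N G"
  shows "poly N d f \<Longrightarrow> wpoly N (d * Suc s) f"
proof (induction d arbitrary: f)
  case (Suc d)
  have "wpoly N (d * Suc s + s - i) (diff n f)" if n: "n \<in> N" "n \<in> C (s - i)" for i n
  proof (cases "i \<le> s")
    case True
    have "wpoly N (d * Suc s) (diff n f)" using Suc n by simp
    then show ?thesis by (rule wpoly_mono[OF N]) (use True in simp)
  next
    case False
    then have "n = \<one>" using n by (simp add: C_0)
    then show ?thesis using subgroup.mem_carrier[OF N] by (intro wpoly_0[OF N]) (simp add: diff_def)
  qed
  moreover have "Suc d * Suc s = Suc (d * Suc s + s)" by simp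
  ultimately show ?case by (simp only: wpoly.simps) blast
qed simp

definition normalizes :: "'a \<Rightarrow> 'a set \<Rightarrow> bool" where
  "normalizes t N \<longleftrightarrow> t \<in> carrier G \<and> (\<forall>x\<in>N. t \<otimes> x \<otimes> inv t \<in> N)"

lemma conj_mult:
  "\<lbrakk>t \<in> carrier G; x \<in> carrier G; y \<in> carrier G\<rbrakk> \<Longrightarrow>
    t \<otimes> (x \<otimes> y) \<otimes> inv t = (t \<otimes> x \<otimes> inv t) \<otimes> (t \<otimes> y \<otimes> inv t)"
  by (simp add: group_simps)

lemma wpoly_conj:
  assumes N: "subgroup N G" and t: "normalizes t N"
  shows "wpoly N w f \<Longrightarrow> wpoly N w (\<lambda>x. f (t \<otimes> x \<otimes> inv t))"
proof (induction w arbitrary: f rule: less_induct)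
  case (less w)
  have tc: "t \<in> carrier G" using t by (simp add: normalizes_def)
  show ?case
  proof (cases w)
    case 0
    then show ?thesis using less.prems t by (simp add: normalizes_def)
  next
    case (Suc v)
    have "wpoly N (v - i) (diff n (\<lambda>x. f (t \<otimes> x \<otimes> inv t)))" if n: "n \<in> N" "n \<in> C (s - i)" for i n
    proof (rule wpoly_cong[OF N])
      have "t \<otimes> n \<otimes> inv t \<in> N \<inter> C (s - i)"
        using t n C_conj[OF tc] by (simp add: normalizes_def)
      then have "wpoly N (v - i) (diff (t \<otimes> n \<otimes> inv t) f)"
        using less.prems unfolding Suc wpoly.simps by blast
      then show "wpoly N (v - i) (\<lambda>x. diff (t \<otimes> n \<otimes> inv t) f (t \<otimes> x \<otimes> inv t))"
        by (rule less.IH[rotated]) (simp add: Suc)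
      fix x assume "x \<in> N"
      then show "diff (t \<otimes> n \<otimes> inv t) f (t \<otimes> x \<otimes> inv t) = diff n (\<lambda>x. f (t \<otimes> x \<otimes> inv t)) x"
        using conj_mult[OF tc] subgroup.mem_carrier[OF N] n by (simp add: diff_def)
    qed
    then show ?thesis by (simp add: Suc)
  qed
qed

text \<open>
  The heart of the argument.  Write \<open>c = [t, n]\<close>, so that \<open>t n t\<^sup>-\<^sup>1 = c n\<close>, and let \<open>\<tau>\<close> be
  conjugation by \<open>t\<close>.  The difference of \<open>f \<circ> \<tau> - f\<close> in direction \<open>n\<close> is the same expression for
  \<open>diff n f\<close>, to which induction applies, plus terms that involve \<open>diff c f\<close>.  The latter have the
  required weight because \<open>c\<close> lies one step deeper in the series than \<open>n\<close>.
\<close>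

lemma wpoly_conj_diff:
  assumes N: "subgroup N G" and t: "normalizes t N"
  shows "wpoly N (Suc w) f \<Longrightarrow> wpoly N w (\<lambda>x. f (t \<otimes> x \<otimes> inv t) - f x)"
proof (induction w arbitrary: f rule: less_induct)
  case (less w)
  have tc: "t \<in> carrier G" using t by (simp add: normalizes_def)
  have Nc: "x \<in> N \<Longrightarrow> x \<in> carrier G" for x by (rule subgroup.mem_carrier[OF N])
  let ?\<tau> = "\<lambda>x. t \<otimes> x \<otimes> inv t"
  show ?case
  proof (cases w)
    case 0
    have const: "f x = f \<one>" if x: "x \<in> N" for x
    proof -
      have "x \<in> C (s - 0)" using Nc[OF x] C_s by simp
      then have "wpoly N 0 (diff x f)" using less.prems x unfolding 0 wpoly.simps(2) by fastforce
      then have "diff x f \<one> = 0" using subgroup.one_closed[OF N] by simp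
      then show ?thesis using Nc[OF x] by (simp add: diff_def)
    qed
    have "f (?\<tau> x) - f x = 0" if "x \<in> N" for x
      using const[OF that] const[of "?\<tau> x"] t that by (simp add: normalizes_def)
    then show ?thesis by (simp add: 0)
  next
    case (Suc v)
    have "wpoly N (v - i) (diff n (\<lambda>x. f (?\<tau> x) - f x))" if n: "n \<in> N" "n \<in> C (s - i)" for i n
    proof -
      define c where "c = commutator t n"
      have nc: "n \<in> carrier G" using n Nc by blast
      have cn: "c \<otimes> n = ?\<tau> n" using conj_eq_commutator[OF tc nc] by (simp add: c_def)
      have cc: "c \<in> carrier G" using tc nc by (simp add: c_def)
      have "c = ?\<tau> n \<otimes> inv n" by (simp add: c_def commutator_def)
      then have cN: "c \<in> N"
        using t n subgroup.m_closed[OF N] subgroup.m_inv_closed[OF N] by (simp add: normalizes_def)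
      have "c \<in> C (s - Suc i)" unfolding c_def by (rule commutator_filtration[OF tc n(2)])
      then have "wpoly N (w - Suc i) (diff c f)" using less.prems cN unfolding wpoly.simps by blast
      then have 1: "wpoly N (v - i) (diff c f)" by (simp add: Suc)
      have 2: "wpoly N (w - i) (diff n f)" using less.prems n unfolding wpoly.simps by blast
      have 3: "wpoly N (v - i) (\<lambda>x. diff n f (?\<tau> x) - diff n f x)"
      proof (cases "i \<le> v")
        case True
        then have "Suc (v - i) = w - i" by (simp add: Suc)
        then show ?thesis using less.IH[of "v - i" "diff n f"] 2 Suc by simp
      next
        case False
        then have "wpoly N 0 (diff n f)" using 2 Suc by simp
        then show ?thesis using t by (intro wpoly_0[OF N]) (simp add: normalizes_def)
      qed
      have "wpoly N (v - i) (\<lambda>x. (diff n (diff c f) (?\<tau> x) + diff c f (?\<tau> x)) +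
          (diff n f (?\<tau> x) - diff n f x))"
        by (intro wpoly_add 3 wpoly_conj[OF N t] wpoly_diff[OF N] 1 n)
      then show ?thesis
      proof (rule wpoly_cong[OF N])
        fix x assume x: "x \<in> N"
        have "?\<tau> (n \<otimes> x) = c \<otimes> (n \<otimes> ?\<tau> x)"
          using conj_mult[OF tc nc Nc[OF x]] cn[symmetric] cc nc tc Nc[OF x] by (simp add: m_assoc)
        then show "(diff n (diff c f) (?\<tau> x) + diff c f (?\<tau> x)) + (diff n f (?\<tau> x) - diff n f x)
            = diff n (\<lambda>x. f (?\<tau> x) - f x) x"
          by (simp add: diff_def)
      qed
    qed
    then show ?thesis by (simp add: Suc)
  qed
qed

section \<open>Extending polynomial functions\<close>

definition additive :: "'a set \<Rightarrow> ('a \<Rightarrow> int) \<Rightarrow> bool" where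
  "additive N e \<longleftrightarrow> (\<forall>x\<in>N. \<forall>y\<in>N. e (x \<otimes> y) = e x + e y)"

lemma additiveD: "additive N e \<Longrightarrow> x \<in> N \<Longrightarrow> y \<in> N \<Longrightarrow> e (x \<otimes> y) = e x + e y"
  by (simp add: additive_def)

lemma additive_one: "subgroup N G \<Longrightarrow> additive N e \<Longrightarrow> e \<one> = 0"
  using additiveD[of N e \<one> \<one>] subgroup.one_closed[of N G] by simp

lemma additive_inv:
  assumes "subgroup N G" "additive N e" "x \<in> N"
  shows "e (inv x) = - e x"
  using additiveD[OF assms(2) assms(3) subgroup.m_inv_closed[OF assms(1,3)]]
    additive_one[OF assms(1,2)] subgroup.mem_carrier[OF assms(1,3)] by simp

lemma additive_nat_pow:
  assumes "subgroup N G" "additive N e" "x \<in> N"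
  shows "e (x [^] (k::nat)) = int k * e x \<and> x [^] k \<in> N"
proof (induction k)
  case 0
  then show ?case using additive_one[OF assms(1,2)] subgroup.one_closed[OF assms(1)] by simp
next
  case (Suc k)
  then have k: "x [^] k \<in> N" "e (x [^] k) = int k * e x" by simp_all
  have "e (x [^] k \<otimes> x) = int (Suc k) * e x"
    unfolding additiveD[OF assms(2) k(1) assms(3)] k(2) by (simp add: distrib_right)
  moreover have "x [^] k \<otimes> x \<in> N" by (rule subgroup.m_closed[OF assms(1) k(1) assms(3)])
  ultimately show ?case by simp
qed

lemma additive_pow:
  assumes "subgroup N G" "additive N e" "x \<in> N"
  shows "e (x [^] (k::int)) = k * e x" and "x [^] k \<in> N"
proof -
  have x: "x \<in> carrier G" by (rule subgroup.mem_carrier[OF assms(1,3)])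
  have "e (x [^] k) = k * e x \<and> x [^] k \<in> N"
  proof (cases k)
    case (nonneg n)
    then show ?thesis using additive_nat_pow[OF assms, of n] by (simp add: int_pow_int)
  next
    case (neg n)
    then have "x [^] k = inv (x [^] Suc n)" using x by (simp add: int_pow_neg int_pow_int del: of_nat_Suc)
    moreover have y: "x [^] Suc n \<in> N" "e (x [^] Suc n) = int (Suc n) * e x"
      using additive_nat_pow[OF assms, of "Suc n"] by (simp_all del: of_nat_Suc)
    moreover have "k * e x = - (int (Suc n) * e x)" by (simp only: neg minus_mult_left)
    ultimately show ?thesis
      by (simp only: additive_inv[OF assms(1,2) y(1)] subgroup.m_inv_closed[OF assms(1) y(1)])
  qed
  then show "e (x [^] k) = k * e x" "x [^] k \<in> N" by auto
qed

definition kernel_of :: "'a set \<Rightarrow> ('a \<Rightarrow> int) \<Rightarrow> 'a set" where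
  "kernel_of N e = {x \<in> N. e x = 0}"

lemma subgroup_kernel:
  assumes "subgroup N G" "additive N e"
  shows "subgroup (kernel_of N e) G"
proof (rule subgroupI)
  show "kernel_of N e \<subseteq> carrier G" using subgroup.mem_carrier[OF assms(1)] by (auto simp: kernel_of_def)
  show "kernel_of N e \<noteq> {}" using subgroup.one_closed[OF assms(1)] additive_one[OF assms]
    by (auto simp: kernel_of_def)
qed (use assms in \<open>auto simp: kernel_of_def additive_inv additiveD subgroup.m_inv_closed subgroup.m_closed\<close>)

text \<open>
  If \<open>e\<close> is additive on a subgroup and \<open>e t = 1\<close>, every element of the subgroup is uniquely \<open>n t\<^sup>k\<close>
  with \<open>e n = 0\<close>; the extension sends it to \<open>f n\<close>.
\<close>

definition extend :: "('a \<Rightarrow> int) \<Rightarrow> 'a \<Rightarrow> ('a \<Rightarrow> int) \<Rightarrow> 'a \<Rightarrow> int" where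
  "extend e t f x = f (x \<otimes> t [^] (- e x))"

context
  fixes M e t
  assumes M: "subgroup M G" and e: "additive M e" and t: "t \<in> M" "e t = 1"
begin

lemma tc: "t \<in> carrier G" by (rule subgroup.mem_carrier[OF M t(1)])

lemma kernel_part: "x \<in> M \<Longrightarrow> x \<otimes> t [^] (- e x) \<in> kernel_of M e"
  using additive_pow[OF M e t(1)] t additiveD[OF e] subgroup.m_closed[OF M]
  by (simp add: kernel_of_def)

lemma extend_kernel: "x \<in> kernel_of M e \<Longrightarrow> extend e t f x = f x"
  using subgroup.mem_carrier[OF M] by (simp add: extend_def kernel_of_def)

lemma kernel_normalized: "x \<in> M \<Longrightarrow> normalizes x (kernel_of M e)"
  using subgroup.mem_carrier[OF M] subgroup.m_closed[OF M] subgroup.m_inv_closed[OF M]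
    additiveD[OF e] additive_inv[OF M e]
  by (simp add: normalizes_def kernel_of_def)

lemma kernel_part_mult:
  assumes m: "m \<in> M" and x: "x \<in> M"
  shows "m \<otimes> x \<otimes> t [^] (- e (m \<otimes> x)) = (m \<otimes> t [^] (- e m)) \<otimes>
    (t [^] e m \<otimes> (x \<otimes> t [^] (- e x)) \<otimes> inv (t [^] e m))"
proof -
  have "- e (m \<otimes> x) = - e x + - e m" using additiveD[OF e m x] by simp
  then have "t [^] (- e (m \<otimes> x)) = t [^] (- e x) \<otimes> t [^] (- e m)"
    by (simp only: int_pow_mult[OF tc])
  moreover have "m \<in> carrier G" "x \<in> carrier G" using m x subgroup.mem_carrier[OF M] by auto
  ultimately show ?thesis using tc by (simp add: int_pow_neg group_simps)
qed

text \<open>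
  If \<open>m = n t\<^sup>k\<close>, then left translation by \<open>m\<close> turns \<open>extend e t f\<close> into the extension of
  \<open>y \<mapsto> f (n \<cdot> t\<^sup>k y t\<^sup>-\<^sup>k)\<close>.  So a difference on the large group is the extension of a sum of a
  difference, composed with a conjugation \<open>\<tau>\<close>, and of \<open>f \<circ> \<tau> - f\<close>; both have smaller weight.
\<close>

lemma poly_extend:
  "wpoly (kernel_of M e) w f \<Longrightarrow> poly M w (extend e t f)"
proof (induction w arbitrary: f)
  case 0
  then show ?case using kernel_part by (simp add: extend_def)
next
  case (Suc w)
  let ?N = "kernel_of M e"
  have N: "subgroup ?N G" by (rule subgroup_kernel[OF M e])
  have "poly M w (diff m (extend e t f))" if m: "m \<in> M" for m
  proof -
    define n where "n = m \<otimes> t [^] (- e m)"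
    define u where "u = t [^] e m"
    define g where "g = (\<lambda>y. diff n f (u \<otimes> y \<otimes> inv u) + (f (u \<otimes> y \<otimes> inv u) - f y))"
    have n: "n \<in> ?N" unfolding n_def by (rule kernel_part[OF m])
    have u: "normalizes u ?N" unfolding u_def
      by (rule kernel_normalized[OF additive_pow(2)[OF M e t(1)]])
    have "n \<in> C (s - 0)" using n subgroup.mem_carrier[OF N] C_s by simp
    then have "wpoly ?N (w - 0) (diff n f)" using Suc.prems n unfolding wpoly.simps by blast
    then have "wpoly ?N w g"
      unfolding g_def using wpoly_conj[OF N u] wpoly_conj_diff[OF N u Suc.prems]
      by (intro wpoly_add) simp_all
    then have "poly M w (extend e t g)" by (rule Suc.IH)
    then show ?thesis
    proof (rule poly_cong[OF M])
      fix x assume x: "x \<in> M"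
      show "extend e t g x = diff m (extend e t f) x"
        using kernel_part_mult[OF m x] by (simp add: extend_def g_def diff_def n_def u_def)
    qed
  qed
  then show ?case by simp
qed

end

end

section \<open>Subgroups of the integers\<close>

lemma subgroup_int_generator:
  fixes D :: "int set"
  assumes "0 \<in> D" and diff: "\<And>x y. x \<in> D \<Longrightarrow> y \<in> D \<Longrightarrow> x - y \<in> D"
  shows "\<exists>d\<in>D. \<forall>x\<in>D. d dvd x"
proof (cases "D = {0}")
  case False
  then obtain z where z: "z \<in> D" "z \<noteq> 0" using assms(1) by blast
  have neg: "- x \<in> D" if "x \<in> D" for x using diff[OF assms(1) that] by simp
  have add: "x + y \<in> D" if "x \<in> D" "y \<in> D" for x y using diff[OF that(1) neg[OF that(2)]] by simp
  have "\<exists>n. 0 < n \<and> int n \<in> D"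
    using z neg[of z] by (intro exI[of _ "nat \<bar>z\<bar>"]) (auto simp: abs_if)
  then obtain n where n: "0 < n" "int n \<in> D" and min: "\<And>m. 0 < m \<Longrightarrow> int m \<in> D \<Longrightarrow> n \<le> m"
    using exists_least_iff[of "\<lambda>n. 0 < n \<and> int n \<in> D"] by (auto simp: not_less[symmetric])
  have mult: "int n * int k \<in> D" for k
    by (induction k) (use assms(1) n(2) add in \<open>auto simp: algebra_simps\<close>)
  have multi: "int n * k \<in> D" for k
    using mult[of "nat k"] neg[OF mult[of "nat (- k)"]] by (cases "k \<ge> 0") auto
  have "int n dvd x" if "x \<in> D" for x
  proof -
    have "x mod int n \<in> D"
      using diff[OF that multi[of "x div int n"]] by (simp add: minus_mult_div_eq_mod)
    moreover have "0 \<le> x mod int n" "x mod int n < int n" using n by simp_all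
    ultimately have "x mod int n = 0" using min[of "nat (x mod int n)"] by force
    then show ?thesis by (simp add: dvd_eq_mod_eq_0)
  qed
  then show ?thesis using n by blast
qed auto

context group
begin

section \<open>Finite index\<close>

text \<open>
  The finite set \<open>R\<close> meets every left coset of \<open>K\<close> in \<open>N\<close>, possibly more than once.
\<close>

definition finite_index :: "'a set \<Rightarrow> 'a set \<Rightarrow> bool" where
  "finite_index N K \<longleftrightarrow> (\<exists>R. finite R \<and> R \<subseteq> N \<and> (\<forall>x\<in>N. \<exists>r\<in>R. inv r \<otimes> x \<in> K))"

lemma finite_indexI:
  assumes "finite (\<kappa> ` N)" "\<And>x y. x \<in> N \<Longrightarrow> y \<in> N \<Longrightarrow> \<kappa> x = \<kappa> y \<Longrightarrow> inv x \<otimes> y \<in> K"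
  shows "finite_index N K"
  unfolding finite_index_def
proof (intro exI[of _ "inv_into N \<kappa> ` \<kappa> ` N"] conjI ballI)
  show "inv_into N \<kappa> ` \<kappa> ` N \<subseteq> N" by (auto intro: inv_into_into)
  fix x assume "x \<in> N"
  then show "\<exists>r\<in>inv_into N \<kappa> ` \<kappa> ` N. inv r \<otimes> x \<in> K"
    using assms(2)[of "inv_into N \<kappa> (\<kappa> x)" x] by (auto simp: f_inv_into_f inv_into_into)
qed (use assms in simp)

lemma finite_index_trans:
  assumes N: "subgroup N G" and K: "K \<subseteq> N" and 1: "finite_index N K" and 2: "finite_index K L"
  shows "finite_index N L"
proof -
  obtain R where R: "finite R" "R \<subseteq> N" "\<And>x. x \<in> N \<Longrightarrow> \<exists>r\<in>R. inv r \<otimes> x \<in> K"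
    using 1 unfolding finite_index_def by blast
  obtain S where S: "finite S" "S \<subseteq> K" "\<And>x. x \<in> K \<Longrightarrow> \<exists>r\<in>S. inv r \<otimes> x \<in> L"
    using 2 unfolding finite_index_def by blast
  let ?T = "(\<lambda>(r, s). r \<otimes> s) ` (R \<times> S)"
  have "\<exists>r\<in>?T. inv r \<otimes> x \<in> L" if x: "x \<in> N" for x
  proof -
    obtain r where r: "r \<in> R" "inv r \<otimes> x \<in> K" using R(3)[OF x] by blast
    obtain u where u: "u \<in> S" "inv u \<otimes> (inv r \<otimes> x) \<in> L" using S(3)[OF r(2)] by blast
    have "r \<in> carrier G" "u \<in> carrier G" "x \<in> carrier G"
      using r u x R S K subgroup.mem_carrier[OF N] by auto
    then have "inv (r \<otimes> u) \<otimes> x \<in> L" using u by (simp add: group_simps)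
    moreover have "r \<otimes> u \<in> ?T" using imageI[of "(r, u)" "R \<times> S" "\<lambda>(r, s). r \<otimes> s"] r u by simp
    ultimately show ?thesis by blast
  qed
  moreover have "?T \<subseteq> N"
  proof clarify
    fix r u assume "r \<in> R" "u \<in> S"
    then show "r \<otimes> u \<in> N" using subgroup.m_closed[OF N, of r u] R(2) S(2) K by blast
  qed
  moreover have "finite ?T" using R(1) S(1) by simp
  ultimately show ?thesis unfolding finite_index_def by blast
qed

text \<open>
  Selecting from the coset as a set makes \<open>\<rho> x\<close> depend on nothing but the coset of \<open>x\<close>.
\<close>

lemma coset_representatives:
  assumes N: "subgroup N G" and K: "subgroup K G" "K \<subseteq> N" and fin: "finite_index N K"
  obtains \<rho> :: "'a \<Rightarrow> 'a" where "finite (\<rho> ` N)"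
    and "\<And>x. x \<in> N \<Longrightarrow> \<rho> x \<in> N" and "\<And>x. x \<in> N \<Longrightarrow> inv x \<otimes> \<rho> x \<in> K"
    and "\<And>x y. x \<in> N \<Longrightarrow> y \<in> N \<Longrightarrow> inv x \<otimes> y \<in> K \<Longrightarrow> \<rho> x = \<rho> y"
proof -
  define cl where "cl x = {y \<in> N. inv x \<otimes> y \<in> K}" for x
  define \<rho> where "\<rho> x = (SOME y. y \<in> cl x)" for x
  have Nc: "x \<in> N \<Longrightarrow> x \<in> carrier G" for x by (rule subgroup.mem_carrier[OF N])
  have eq: "\<rho> x = \<rho> y" if "x \<in> N" "y \<in> N" "inv x \<otimes> y \<in> K" for x y
  proof -
    have "inv x \<otimes> z \<in> K \<longleftrightarrow> inv y \<otimes> z \<in> K" if z: "z \<in> N" for z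
    proof
      assume "inv y \<otimes> z \<in> K"
      from subgroup.m_closed[OF K(1) \<open>inv x \<otimes> y \<in> K\<close> this] show "inv x \<otimes> z \<in> K"
        using Nc \<open>x \<in> N\<close> \<open>y \<in> N\<close> z by (simp add: group_simps)
    next
      assume "inv x \<otimes> z \<in> K"
      from subgroup.m_closed[OF K(1) subgroup.m_inv_closed[OF K(1) \<open>inv x \<otimes> y \<in> K\<close>] this]
      show "inv y \<otimes> z \<in> K"
        using Nc \<open>x \<in> N\<close> \<open>y \<in> N\<close> z by (simp add: group_simps)
    qed
    then have "cl x = cl y" unfolding cl_def by blast
    then show ?thesis by (simp add: \<rho>_def)
  qed
  have mem: "\<rho> x \<in> cl x" if "x \<in> N" for x
  proof -
    have "x \<in> cl x" using that Nc subgroup.one_closed[OF K(1)] by (simp add: cl_def)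
    then show ?thesis unfolding \<rho>_def by (rule someI)
  qed
  obtain R where R: "finite R" "R \<subseteq> N" "\<And>x. x \<in> N \<Longrightarrow> \<exists>r\<in>R. inv r \<otimes> x \<in> K"
    using fin unfolding finite_index_def by blast
  have "\<rho> ` N \<subseteq> \<rho> ` R"
  proof
    fix z assume "z \<in> \<rho> ` N"
    then obtain x where x: "x \<in> N" "z = \<rho> x" by blast
    obtain r where "r \<in> R" "inv r \<otimes> x \<in> K" using R(3)[OF x(1)] by blast
    then have "z = \<rho> r" using eq[of r x] R(2) x by (simp add: subset_iff)
    then show "z \<in> \<rho> ` R" using \<open>r \<in> R\<close> by (rule image_eqI)
  qed
  then have "finite (\<rho> ` N)" by (rule finite_subset) (simp add: R(1))
  moreover have "\<rho> x \<in> N" if "x \<in> N" for x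
    using mem[OF that] by (simp add: cl_def)
  moreover have "inv x \<otimes> \<rho> x \<in> K" if "x \<in> N" for x
    using mem[OF that] by (simp add: cl_def)
  ultimately show thesis using eq by (rule that)
qed

text \<open>
  The transfer: \<open>e g\<close> is the sum over representatives \<open>r\<close> of \<open>\<epsilon> (\<rho> (g r)\<^sup>-\<^sup>1 g r)\<close>.  It is additive
  because \<open>r \<mapsto> \<rho> (h r)\<close> permutes the representatives.  For \<open>g \<in> K\<close> every summand equals \<open>\<epsilon> g\<close> by
  invariance under conjugation, so that \<open>m\<close> is the index.
\<close>

lemma transfer_homomorphism:
  fixes \<epsilon> :: "'a \<Rightarrow> int"
  assumes N: "subgroup N G" and K: "subgroup K G" "K \<subseteq> N" and fin: "finite_index N K"
    and add: "\<And>x y. x \<in> K \<Longrightarrow> y \<in> K \<Longrightarrow> \<epsilon> (x \<otimes> y) = \<epsilon> x + \<epsilon> y"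
    and conj: "\<And>g x. g \<in> N \<Longrightarrow> x \<in> K \<Longrightarrow> g \<otimes> x \<otimes> inv g \<in> K \<and> \<epsilon> (g \<otimes> x \<otimes> inv g) = \<epsilon> x"
  shows "\<exists>e m. 0 < m \<and> (\<forall>x\<in>N. \<forall>y\<in>N. e (x \<otimes> y) = e x + e y) \<and> (\<forall>x\<in>K. e x = m * \<epsilon> x)"
proof -
  have Nc: "x \<in> N \<Longrightarrow> x \<in> carrier G" for x by (rule subgroup.mem_carrier[OF N])
  have Kc: "x \<in> K \<Longrightarrow> x \<in> carrier G" for x by (rule subgroup.mem_carrier[OF K(1)])
  note Nm = subgroup.m_closed[OF N] and Ni = subgroup.m_inv_closed[OF N]
  obtain \<rho> where fin\<rho>: "finite (\<rho> ` N)"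
    and \<rho>N: "\<And>x. x \<in> N \<Longrightarrow> \<rho> x \<in> N" and \<rho>K: "\<And>x. x \<in> N \<Longrightarrow> inv x \<otimes> \<rho> x \<in> K"
    and \<rho>eq: "\<And>x y. x \<in> N \<Longrightarrow> y \<in> N \<Longrightarrow> inv x \<otimes> y \<in> K \<Longrightarrow> \<rho> x = \<rho> y"
    by (rule coset_representatives[OF N K fin]) blast
  define R where "R = \<rho> ` N"
  have RN: "r \<in> R \<Longrightarrow> r \<in> N" for r using \<rho>N by (auto simp: R_def)
  have \<rho>R: "\<rho> r = r" if "r \<in> R" for r
  proof -
    obtain x where x: "x \<in> N" "r = \<rho> x" using \<open>r \<in> R\<close> by (auto simp: R_def)
    then show ?thesis using \<rho>eq[OF x(1) \<rho>N[OF x(1)] \<rho>K[OF x(1)]] by simp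
  qed
  have \<rho>K': "inv (\<rho> x) \<otimes> x \<in> K" if "x \<in> N" for x
    using subgroup.m_inv_closed[OF K(1) \<rho>K[OF that]] Nc[OF that] Nc[OF \<rho>N[OF that]]
    by (simp add: inv_mult_group)
  define e where "e g = (\<Sum>r\<in>R. \<epsilon> (inv (\<rho> (g \<otimes> r)) \<otimes> (g \<otimes> r)))" for g
  have hom: "e (g \<otimes> h) = e g + e h" if g: "g \<in> N" and h: "h \<in> N" for g h
  proof -
    let ?\<pi> = "\<lambda>r. \<rho> (h \<otimes> r)"
    have "inj_on ?\<pi> R"
    proof
      fix r r' assume r: "r \<in> R" "r' \<in> R" and eq: "\<rho> (h \<otimes> r) = \<rho> (h \<otimes> r')"
      have 1: "h \<otimes> r \<in> N" "h \<otimes> r' \<in> N" using h r RN Nm by auto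
      have "(inv (h \<otimes> r) \<otimes> \<rho> (h \<otimes> r)) \<otimes> (inv (\<rho> (h \<otimes> r')) \<otimes> (h \<otimes> r')) \<in> K"
        by (rule subgroup.m_closed[OF K(1) \<rho>K[OF 1(1)] \<rho>K'[OF 1(2)]])
      then have "inv r \<otimes> r' \<in> K"
        using Nc[OF h] Nc[OF RN[OF r(1)]] Nc[OF RN[OF r(2)]] Nc[OF \<rho>N[OF 1(2)]]
        unfolding eq by (simp add: group_simps)
      then show "r = r'" using \<rho>eq[of r r'] \<rho>R r RN by simp
    qed
    moreover have "?\<pi> ` R \<subseteq> R" using h RN Nm by (auto simp: R_def)
    ultimately have bij: "?\<pi> ` R = R" using fin\<rho> by (intro endo_inj_surj) (auto simp: R_def)
    have split: "\<epsilon> (inv (\<rho> ((g \<otimes> h) \<otimes> r)) \<otimes> ((g \<otimes> h) \<otimes> r)) =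
        \<epsilon> (inv (\<rho> (g \<otimes> ?\<pi> r)) \<otimes> (g \<otimes> ?\<pi> r)) + \<epsilon> (inv (?\<pi> r) \<otimes> (h \<otimes> r))" if r: "r \<in> R" for r
    proof -
      have hr: "h \<otimes> r \<in> N" using h r RN Nm by auto
      have p: "?\<pi> r \<in> N" by (rule \<rho>N[OF hr])
      have gp: "g \<otimes> ?\<pi> r \<in> N" by (rule Nm[OF g p])
      have ghr: "(g \<otimes> h) \<otimes> r \<in> N" using g h r RN Nm by auto
      have c: "g \<in> carrier G" "h \<in> carrier G" "r \<in> carrier G" "?\<pi> r \<in> carrier G"
        using g h r RN Nc p by auto
      have "inv (g \<otimes> ?\<pi> r) \<otimes> ((g \<otimes> h) \<otimes> r) = inv (?\<pi> r) \<otimes> (h \<otimes> r)"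
        using c by (simp add: group_simps)
      then have same: "\<rho> (g \<otimes> ?\<pi> r) = \<rho> ((g \<otimes> h) \<otimes> r)"
        using \<rho>K'[OF hr] by (intro \<rho>eq gp ghr) simp
      have d: "\<rho> (g \<otimes> ?\<pi> r) \<in> carrier G" by (rule Nc[OF \<rho>N[OF gp]])
      have "inv (\<rho> ((g \<otimes> h) \<otimes> r)) \<otimes> ((g \<otimes> h) \<otimes> r) =
          (inv (\<rho> (g \<otimes> ?\<pi> r)) \<otimes> (g \<otimes> ?\<pi> r)) \<otimes> (inv (?\<pi> r) \<otimes> (h \<otimes> r))"
        unfolding same[symmetric] using c d by (simp add: group_simps)
      then show ?thesis using add[OF \<rho>K'[OF gp] \<rho>K'[OF hr]] by simp
    qed
    have "e (g \<otimes> h) = (\<Sum>r\<in>R. \<epsilon> (inv (\<rho> (g \<otimes> ?\<pi> r)) \<otimes> (g \<otimes> ?\<pi> r))) + e h"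
      unfolding e_def using split by (simp add: sum.distrib)
    also have "(\<Sum>r\<in>R. \<epsilon> (inv (\<rho> (g \<otimes> ?\<pi> r)) \<otimes> (g \<otimes> ?\<pi> r))) = (\<Sum>r\<in>?\<pi> ` R. \<epsilon> (inv (\<rho> (g \<otimes> r)) \<otimes> (g \<otimes> r)))"
      by (simp add: sum.reindex[OF \<open>inj_on ?\<pi> R\<close>])
    finally show ?thesis unfolding bij by (simp add: e_def)
  qed
  have onK: "e x = int (card R) * \<epsilon> x" if x: "x \<in> K" for x
  proof -
    have xN: "x \<in> N" using x K by blast
    have "\<epsilon> (inv (\<rho> (x \<otimes> r)) \<otimes> (x \<otimes> r)) = \<epsilon> x" if r: "r \<in> R" for r
    proof -
      have c: "x \<in> carrier G" "r \<in> carrier G" using xN RN[OF r] Nc by auto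
      have xr: "x \<otimes> r \<in> N" by (rule Nm[OF xN RN[OF r]])
      have k: "inv r \<otimes> x \<otimes> inv (inv r) \<in> K" "\<epsilon> (inv r \<otimes> x \<otimes> inv (inv r)) = \<epsilon> x"
        using conj[OF Ni[OF RN[OF r]] x] by auto
      have "inv (x \<otimes> r) \<otimes> r = inv (inv r \<otimes> x \<otimes> inv (inv r))" using c by (simp add: group_simps)
      then have "inv (x \<otimes> r) \<otimes> r \<in> K" using subgroup.m_inv_closed[OF K(1) k(1)] by simp
      then have "\<rho> (x \<otimes> r) = r" using \<rho>eq[OF xr RN[OF r]] \<rho>R[OF r] by simp
      then show ?thesis using k(2) c by (simp add: group_simps)
    qed
    then show ?thesis by (simp add: e_def)
  qed
  have "R \<noteq> {}" using subgroup.one_closed[OF N] by (auto simp: R_def)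
  then have "0 < int (card R)" using fin\<rho> by (simp add: R_def card_gt_0_iff)
  then show ?thesis using hom onK by (intro exI[of _ e] exI[of _ "int (card R)"]) blast
qed

text \<open>
  A finitely generated group has only finitely many actions on a given finite set \<open>\<Omega>\<close>, since an action
  is determined by the generators.  Take for \<open>\<Omega>\<close> the cosets of \<open>K\<close> and for \<open>K'\<close> the elements that
  are trivial in every action.  Conjugation by a normalizing element turns actions into actions, and
  therefore preserves \<open>K'\<close>; and \<open>K'\<close> lies in the stabilizer \<open>K\<close> of the coset \<open>K\<close>.
\<close>

lemma invariant_finite_index:
  assumes N: "subgroup N G" and S: "finite S" "S \<subseteq> carrier G" "generate G S = N"
    and K: "subgroup K G" "K \<subseteq> N" and fin: "finite_index N K"
  shows "\<exists>K'. subgroup K' G \<and> K' \<subseteq> K \<and> finite_index N K' \<and>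
    (\<forall>t\<in>carrier G. (\<forall>x\<in>N. t \<otimes> x \<otimes> inv t \<in> N) \<longrightarrow> (\<forall>x\<in>K'. t \<otimes> x \<otimes> inv t \<in> K'))"
proof -
  have Nc: "x \<in> N \<Longrightarrow> x \<in> carrier G" for x by (rule subgroup.mem_carrier[OF N])
  note Nm = subgroup.m_closed[OF N] and Ni = subgroup.m_inv_closed[OF N]
    and N1 = subgroup.one_closed[OF N]
  obtain \<rho> where fin\<rho>: "finite (\<rho> ` N)"
    and \<rho>N: "\<And>x. x \<in> N \<Longrightarrow> \<rho> x \<in> N" and \<rho>K: "\<And>x. x \<in> N \<Longrightarrow> inv x \<otimes> \<rho> x \<in> K"
    and \<rho>eq: "\<And>x y. x \<in> N \<Longrightarrow> y \<in> N \<Longrightarrow> inv x \<otimes> y \<in> K \<Longrightarrow> \<rho> x = \<rho> y"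
    by (rule coset_representatives[OF N K fin]) blast
  define \<Omega> where "\<Omega> = \<rho> ` N"
  have \<Omega>: "finite \<Omega>" using fin\<rho> by (simp add: \<Omega>_def)
  define Act where "Act = {act :: 'a \<Rightarrow> 'a \<Rightarrow> 'a. (\<forall>n\<in>N. \<forall>\<omega>\<in>\<Omega>. act n \<omega> \<in> \<Omega>) \<and> (\<forall>\<omega>\<in>\<Omega>. act \<one> \<omega> = \<omega>) \<and>
    (\<forall>m\<in>N. \<forall>n\<in>N. \<forall>\<omega>\<in>\<Omega>. act (m \<otimes> n) \<omega> = act m (act n \<omega>))}"
  have act_closed: "act n \<omega> \<in> \<Omega>" if "act \<in> Act" "n \<in> N" "\<omega> \<in> \<Omega>" for act n \<omega>
    using that by (simp add: Act_def)
  have act_one: "act \<one> \<omega> = \<omega>" if "act \<in> Act" "\<omega> \<in> \<Omega>" for act \<omega>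
    using that by (simp add: Act_def)
  have act_mult: "act (m \<otimes> n) \<omega> = act m (act n \<omega>)"
    if "act \<in> Act" "m \<in> N" "n \<in> N" "\<omega> \<in> \<Omega>" for act m n \<omega>
    using that by (simp add: Act_def)
  have act_inv1: "act (inv n) (act n \<omega>) = \<omega>" and act_inv2: "act n (act (inv n) \<omega>) = \<omega>"
    if "act \<in> Act" "n \<in> N" "\<omega> \<in> \<Omega>" for act n \<omega>
    using act_mult[OF that(1) Ni[OF that(2)] that(2,3)] act_mult[OF that(1,2) Ni[OF that(2)] that(3)]
      act_one[OF that(1,3)] Nc[OF that(2)] by simp_all
  define K' where "K' = {n \<in> N. \<forall>act\<in>Act. \<forall>\<omega>\<in>\<Omega>. act n \<omega> = \<omega>}"
  have K'D: "act n \<omega> = \<omega>" if "n \<in> K'" "act \<in> Act" "\<omega> \<in> \<Omega>" for n act \<omega>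
    using that unfolding K'_def by blast
  have K'_sub: "subgroup K' G"
  proof (rule subgroupI)
    show "K' \<subseteq> carrier G" using Nc by (auto simp: K'_def)
    show "K' \<noteq> {}" using N1 act_one by (auto simp: K'_def)
    show "inv n \<in> K'" if "n \<in> K'" for n
    proof -
      have n: "n \<in> N" using that by (simp add: K'_def)
      have "act (inv n) \<omega> = \<omega>" if "act \<in> Act" "\<omega> \<in> \<Omega>" for act \<omega>
      proof -
        have "act n \<omega> = \<omega>" by (rule K'D[OF \<open>n \<in> K'\<close> that])
        then show ?thesis using act_inv1[OF that(1) n that(2)] by simp
      qed
      then show ?thesis using Ni[OF n] by (simp add: K'_def)
    qed
    show "m \<otimes> n \<in> K'" if "m \<in> K'" "n \<in> K'" for m n
    proof -
      have N: "m \<in> N" "n \<in> N" using that by (simp_all add: K'_def)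
      have "act (m \<otimes> n) \<omega> = \<omega>" if "act \<in> Act" "\<omega> \<in> \<Omega>" for act \<omega>
        using act_mult[OF that(1) N that(2)] K'D[OF \<open>m \<in> K'\<close> that] K'D[OF \<open>n \<in> K'\<close> that] by simp
      then show ?thesis using Nm[OF N] by (simp add: K'_def)
    qed
  qed
  have "K' \<subseteq> K"
  proof
    fix n assume n: "n \<in> K'"
    then have nN: "n \<in> N" by (simp add: K'_def)
    have step: "\<rho> (m \<otimes> \<rho> x) = \<rho> (m \<otimes> x)" if "m \<in> N" "x \<in> N" for m x
    proof (rule \<rho>eq[symmetric])
      have "m \<in> carrier G" "x \<in> carrier G" "\<rho> x \<in> carrier G" using that Nc \<rho>N by auto
      then have "inv (m \<otimes> x) \<otimes> (m \<otimes> \<rho> x) = inv x \<otimes> \<rho> x" by (simp add: group_simps)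
      then show "inv (m \<otimes> x) \<otimes> (m \<otimes> \<rho> x) \<in> K" using \<rho>K[OF that(2)] by simp
    qed (use that Nm \<rho>N in auto)
    \<comment> \<open>The action on cosets, carried over to their representatives.\<close>
    define act where "act = (\<lambda>m r. \<rho> (m \<otimes> r))"
    have "act \<in> Act"
    proof -
      have "act m \<omega> \<in> \<Omega>" if "m \<in> N" "\<omega> \<in> \<Omega>" for m \<omega>
        using that Nm \<rho>N by (auto simp: act_def \<Omega>_def)
      moreover have "act \<one> \<omega> = \<omega>" if "\<omega> \<in> \<Omega>" for \<omega>
      proof -
        obtain x where x: "x \<in> N" "\<omega> = \<rho> x" using \<open>\<omega> \<in> \<Omega>\<close> by (auto simp: \<Omega>_def)
        have "\<rho> (\<one> \<otimes> \<rho> x) = \<rho> (\<one> \<otimes> x)" by (rule step[OF N1 x(1)])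
        then show ?thesis using x Nc \<rho>N by (simp add: act_def)
      qed
      moreover have "act (m \<otimes> m') \<omega> = act m (act m' \<omega>)" if "m \<in> N" "m' \<in> N" "\<omega> \<in> \<Omega>" for m m' \<omega>
      proof -
        have w: "\<omega> \<in> N" using that \<rho>N by (auto simp: \<Omega>_def)
        show ?thesis using step[OF that(1) Nm[OF that(2) w]] Nc that w by (simp add: act_def m_assoc)
      qed
      ultimately show ?thesis by (simp add: Act_def)
    qed
    moreover have "\<rho> \<one> \<in> \<Omega>" using N1 by (simp add: \<Omega>_def)
    ultimately have "\<rho> (n \<otimes> \<rho> \<one>) = \<rho> \<one>" using K'D[OF n, of act "\<rho> \<one>"] by (simp add: act_def)
    then have eq: "\<rho> n = \<rho> \<one>" using step[OF nN N1] Nc[OF nN] by simp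
    have "inv n \<otimes> \<rho> \<one> \<in> K" using \<rho>K[OF nN] eq by simp
    moreover have "\<rho> \<one> \<in> K" using \<rho>K[OF N1] Nc[OF \<rho>N[OF N1]] by simp
    ultimately have "(inv n \<otimes> \<rho> \<one>) \<otimes> inv (\<rho> \<one>) \<in> K"
      using subgroup.m_closed[OF K(1)] subgroup.m_inv_closed[OF K(1)] by simp
    then have "inv n \<in> K" using Nc[OF nN] Nc[OF \<rho>N[OF N1]] by (simp add: group_simps)
    then show "n \<in> K" using subgroup.m_inv_closed[OF K(1), of "inv n"] Nc[OF nN] by simp
  qed
  moreover have "\<forall>x\<in>K'. t \<otimes> x \<otimes> inv t \<in> K'" if t: "t \<in> carrier G" "\<forall>x\<in>N. t \<otimes> x \<otimes> inv t \<in> N" for t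
  proof
    fix x assume x: "x \<in> K'"
    then have xN: "x \<in> N" by (simp add: K'_def)
    have "act (t \<otimes> x \<otimes> inv t) \<omega> = \<omega>" if act: "act \<in> Act" and \<omega>: "\<omega> \<in> \<Omega>" for act \<omega>
    proof -
      define act' where "act' = (\<lambda>n. act (t \<otimes> n \<otimes> inv t))"
      have "act' \<in> Act"
      proof -
        have "act' (m \<otimes> n) \<omega> = act' m (act' n \<omega>)" if "m \<in> N" "n \<in> N" "\<omega> \<in> \<Omega>" for m n \<omega>
        proof -
          have "t \<otimes> (m \<otimes> n) \<otimes> inv t = (t \<otimes> m \<otimes> inv t) \<otimes> (t \<otimes> n \<otimes> inv t)"
            using t that Nc by (simp add: group_simps)
          then show ?thesis using act_mult[OF act, of "t \<otimes> m \<otimes> inv t" "t \<otimes> n \<otimes> inv t"] t that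
            by (simp add: act'_def)
        qed
        then show ?thesis using t act_closed[OF act] act_one[OF act] by (simp add: Act_def act'_def)
      qed
      from K'D[OF x this \<omega>] show ?thesis by (simp add: act'_def)
    qed
    then show "t \<otimes> x \<otimes> inv t \<in> K'" using t xN by (simp add: K'_def)
  qed
  moreover have "finite_index N K'"
  proof -
    have SN: "S \<subseteq> N" using generate.incl[of _ S G] S(3) by (simp add: subset_iff)
    \<comment> \<open>The table of an action records the permutations given by the generators.\<close>
    define \<tau> where "\<tau> act = restrict (\<lambda>(x, \<omega>). act x \<omega>) (S \<times> \<Omega>)" for act :: "'a \<Rightarrow> 'a \<Rightarrow> 'a"
    have "\<tau> ` Act \<subseteq> (S \<times> \<Omega>) \<rightarrow>\<^sub>E \<Omega>"
    proof clarify
      fix act assume "act \<in> Act"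
      then have "act x \<omega> \<in> \<Omega>" if "x \<in> S" "\<omega> \<in> \<Omega>" for x \<omega>
        by (rule act_closed[OF _ subsetD[OF SN that(1)] that(2)])
      then show "\<tau> act \<in> (S \<times> \<Omega>) \<rightarrow>\<^sub>E \<Omega>"
        unfolding \<tau>_def restrict_PiE_iff by auto
    qed
    then have fin\<tau>: "finite (\<tau> ` Act)"
      by (rule finite_subset) (use S(1) \<Omega> in \<open>auto intro!: finite_PiE\<close>)
    have determined: "\<forall>\<omega>\<in>\<Omega>. act n \<omega> = act' n \<omega>"
      if a: "act \<in> Act" "act' \<in> Act" "\<tau> act = \<tau> act'" and n: "n \<in> N" for act act' n
    proof -
      have S_eq: "act x \<omega> = act' x \<omega>" if "x \<in> S" "\<omega> \<in> \<Omega>" for x \<omega>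
        using fun_cong[OF a(3), of "(x, \<omega>)"] that by (simp add: \<tau>_def)
      have "n \<in> generate G S" using n S(3) by simp
      then show ?thesis
      proof induction
        case one
        show ?case using act_one[OF a(1)] act_one[OF a(2)] by simp
      next
        case (incl h)
        then show ?case using S_eq by simp
      next
        case (inv h)
        have h: "h \<in> N" using inv SN by blast
        show ?case
        proof
          fix \<omega> assume w: "\<omega> \<in> \<Omega>"
          have "act (inv h) \<omega> = act' (inv h) (act' h (act (inv h) \<omega>))"
            using act_inv1[OF a(2) h] act_closed[OF a(1) Ni[OF h] w] by simp
          also have "act' h (act (inv h) \<omega>) = act h (act (inv h) \<omega>)"
            using S_eq[OF inv] act_closed[OF a(1) Ni[OF h] w] by simp
          also have "\<dots> = \<omega>" by (rule act_inv2[OF a(1) h w])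
          finally show "act (inv h) \<omega> = act' (inv h) \<omega>" .
        qed
      next
        case (eng h1 h2)
        then have h: "h1 \<in> N" "h2 \<in> N" using S(3) by auto
        then show ?case
          using eng.IH act_mult[OF a(1) h] act_mult[OF a(2) h] act_closed[OF a(2) h(2)] by simp
      qed
    qed
    define r where "r = inv_into Act \<tau>"
    have r: "r (\<tau> act) \<in> Act" "\<tau> (r (\<tau> act)) = \<tau> act" if "act \<in> Act" for act
      unfolding r_def using that by (simp_all add: inv_into_into f_inv_into_f[OF imageI])
    define \<kappa> where "\<kappa> n = restrict (\<lambda>(T, \<omega>). r T n \<omega>) (\<tau> ` Act \<times> \<Omega>)" for n
    have "\<kappa> ` N \<subseteq> (\<tau> ` Act \<times> \<Omega>) \<rightarrow>\<^sub>E \<Omega>"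
    proof clarify
      fix n assume n: "n \<in> N"
      have "r T n \<omega> \<in> \<Omega>" if "T \<in> \<tau> ` Act" "\<omega> \<in> \<Omega>" for T \<omega>
        using that r(1) act_closed[OF _ n] by auto
      then show "\<kappa> n \<in> (\<tau> ` Act \<times> \<Omega>) \<rightarrow>\<^sub>E \<Omega>"
        unfolding \<kappa>_def restrict_PiE_iff by auto
    qed
    then have "finite (\<kappa> ` N)"
      by (rule finite_subset) (use fin\<tau> \<Omega> in \<open>auto intro!: finite_PiE\<close>)
    moreover have "inv x \<otimes> y \<in> K'" if xy: "x \<in> N" "y \<in> N" "\<kappa> x = \<kappa> y" for x y
    proof -
      have "act (inv x \<otimes> y) \<omega> = \<omega>" if a: "act \<in> Act" and w: "\<omega> \<in> \<Omega>" for act \<omega>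
      proof -
        have "act y \<omega> = r (\<tau> act) y \<omega>" using determined[OF a r(1)[OF a] r(2)[OF a, symmetric] xy(2)] w by blast
        also have "\<dots> = r (\<tau> act) x \<omega>"
          using fun_cong[OF xy(3), of "(\<tau> act, \<omega>)"] a w by (simp add: \<kappa>_def)
        also have "\<dots> = act x \<omega>" using determined[OF a r(1)[OF a] r(2)[OF a, symmetric] xy(1)] w by simp
        finally show ?thesis
          using act_mult[OF a Ni[OF xy(1)] xy(2) w] act_inv1[OF a xy(1) w] by simp
      qed
      then show ?thesis using Nm[OF Ni[OF xy(1)] xy(2)] by (simp add: K'_def)
    qed
    ultimately show ?thesis by (rule finite_indexI)
  qed
  ultimately show ?thesis using K'_sub by blast
qed

end

context central_series
begin

section \<open>Exponents in the cyclic factors\<close>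

text \<open>
  A relation and not a function, because the exponent of \<open>x\<close> modulo \<open>C j\<close> is only determined up to
  the order of \<open>a j\<close> modulo \<open>C j\<close>.
\<close>

definition exponent :: "nat \<Rightarrow> 'a \<Rightarrow> int \<Rightarrow> bool" where
  "exponent j x k \<longleftrightarrow> x \<in> C (Suc j) \<and> inv (a j [^] k) \<otimes> x \<in> C j"

lemma a_carrier: "a j \<in> carrier G"
  by (rule C_carrier[OF a_in])

lemma a_pow_carrier [simp]: "a j [^] (k::int) \<in> carrier G"
  by (rule int_pow_closed[OF a_carrier])

lemma exponent_carrier: "exponent j x k \<Longrightarrow> x \<in> carrier G"
  using C_carrier[of x "Suc j"] by (simp add: exponent_def)

lemma C_Suc: "x \<in> C j \<Longrightarrow> x \<in> C (Suc j)"
  by (rule subsetD[OF C_mono])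

lemma exponent_exists:
  assumes "x \<in> C (Suc j)"
  obtains k where "exponent j x k"
proof -
  obtain k :: int and c where k: "c \<in> C j" "x = a j [^] k \<otimes> c" using C_cyclic[OF assms] by (elim exE bexE)
  have "inv (a j [^] k) \<otimes> x = c"
    unfolding k(2) by (rule inv_cancel(1)[OF a_pow_carrier C_carrier[OF k(1)]])
  then have "exponent j x k" using k(1) assms by (simp add: exponent_def)
  then show thesis by (rule that)
qed

lemma exponent_0: "exponent j x 0 \<longleftrightarrow> x \<in> C j"
proof
  assume e: "exponent j x 0"
  have "inv (a j [^] (0::int)) \<otimes> x = x" using exponent_carrier[OF e] by simp
  then show "x \<in> C j" using e unfolding exponent_def by metis
next
  assume x: "x \<in> C j"
  have "inv (a j [^] (0::int)) \<otimes> x = x" using C_carrier[OF x] by simp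
  then show "exponent j x 0" using x C_Suc[OF x] unfolding exponent_def by metis
qed

lemma exponent_mult:
  assumes "exponent j x k" "exponent j y l"
  shows "exponent j (x \<otimes> y) (k + l)"
proof -
  have c: "x \<in> carrier G" "y \<in> carrier G"
    using exponent_carrier[OF assms(1)] exponent_carrier[OF assms(2)] by simp_all
  have x: "inv (a j [^] k) \<otimes> x \<in> C j" and y: "inv (a j [^] l) \<otimes> y \<in> C j"
    using assms by (simp_all add: exponent_def)
  have "inv (a j [^] l) \<otimes> (inv (a j [^] k) \<otimes> x) \<otimes> inv (inv (a j [^] l)) \<in> C j"
    by (rule C_conj[OF _ x]) simp
  from subgroup.m_closed[OF C_subgroup this y]
  have "inv (a j [^] (k + l)) \<otimes> (x \<otimes> y) \<in> C j"
    using c by (simp add: int_pow_mult[OF a_carrier] group_simps)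
  moreover have "x \<otimes> y \<in> C (Suc j)"
    using assms subgroup.m_closed[OF C_subgroup] by (simp add: exponent_def)
  ultimately show ?thesis by (simp add: exponent_def)
qed

lemma exponent_inv:
  assumes "exponent j x k"
  shows "exponent j (inv x) (- k)"
proof -
  have c: "x \<in> carrier G" by (rule exponent_carrier[OF assms])
  have x: "inv (a j [^] k) \<otimes> x \<in> C j" using assms by (simp add: exponent_def)
  have "a j [^] k \<otimes> inv (inv (a j [^] k) \<otimes> x) \<otimes> inv (a j [^] k) \<in> C j"
    by (rule C_conj[OF _ subgroup.m_inv_closed[OF C_subgroup x]]) simp
  then have "inv (a j [^] (- k)) \<otimes> inv x \<in> C j"
    using c by (simp add: int_pow_neg[OF a_carrier] group_simps)
  moreover have "inv x \<in> C (Suc j)"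
    using assms subgroup.m_inv_closed[OF C_subgroup] by (simp add: exponent_def)
  ultimately show ?thesis by (simp add: exponent_def)
qed

lemma exponent_pow:
  assumes "exponent j x k"
  shows "exponent j (x [^] (n::nat)) (int n * k)"
proof (induction n)
  case 0
  then show ?case using subgroup.one_closed[OF C_subgroup] by (simp add: exponent_0)
next
  case (Suc n)
  from exponent_mult[OF this assms] show ?case by (simp add: algebra_simps)
qed

lemma exponent_int_pow:
  assumes "exponent j x k"
  shows "exponent j (x [^] (n::int)) (n * k)"
proof (cases n)
  case (nonneg m)
  then show ?thesis using exponent_pow[OF assms, of m] by (simp add: int_pow_int)
next
  case (neg m)
  have "x [^] n = inv (x [^] Suc m)"
    using exponent_carrier[OF assms] neg by (simp add: int_pow_neg int_pow_int del: of_nat_Suc)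
  then show ?thesis
    using exponent_inv[OF exponent_pow[OF assms, of "Suc m"]] neg by (simp del: of_nat_Suc)
qed

lemma exponent_conj:
  assumes "exponent j x k" and g: "g \<in> carrier G"
  shows "exponent j (g \<otimes> x \<otimes> inv g) k"
proof -
  have x: "x \<in> C (Suc j)" using assms by (simp add: exponent_def)
  have "exponent j (commutator g x) 0" unfolding exponent_0 by (rule C_central[OF g x])
  from exponent_mult[OF this assms(1)] show ?thesis
    by (simp add: conj_eq_commutator[OF g C_carrier[OF x]])
qed

section \<open>Homomorphisms to the integers\<close>

text \<open>
  If \<open>N\<close> has no nonzero homomorphism to the integers, then \<open>N \<inter> C j\<close> has finite index in \<open>N\<close> for
  every \<open>j\<close>, down to \<open>C 0\<close>, and \<open>N\<close> is finite.  In the step from \<open>Suc j\<close> to \<open>j\<close> the claim is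
  clear when \<open>C (Suc j)\<close> modulo \<open>C j\<close> is finite.  When it is infinite cyclic, the exponent is a
  homomorphism that is invariant under conjugation.  Its transfer to \<open>N\<close> vanishes, and therefore the
  exponent vanishes on \<open>N \<inter> C (Suc j)\<close>, which is thus equal to \<open>N \<inter> C j\<close>.
\<close>

lemma infinite_has_homomorphism:
  assumes N: "subgroup N G" and inf: "infinite N"
  shows "\<exists>e. additive N e \<and> (\<exists>x\<in>N. e x \<noteq> 0)"
proof (rule ccontr)
  assume no: "\<nexists>e. additive N e \<and> (\<exists>x\<in>N. e x \<noteq> 0)"
  let ?K = "\<lambda>j. N \<inter> C j"
  have K: "subgroup (?K j) G" for j by (rule subgroups_Inter_pair[OF N C_subgroup])
  have Nc: "x \<in> N \<Longrightarrow> x \<in> carrier G" for x by (rule subgroup.mem_carrier[OF N])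
  have "finite_index N (?K (s - i))" if "i \<le> s" for i
    using that
  proof (induction i)
    case 0
    have "finite_index N (?K s)" unfolding finite_index_def
      by (rule exI[of _ "{\<one>}"]) (use subgroup.one_closed[OF N] Nc C_s in auto)
    then show ?case by simp
  next
    case (Suc i)
    define j where "j = s - Suc i"
    have j: "s - i = Suc j" using Suc.prems by (simp add: j_def)
    have fin: "finite_index N (?K (Suc j))" using Suc j by simp
    have step: "finite_index (?K (Suc j)) (?K j)"
    proof (cases "\<exists>m::nat. 0 < m \<and> exponent j \<one> (int m)")
      case True
      then obtain m where m: "0 < m" "exponent j \<one> (int m)" by blast
      define \<kappa> where "\<kappa> x = (SOME k. exponent j x k) mod int m" for x
      have some: "exponent j x (SOME k. exponent j x k)" if "x \<in> C (Suc j)" for x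
        using exponent_exists[OF that] someI[of "exponent j x"] by blast
      show ?thesis
      proof (rule finite_indexI)
        have "\<kappa> ` ?K (Suc j) \<subseteq> {0..<int m}" using m(1) by (auto simp: \<kappa>_def)
        then show "finite (\<kappa> ` ?K (Suc j))" by (rule finite_subset) simp
        fix x y assume x: "x \<in> ?K (Suc j)" and y: "y \<in> ?K (Suc j)" and eq: "\<kappa> x = \<kappa> y"
        define k where "k = (SOME k. exponent j x k)"
        define l where "l = (SOME k. exponent j y k)"
        have kl: "exponent j x k" "exponent j y l" using some x y by (auto simp: k_def l_def)
        have "k mod int m = l mod int m" using eq by (simp add: \<kappa>_def k_def l_def)
        then obtain q where q: "k - l = int m * q" by (meson mod_eq_dvd_iff dvd_def)
        have "exponent j (\<one> [^] q \<otimes> (inv x \<otimes> y)) (q * int m + (- k + l))"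
          by (intro exponent_mult exponent_int_pow exponent_inv m(2) kl)
        moreover have "q * int m + (- k + l) = 0" using q by (simp add: algebra_simps)
        moreover have "\<one> [^] q \<otimes> (inv x \<otimes> y) = inv x \<otimes> y" using x y Nc by simp
        ultimately have "inv x \<otimes> y \<in> C j" using exponent_0 by simp
        then show "inv x \<otimes> y \<in> ?K j"
          using x y subgroup.m_closed[OF N] subgroup.m_inv_closed[OF N] by simp
      qed
    next
      case False
      have one: "k = 0" if "exponent j \<one> k" for k
      proof (rule ccontr)
        assume "k \<noteq> 0"
        moreover have "exponent j \<one> (- k)" using exponent_inv[OF that] by simp
        ultimately have "exponent j \<one> (int (nat \<bar>k\<bar>))" using that by (cases "0 \<le> k") auto
        then show False using False \<open>k \<noteq> 0\<close> by (metis nat_0_iff neq0_conv not_le zero_less_abs_iff)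
      qed
      have unique: "k = l" if "exponent j x k" "exponent j x l" for x k l
      proof -
        have "exponent j (inv x \<otimes> x) (- l + k)"
          by (rule exponent_mult[OF exponent_inv[OF that(2)] that(1)])
        then have "exponent j \<one> (- l + k)" unfolding l_inv[OF exponent_carrier[OF that(1)]] .
        from one[OF this] show ?thesis by simp
      qed
      define \<epsilon> where "\<epsilon> x = (THE k. exponent j x k)" for x
      have \<epsilon>: "\<epsilon> x = k" if "exponent j x k" for x k
        unfolding \<epsilon>_def using that unique by blast
      have ex: "exponent j x (\<epsilon> x)" if x: "x \<in> C (Suc j)" for x
      proof -
        obtain k where "exponent j x k" by (rule exponent_exists[OF x])
        then show ?thesis using \<epsilon> by simp
      qed
      have "\<exists>e m. 0 < m \<and> (\<forall>x\<in>N. \<forall>y\<in>N. e (x \<otimes> y) = e x + e y) \<and> (\<forall>x\<in>?K (Suc j). e x = m * \<epsilon> x)"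
      proof (rule transfer_homomorphism[OF N K _ fin])
        show "\<epsilon> (x \<otimes> y) = \<epsilon> x + \<epsilon> y" if "x \<in> ?K (Suc j)" "y \<in> ?K (Suc j)" for x y
          using that by (intro \<epsilon> exponent_mult ex) auto
        show "g \<otimes> x \<otimes> inv g \<in> ?K (Suc j) \<and> \<epsilon> (g \<otimes> x \<otimes> inv g) = \<epsilon> x"
          if g: "g \<in> N" and x: "x \<in> ?K (Suc j)" for g x
        proof -
          have "\<epsilon> (g \<otimes> x \<otimes> inv g) = \<epsilon> x"
            using x by (intro \<epsilon> exponent_conj ex Nc[OF g]) auto
          moreover have "g \<otimes> x \<otimes> inv g \<in> N"
            using g x subgroup.m_closed[OF N] subgroup.m_inv_closed[OF N] by simp
          ultimately show ?thesis using C_conj[OF Nc[OF g], of x] x by simp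
        qed
      qed simp
      then obtain e m where e: "0 < m" "\<And>x y. x \<in> N \<Longrightarrow> y \<in> N \<Longrightarrow> e (x \<otimes> y) = e x + e y"
        "\<And>x. x \<in> ?K (Suc j) \<Longrightarrow> e x = m * \<epsilon> x" by blast
      have "additive N e" using e(2) by (simp add: additive_def)
      then have zero: "e x = 0" if "x \<in> N" for x using no that by blast
      have "x \<in> C j" if x: "x \<in> ?K (Suc j)" for x
      proof -
        have "m * \<epsilon> x = 0" using zero[of x] e(3)[OF x] x by simp
        then have "\<epsilon> x = 0" using e(1) by simp
        then show ?thesis using ex[of x] x exponent_0 by simp
      qed
      then have "?K (Suc j) = ?K j" using C_mono[of j] by blast
      then show ?thesis unfolding finite_index_def
        using subgroup.one_closed[OF K[of "Suc j"]] Nc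
        by (intro exI[of _ "{\<one>}"]) auto
    qed
    have "?K (Suc j) \<subseteq> N" by blast
    from finite_index_trans[OF N this fin step] show ?case by (simp add: j_def)
  qed
  from this[of s] have "finite_index N (?K 0)" by simp
  then obtain R where R: "finite R" "R \<subseteq> N" "\<And>x. x \<in> N \<Longrightarrow> \<exists>r\<in>R. inv r \<otimes> x \<in> N \<inter> C 0"
    unfolding finite_index_def by blast
  have "N \<subseteq> R"
  proof
    fix x assume x: "x \<in> N"
    obtain r where r: "r \<in> R" "inv r \<otimes> x = \<one>" using R(3)[OF x] C_0 by auto
    have rc: "r \<in> carrier G" using r(1) R(2) Nc by blast
    then have "x = r" using inv_cancel(2)[OF rc Nc[OF x]] r(2) by simp
    then show "x \<in> R" using r by simp
  qed
  then show False using inf R(1) finite_subset by blast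
qed

lemma infinite_has_surjection:
  assumes N: "subgroup N G" and inf: "infinite N"
  shows "\<exists>e t. additive N e \<and> t \<in> N \<and> e t = 1"
proof -
  obtain e x where e: "additive N e" and x: "x \<in> N" "e x \<noteq> 0"
    using infinite_has_homomorphism[OF assms] by blast
  have "\<exists>d\<in>e ` N. \<forall>x\<in>e ` N. d dvd x"
  proof (rule subgroup_int_generator)
    show "0 \<in> e ` N" using additive_one[OF N e] subgroup.one_closed[OF N] by force
    fix m n assume "m \<in> e ` N" "n \<in> e ` N"
    then obtain y z where y: "y \<in> N" "m = e y" and z: "z \<in> N" "n = e z" by blast
    have "e (y \<otimes> inv z) = m - n"
      using additiveD[OF e y(1) subgroup.m_inv_closed[OF N z(1)]] additive_inv[OF N e z(1)] y z by simp
    moreover have "y \<otimes> inv z \<in> N"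
      using subgroup.m_closed[OF N y(1) subgroup.m_inv_closed[OF N z(1)]] .
    ultimately show "m - n \<in> e ` N" by (metis image_eqI)
  qed
  then obtain t where t: "t \<in> N" "\<And>y. y \<in> N \<Longrightarrow> e t dvd e y" by blast
  have nz: "e t \<noteq> 0" using t(2)[OF x(1)] x(2) by auto
  define e' where "e' y = e y div e t" for y
  have "additive N e'"
    unfolding additive_def e'_def using additiveD[OF e] t(2) by (simp add: div_plus_div_distrib_dvd_left)
  moreover have "e' t = 1" using nz by (simp add: e'_def)
  ultimately show ?thesis using t(1) by blast
qed

section \<open>The Hirsch length\<close>

text \<open>
  The factors of the induced series of \<open>N\<close> that are infinite.  Their number is the Hirsch length.
\<close>

definition infinite_factors :: "'a set \<Rightarrow> nat set" where
  "infinite_factors N = {j. j < s \<and> (\<exists>x\<in>N \<inter> C (Suc j). \<forall>k>0. x [^] (k::nat) \<notin> C j)}"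

text \<open>
  Let \<open>C (Suc j)\<close> be the first term of the series on which \<open>e\<close> does not vanish.  There \<open>e\<close> factors
  through an infinite cyclic group and is injective on it, so that the kernel has lost this factor.
\<close>

lemma infinite_factors_kernel:
  assumes N: "subgroup N G" and e: "additive N e" and x: "x \<in> N" "e x \<noteq> 0"
  shows "infinite_factors (kernel_of N e) \<subset> infinite_factors N"
proof -
  have "x \<in> C s" using x(1) C_s subgroup.mem_carrier[OF N] by simp
  then have "\<exists>i. \<exists>x\<in>N \<inter> C i. e x \<noteq> 0" using x by blast
  then obtain i where i: "\<exists>x\<in>N \<inter> C i. e x \<noteq> 0" and min: "\<And>j. j < i \<Longrightarrow> \<forall>x\<in>N \<inter> C j. e x = 0"
    using exists_least_iff[of "\<lambda>i. \<exists>x\<in>N \<inter> C i. e x \<noteq> 0"] by blast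
  have "i \<noteq> 0"
  proof
    assume "i = 0"
    then show False using i additive_one[OF N e] by (simp add: C_0)
  qed
  then obtain j where j: "i = Suc j" by (cases i) auto
  obtain z where z: "z \<in> N" "z \<in> C (Suc j)" "e z \<noteq> 0" using i unfolding j by blast
  have "\<forall>x\<in>N \<inter> C j. e x = 0" by (rule min) (simp add: j)
  then have zero: "e y = 0" if "y \<in> N" "y \<in> C j" for y using that by blast
  have "j < s"
  proof (rule ccontr)
    assume "\<not> j < s"
    then have "C s \<subseteq> C j" by (intro lift_Suc_mono_le[of C, OF C_mono]) simp
    then have "z \<in> C j" using C_s C_carrier[OF z(2)] by blast
    then show False using zero[OF z(1)] z(3) by simp
  qed
  have "z [^] k \<notin> C j" if k: "0 < k" for k :: nat
  proof
    assume "z [^] k \<in> C j"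
    then have "int k * e z = 0" using zero[of "z [^] k"] additive_nat_pow[OF N e z(1), of k] by simp
    then show False using k z(3) by simp
  qed
  then have "j \<in> infinite_factors N" using \<open>j < s\<close> z by (auto simp: infinite_factors_def)
  moreover have "j \<notin> infinite_factors (kernel_of N e)"
  proof
    assume "j \<in> infinite_factors (kernel_of N e)"
    then obtain y where y: "y \<in> N" "e y = 0" "y \<in> C (Suc j)" and inf: "\<And>k::nat. 0 < k \<Longrightarrow> y [^] k \<notin> C j"
      by (auto simp: infinite_factors_def kernel_of_def)
    obtain p where p: "exponent j z p" by (rule exponent_exists[OF z(2)])
    obtain q where q: "exponent j y q" by (rule exponent_exists[OF y(3)])
    have "exponent j (z [^] q \<otimes> inv (y [^] p)) (q * p + - (p * q))"
      by (intro exponent_mult exponent_inv exponent_int_pow p q)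
    then have in_C: "z [^] q \<otimes> inv (y [^] p) \<in> C j" by (simp add: exponent_0 mult.commute)
    have yp: "y [^] p \<in> N" "e (y [^] p) = 0" using additive_pow[OF N e y(1), of p] y(2) by auto
    have zq: "z [^] q \<in> N" "e (z [^] q) = q * e z" using additive_pow[OF N e z(1), of q] by auto
    have "e (z [^] q \<otimes> inv (y [^] p)) = q * e z"
      using additiveD[OF e zq(1) subgroup.m_inv_closed[OF N yp(1)]] additive_inv[OF N e yp(1)] yp(2) zq(2)
      by simp
    moreover have "z [^] q \<otimes> inv (y [^] p) \<in> N"
      using subgroup.m_closed[OF N zq(1) subgroup.m_inv_closed[OF N yp(1)]] .
    ultimately have "q * e z = 0" using zero in_C by simp
    then have "y \<in> C j" using q z(3) by (simp add: exponent_0)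
    then show False using inf[of 1] C_carrier[OF y(3)] by simp
  qed
  moreover have "infinite_factors (kernel_of N e) \<subseteq> infinite_factors N"
    by (auto simp: infinite_factors_def kernel_of_def)
  ultimately show ?thesis by blast
qed

lemma finite_infinite_factors: "finite (infinite_factors N)"
  by (rule finite_subset[of _ "{..<s}"]) (auto simp: infinite_factors_def)

section \<open>Subgroups are finitely generated\<close>

text \<open>
  The exponents modulo \<open>C j\<close> of the elements of \<open>N \<inter> C (Suc j)\<close> form a subgroup of the integers, and
  an element whose exponent generates it is the only new generator required.
\<close>

lemma subgroup_finitely_generated:
  assumes N: "subgroup N G"
  shows "\<exists>S. finite S \<and> S \<subseteq> N \<and> generate G S = N"
proof -
  have K: "subgroup (N \<inter> C j) G" for j by (rule subgroups_Inter_pair[OF N C_subgroup])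
  have "\<exists>S. finite S \<and> S \<subseteq> N \<inter> C j \<and> N \<inter> C j \<subseteq> generate G S" for j
  proof (induction j)
    case 0
    show ?case using C_0 by (intro exI[of _ "{}"]) (auto intro: generate.one)
  next
    case (Suc j)
    then obtain S where S: "finite S" "S \<subseteq> N \<inter> C j" "N \<inter> C j \<subseteq> generate G S" by blast
    define D where "D = {k. \<exists>x\<in>N. exponent j x k}"
    have "\<exists>d\<in>D. \<forall>k\<in>D. d dvd k"
    proof (rule subgroup_int_generator)
      have "exponent j \<one> 0" using subgroup.one_closed[OF C_subgroup] by (simp add: exponent_0)
      then show "0 \<in> D" using subgroup.one_closed[OF N] by (auto simp: D_def)
      fix k l assume "k \<in> D" "l \<in> D"
      then obtain x y where x: "x \<in> N" "exponent j x k" and y: "y \<in> N" "exponent j y l"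
        by (auto simp: D_def)
      have "x \<otimes> inv y \<in> N"
        by (rule subgroup.m_closed[OF N x(1) subgroup.m_inv_closed[OF N y(1)]])
      moreover have "exponent j (x \<otimes> inv y) (k + - l)"
        by (rule exponent_mult[OF x(2) exponent_inv[OF y(2)]])
      ultimately show "k - l \<in> D" by (auto simp: D_def)
    qed
    then obtain d b where b: "b \<in> N" "exponent j b d" and d: "\<And>k. k \<in> D \<Longrightarrow> d dvd k"
      by (auto simp: D_def)
    have bC: "b \<in> C (Suc j)" using b by (simp add: exponent_def)
    have sub: "insert b S \<subseteq> N \<inter> C (Suc j)" using S b bC C_mono[of j] by blast
    have g: "subgroup (generate G (insert b S)) G"
      using sub subgroup.subset[OF N] by (intro generate_is_subgroup) blast
    have "x \<in> generate G (insert b S)" if x: "x \<in> N" "x \<in> C (Suc j)" for x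
    proof -
      obtain k where k: "exponent j x k" by (rule exponent_exists[OF x(2)])
      then have "d dvd k" using d x(1) by (auto simp: D_def)
      then obtain m where m: "k = d * m" by (rule dvdE)
      have bm: "b [^] m \<in> generate G (insert b S)"
        by (rule subgroup_int_pow_closed[OF g]) (simp add: generate.incl)
      have "exponent j (inv (b [^] m) \<otimes> x) (- (m * d) + k)"
        by (intro exponent_mult exponent_inv exponent_int_pow b k)
      then have "inv (b [^] m) \<otimes> x \<in> C j" by (simp add: exponent_0 m mult.commute)
      moreover have "inv (b [^] m) \<otimes> x \<in> N"
        by (intro subgroup.m_closed[OF N] subgroup.m_inv_closed[OF N] subgroup_int_pow_closed[OF N] b x)
      ultimately have "inv (b [^] m) \<otimes> x \<in> generate G (insert b S)"
        using S(3) mono_generate[of S "insert b S"] by blast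
      from subgroup.m_closed[OF g bm this] show ?thesis
        using C_carrier[OF x(2)] C_carrier[OF bC] by (simp add: group_simps)
    qed
    then show ?case using sub S(1) by (intro exI[of _ "insert b S"]) auto
  qed
  from this[of s] obtain S where S: "finite S" "S \<subseteq> N \<inter> C s" "N \<inter> C s \<subseteq> generate G S" by blast
  have "N \<inter> C s = N" using C_s subgroup.subset[OF N] by blast
  then have "generate G S = N" "S \<subseteq> N"
    using S generate_subgroup_incl[OF _ N, of S] by auto
  then show ?thesis using S(1) by blast
qed

section \<open>Towers\<close>

text \<open>
  The descending chain of subgroups is left implicit in the functions \<open>e\<close>, each of which is
  additive on the common kernel of its predecessors.  As they are defined on the whole type, they can
  serve as coordinates on all of \<open>N\<close>.
\<close>

fun tower :: "'a set \<Rightarrow> ('a \<times> ('a \<Rightarrow> int)) list \<Rightarrow> 'a set \<Rightarrow> bool" where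
  "tower N [] T \<longleftrightarrow> N = T"
| "tower N ((t, e) # L) T \<longleftrightarrow> t \<in> N \<and> e t = 1 \<and> additive N e \<and> tower (kernel_of N e) L T"

lemma tower_cong:
  "tower N L T \<Longrightarrow> (\<And>f x. f \<in> snd ` set L \<Longrightarrow> x \<in> N \<Longrightarrow> h f x = f x) \<Longrightarrow> subgroup N G \<Longrightarrow>
    tower N (map (\<lambda>(t, f). (t, h f)) L) T"
proof (induction L arbitrary: N)
  case (Cons p L)
  obtain t e where p: "p = (t, e)" by (cases p)
  have e: "h e x = e x" if "x \<in> N" for x using Cons.prems(2)[of e x] that by (simp add: p)
  have k: "kernel_of N (h e) = kernel_of N e" using e by (auto simp: kernel_of_def)
  have add: "additive N e" and t: "t \<in> N" "e t = 1" using Cons.prems(1) by (simp_all add: p)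
  have "additive N (h e)"
    using add e subgroup.m_closed[OF Cons.prems(3)] by (simp add: additive_def)
  moreover have "tower (kernel_of N e) (map (\<lambda>(t, f). (t, h f)) L) T"
  proof (rule Cons.IH)
    show "tower (kernel_of N e) L T" using Cons.prems(1) by (simp add: p)
    show "h f x = f x" if "f \<in> snd ` set L" "x \<in> kernel_of N e" for f x
      using Cons.prems(2)[of f x] that by (auto simp: kernel_of_def)
    show "subgroup (kernel_of N e) G" by (rule subgroup_kernel[OF Cons.prems(3) add])
  qed
  ultimately show ?case using t e by (simp add: p k)
qed simp

lemma tower_subset: "tower N L T \<Longrightarrow> T \<subseteq> N"
proof (induction L arbitrary: N)
  case (Cons p L)
  then show ?case by (cases p) (force simp: kernel_of_def)
qed simp

lemma tower_subgroup: "subgroup N G \<Longrightarrow> tower N L T \<Longrightarrow> subgroup T G"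
proof (induction L arbitrary: N)
  case (Cons p L)
  obtain t e where p: "p = (t, e)" by (cases p)
  show ?case
    using Cons.prems(2) by (intro Cons.IH[of "kernel_of N e"] subgroup_kernel[OF Cons.prems(1)]) (simp_all add: p)
qed simp

lemma tower_letters: "tower N L T \<Longrightarrow> fst ` set L \<subseteq> N"
proof (induction L arbitrary: N)
  case (Cons p L)
  obtain t e where p: "p = (t, e)" by (cases p)
  have "fst ` set L \<subseteq> kernel_of N e" using Cons.prems by (intro Cons.IH) (simp add: p)
  then show ?case using Cons.prems by (auto simp: p kernel_of_def)
qed simp

text \<open>
  By induction on the Hirsch length.  Suppose that the kernel \<open>M\<close> of \<open>e\<close> has a tower and a subgroup
  \<open>K\<close>, and that \<open>e t = 1\<close>.  The functions of the tower are extended from \<open>M\<close> to \<open>N\<close>.  After \<open>K\<close> has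
  been shrunk to a subgroup \<open>K'\<close> that is normalized by \<open>t\<close>, the subgroup \<open>K'\<langle>t\<rangle>\<close> has finite index
  in \<open>N\<close> and meets \<open>M\<close> in \<open>K'\<close> only.
\<close>

theorem tower_exists:
  assumes "subgroup N G"
  shows "\<exists>L T K. tower N L T \<and> finite T \<and> (\<forall>e\<in>snd ` set L. \<exists>d. poly N d e) \<and>
    subgroup K G \<and> K \<subseteq> N \<and> finite_index N K \<and> K \<inter> T = {\<one>}"
  using assms
proof (induction "card (infinite_factors N)" arbitrary: N rule: less_induct)
  case less
  note N = less.prems
  have Nc: "x \<in> N \<Longrightarrow> x \<in> carrier G" for x by (rule subgroup.mem_carrier[OF N])
  show ?case
  proof (cases "finite N")
    case True
    have "finite_index N {\<one>}"
      unfolding finite_index_def using True Nc by (intro exI[of _ N]) (auto intro: l_inv)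
    then have "tower N [] N \<and> finite N \<and> (\<forall>e\<in>snd ` set []. \<exists>d. poly N d e) \<and>
        subgroup {\<one>} G \<and> {\<one>} \<subseteq> N \<and> finite_index N {\<one>} \<and> {\<one>} \<inter> N = {\<one>}"
      using True subgroup.one_closed[OF N] triv_subgroup by simp
    then show ?thesis by blast
  next
    case False
    then obtain e t where e: "additive N e" and t: "t \<in> N" "e t = 1"
      using infinite_has_surjection[OF N] by blast
    let ?M = "kernel_of N e"
    have M: "subgroup ?M G" by (rule subgroup_kernel[OF N e])
    have MN: "?M \<subseteq> N" by (auto simp: kernel_of_def)
    have "card (infinite_factors ?M) < card (infinite_factors N)"
      using infinite_factors_kernel[OF N e t(1)] t(2) by (intro psubset_card_mono finite_infinite_factors) simp
    from less.hyps[OF this M] obtain L T K where IH: "tower ?M L T" "finite T"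
      "\<forall>f\<in>snd ` set L. \<exists>d. poly ?M d f" "subgroup K G" "K \<subseteq> ?M" "finite_index ?M K" "K \<inter> T = {\<one>}"
      by blast
    define L' where "L' = (t, e) # map (\<lambda>(u, f). (u, extend e t f)) L"
    have tower: "tower N L' T"
      using tower_cong[OF IH(1) _ M, of "extend e t"] extend_kernel[OF N e t] e t
      by (simp add: L'_def)
    have poly: "\<exists>d. poly N d f" if f: "f \<in> snd ` set L'" for f
    proof (cases "f = e")
      case True
      then show ?thesis using poly_hom[OF N, of e] additiveD[OF e] by blast
    next
      case False
      then obtain f' where f': "f' \<in> snd ` set L" "f = extend e t f'"
        using f by (auto simp: L'_def split: prod.splits) (metis image_eqI snd_conv)
      then obtain d where "poly ?M d f'" using IH(3) by blast
      then show ?thesis using poly_extend[OF N e t poly_imp_wpoly[OF M]] f'(2) by blast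
    qed
    obtain S where S: "finite S" "S \<subseteq> ?M" "generate G S = ?M"
      using subgroup_finitely_generated[OF M] by blast
    have Sc: "S \<subseteq> carrier G" using S(2) subgroup.subset[OF M] by blast
    obtain K' where K': "subgroup K' G" "K' \<subseteq> K" "finite_index ?M K'"
      "\<And>g. g \<in> carrier G \<Longrightarrow> \<forall>x\<in>?M. g \<otimes> x \<otimes> inv g \<in> ?M \<Longrightarrow> \<forall>x\<in>K'. g \<otimes> x \<otimes> inv g \<in> K'"
      using invariant_finite_index[OF M S(1) Sc S(3) IH(4,5,6)] by blast
    have K'conj: "g \<otimes> x \<otimes> inv g \<in> K'" if "g \<in> N" "x \<in> K'" for g x
      using K'(4)[OF Nc[OF that(1)]] kernel_normalized[OF N e t that(1)] that(2)
      by (simp add: normalizes_def)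
    \<comment> \<open>This is \<open>K'\<langle>t\<rangle>\<close>: the elements whose part in the kernel lies in \<open>K'\<close>.\<close>
    define H where "H = {x \<in> N. x \<otimes> t [^] (- e x) \<in> K'}"
    have tp: "t [^] (k::int) \<in> N" for k by (rule additive_pow(2)[OF N e t(1)])
    have Hm: "x \<otimes> y \<in> H" if x: "x \<in> H" and y: "y \<in> H" for x y
    proof -
      have xy: "x \<in> N" "y \<in> N" "x \<otimes> t [^] (- e x) \<in> K'" "y \<otimes> t [^] (- e y) \<in> K'"
        using x y by (simp_all add: H_def)
      from subgroup.m_closed[OF K'(1) xy(3) K'conj[OF tp xy(4)], of "e x"]
      have "(x \<otimes> y) \<otimes> t [^] (- e (x \<otimes> y)) \<in> K'"
        unfolding kernel_part_mult[OF N e t xy(1,2)] .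
      then show ?thesis using subgroup.m_closed[OF N xy(1,2)] by (simp add: H_def)
    qed
    have Hi: "inv x \<in> H" if x: "x \<in> H" for x
    proof -
      have x': "x \<in> N" "x \<otimes> t [^] (- e x) \<in> K'" using x by (simp_all add: H_def)
      have c: "x \<in> carrier G" "t [^] e x \<in> carrier G" using x' Nc tp by auto
      have "inv (t [^] e x) \<otimes> inv (x \<otimes> t [^] (- e x)) \<otimes> inv (inv (t [^] e x)) \<in> K'"
        using K'conj[OF subgroup.m_inv_closed[OF N tp] subgroup.m_inv_closed[OF K'(1) x'(2)]] .
      then have "inv x \<otimes> t [^] (- e (inv x)) \<in> K'"
        using c Nc[OF t(1)] additive_inv[OF N e x'(1)] by (simp add: int_pow_neg group_simps)
      then show ?thesis using subgroup.m_inv_closed[OF N x'(1)] by (simp add: H_def)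
    qed
    have H1: "\<one> \<in> H"
      using subgroup.one_closed[OF N] subgroup.one_closed[OF K'(1)] additive_one[OF N e]
      by (simp add: H_def)
    have H: "subgroup H G"
      by (rule subgroupI) (use Nc Hm Hi H1 in \<open>auto simp: H_def\<close>)
    obtain R where R: "finite R" "R \<subseteq> ?M" "\<And>x. x \<in> ?M \<Longrightarrow> \<exists>r\<in>R. inv r \<otimes> x \<in> K'"
      using K'(3) unfolding finite_index_def by blast
    have "\<exists>r\<in>R. inv r \<otimes> x \<in> H" if x: "x \<in> N" for x
    proof -
      obtain r where r: "r \<in> R" "inv r \<otimes> (x \<otimes> t [^] (- e x)) \<in> K'"
        using R(3)[OF kernel_part[OF N e t x]] by blast
      have rN: "r \<in> N" "e r = 0" using r(1) R(2) by (auto simp: kernel_of_def)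
      have rx: "inv r \<otimes> x \<in> N" using subgroup.m_closed[OF N subgroup.m_inv_closed[OF N rN(1)] x] .
      have "e (inv r \<otimes> x) = e x"
        using additiveD[OF e subgroup.m_inv_closed[OF N rN(1)] x] additive_inv[OF N e rN(1)] rN(2) by simp
      then have "inv r \<otimes> x \<otimes> t [^] (- e (inv r \<otimes> x)) \<in> K'"
        using r(2) Nc rN(1) x tp by (simp add: m_assoc)
      then show ?thesis using r(1) rx by (auto simp: H_def)
    qed
    then have "finite_index N H"
      unfolding finite_index_def using R(1,2) MN by (intro exI[of _ R]) blast
    moreover have "H \<inter> T = {\<one>}"
    proof
      show "H \<inter> T \<subseteq> {\<one>}"
      proof
        fix x assume x: "x \<in> H \<inter> T"
        then have "x \<in> ?M" using tower_subset[OF IH(1)] by blast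
        then have "e x = 0" "x \<in> carrier G" using Nc by (auto simp: kernel_of_def)
        then have "x \<in> K'" using x by (simp add: H_def)
        then show "x \<in> {\<one>}" using K'(2) IH(7) x by blast
      qed
      have "\<one> \<in> T" using IH(7) by blast
      then show "{\<one>} \<subseteq> H \<inter> T" using H1 by blast
    qed
    ultimately show ?thesis using tower poly IH(2) H
      by (intro exI[of _ L'] exI[of _ T] exI[of _ H]) (auto simp: H_def)
  qed
qed

end

section \<open>Words\<close>

context group
begin

lemma word_value_Nil [simp]: "word_value G [] = \<one>"
  and word_value_Cons [simp]: "word_value G (x # w) = x \<otimes> word_value G w"
  by (simp_all add: word_value_def)

lemma word_value_closed [simp]: "w \<in> lists X \<Longrightarrow> X \<subseteq> carrier G \<Longrightarrow> word_value G w \<in> carrier G"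
  by (induction w) auto

lemma word_value_append:
  assumes X: "X \<subseteq> carrier G" and v: "v \<in> lists X"
  shows "u \<in> lists X \<Longrightarrow> word_value G (u @ v) = word_value G u \<otimes> word_value G v"
proof (induction u)
  case Nil
  then show ?case using word_value_closed[OF v X] by simp
next
  case (Cons x u)
  then have "x \<in> carrier G" "u \<in> lists X" using X by auto
  then show ?case
    using Cons.IH word_value_closed[OF v X] word_value_closed[OF _ X, of u] by (simp add: m_assoc)
qed

lemma word_value_replicate:
  assumes "x \<in> carrier G"
  shows "word_value G (replicate n x) = x [^] n"
  by (induction n) (use assms nat_pow_Suc2 in auto)

lemma generate_word:
  assumes X: "X \<subseteq> carrier G" "\<And>x. x \<in> X \<Longrightarrow> inv x \<in> X" and g: "g \<in> generate G X"
  shows "\<exists>w\<in>lists X. word_value G w = g"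
  using g
proof induction
  case one
  then show ?case by (intro bexI[of _ "[]"]) auto
next
  case (incl h)
  then show ?case using X by (intro bexI[of _ "[h]"]) auto
next
  case (inv h)
  then show ?case using X by (intro bexI[of _ "[inv h]"]) auto
next
  case (eng h1 h2)
  then obtain u v where u: "u \<in> lists X" "word_value G u = h1" and v: "v \<in> lists X" "word_value G v = h2"
    by blast
  have "word_value G (u @ v) = h1 \<otimes> h2" by (simp only: word_value_append[OF X(1) v(1) u(1)] u(2) v(2))
  moreover have "u @ v \<in> lists X" using u(1) v(1) by simp
  ultimately show ?case by blast
qed

end

section \<open>Polynomial growth\<close>

lemma poly_growth_step:
  fixes C D m :: nat
  shows "m + C * (m + 1) ^ D \<le> (C + 1) * (m + 1) ^ (D + 1)"
proof -
  have "m * 1 \<le> (m + 1) * (m + 1) ^ D" by (intro mult_mono) simp_all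
  moreover have "C * (m + 1) ^ D \<le> C * ((m + 1) * (m + 1) ^ D)" by simp
  ultimately show ?thesis by (simp add: algebra_simps)
qed

lemma poly_growth_comp:
  fixes C D C' D' m :: nat
  assumes "k \<le> C' * (m + 1) ^ D'"
  shows "C * (k + 1) ^ D \<le> C * (C' + 1) ^ D * (m + 1) ^ (D' * D)"
proof -
  have "1 \<le> (m + 1) ^ D'" by simp
  then have "k + 1 \<le> (C' + 1) * (m + 1) ^ D'"
    using assms unfolding distrib_right mult_1 by linarith
  then have "(k + 1) ^ D \<le> ((C' + 1) * (m + 1) ^ D') ^ D" by (rule power_mono) simp
  then have "(k + 1) ^ D \<le> (C' + 1) ^ D * (m + 1) ^ (D' * D)"
    by (simp only: power_mult_distrib power_mult)
  then show ?thesis by (simp add: mult.assoc)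
qed

text \<open>
  A bound for the word length after \<open>k\<close> syllables have been divided off: if \<open>g\<close> has word length up
  to \<open>m\<close>, then \<open>e g\<close> is bounded by \<open>C * (m + 1) ^ D\<close>, and so is the length of the syllable.
\<close>

fun grow :: "nat \<Rightarrow> nat \<Rightarrow> nat \<Rightarrow> nat \<Rightarrow> nat" where
  "grow C D 0 m = m"
| "grow C D (Suc k) m = grow C D k (m + C * (m + 1) ^ D)"

lemma grow_ge: "m \<le> grow C D k m"
proof (induction k arbitrary: m)
  case (Suc k)
  from Suc[of "m + C * (m + 1) ^ D"] show ?case by simp
qed simp

lemma grow_polynomial: "\<exists>C' D'. \<forall>m. grow C D k m \<le> C' * (m + 1) ^ D'"
proof (induction k)
  case 0
  show ?case by (intro exI[of _ 1]) simp
next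
  case (Suc k)
  then obtain C' D' where IH: "\<And>m. grow C D k m \<le> C' * (m + 1) ^ D'" by blast
  have "grow C D (Suc k) m \<le> C' * (C + 1 + 1) ^ D' * (m + 1) ^ ((D + 1) * D')" for m
  proof -
    have "grow C D (Suc k) m \<le> C' * (m + C * (m + 1) ^ D + 1) ^ D'"
      using IH[of "m + C * (m + 1) ^ D"] by simp
    also have "\<dots> \<le> C' * (C + 1 + 1) ^ D' * (m + 1) ^ ((D + 1) * D')"
      by (rule poly_growth_comp[OF poly_growth_step])
    finally show ?thesis .
  qed
  then show ?case by blast
qed

context central_series
begin

lemma poly_diff:
  assumes N: "subgroup N G" and "poly N d f" "n \<in> N"
  shows "poly N d (diff n f)"
proof (cases d)
  case 0
  then show ?thesis using assms subgroup.m_closed[OF N assms(3)] by (simp add: diff_def)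
next
  case (Suc k)
  then show ?thesis using assms(2,3) poly_Suc[OF N, of k] by (simp del: poly.simps(2)) (simp add: poly.simps(2))
qed

text \<open>
  Read from its end, a word is built up by left multiplications.  Each of them changes \<open>f\<close> by
  a difference, which is bounded by induction on the degree.
\<close>

lemma poly_growth:
  assumes X: "finite X" "X \<subseteq> carrier G"
  shows "poly (carrier G) d f \<Longrightarrow>
    \<exists>B::nat. \<forall>w\<in>lists X. \<bar>f (word_value G w)\<bar> \<le> int (B * (length w + 1) ^ d)"
proof (induction d arbitrary: f)
  case 0
  then show ?case using X by simp
next
  case (Suc d)
  have "\<exists>B::nat. \<forall>w\<in>lists X. \<bar>diff x f (word_value G w)\<bar> \<le> int (B * (length w + 1) ^ d)" if "x \<in> X" for x
    using Suc.prems X(2) that by (intro Suc.IH) auto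
  then obtain c :: "'a \<Rightarrow> nat" where
    c: "\<And>x w. x \<in> X \<Longrightarrow> w \<in> lists X \<Longrightarrow> \<bar>diff x f (word_value G w)\<bar> \<le> int (c x * (length w + 1) ^ d)"
    by metis
  define B where "B = sum c X"
  define b where "b = nat \<bar>f \<one>\<bar>"
  have cB: "c x \<le> B" if "x \<in> X" for x unfolding B_def using X(1) that by (intro member_le_sum) auto
  have main: "\<bar>f (word_value G w)\<bar> \<le> int (b + length w * (B * (length w + 1) ^ d))" if "w \<in> lists X" for w
    using that
  proof (induction w rule: list.induct)
    case Nil
    show ?case by (simp add: b_def)
  next
    case (Cons x w)
    let ?n = "length w"
    have x: "x \<in> X" and w: "w \<in> lists X" using Cons.prems by auto
    have "f (word_value G (x # w)) = diff x f (word_value G w) + f (word_value G w)"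
      by (simp add: diff_def)
    then have "\<bar>f (word_value G (x # w))\<bar> \<le> \<bar>diff x f (word_value G w)\<bar> + \<bar>f (word_value G w)\<bar>"
      by simp
    also have "\<dots> \<le> int (c x * (?n + 1) ^ d) + int (b + ?n * (B * (?n + 1) ^ d))"
      by (rule add_mono[OF c[OF x w] Cons.IH[OF w]])
    also have "\<dots> = int (b + (c x * (?n + 1) ^ d + ?n * (B * (?n + 1) ^ d)))"
      by (simp only: of_nat_add add_ac)
    also have "\<dots> \<le> int (b + Suc ?n * (B * (Suc ?n + 1) ^ d))"
    proof -
      have p: "(?n + 1) ^ d \<le> (Suc ?n + 1) ^ d" by (rule power_mono) simp_all
      have "c x * (?n + 1) ^ d \<le> B * (Suc ?n + 1) ^ d" by (rule mult_mono[OF cB[OF x] p]) simp_all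
      moreover have "?n * (B * (?n + 1) ^ d) \<le> ?n * (B * (Suc ?n + 1) ^ d)"
        by (intro mult_le_mono2 p)
      ultimately have "c x * (?n + 1) ^ d + ?n * (B * (?n + 1) ^ d) \<le> Suc ?n * (B * (Suc ?n + 1) ^ d)"
        by (simp only: mult_Suc)
      then show ?thesis by (simp only: of_nat_le_iff add_le_cancel_left)
    qed
    finally show ?case by simp
  qed
  have "\<bar>f (word_value G w)\<bar> \<le> int ((b + B) * (length w + 1) ^ Suc d)" if "w \<in> lists X" for w
  proof -
    let ?n = "length w"
    have 1: "b * 1 \<le> b * (?n + 1) ^ Suc d"
      by (rule mult_le_mono2[OF one_le_power]) simp
    have 2: "?n * (B * (?n + 1) ^ d) \<le> B * (?n + 1) ^ Suc d" by (simp add: algebra_simps)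
    have "b + ?n * (B * (?n + 1) ^ d) \<le> (b + B) * (?n + 1) ^ Suc d"
      using add_mono[OF 1 2] by (simp only: distrib_right mult_1_right)
    then have "int (b + ?n * (B * (?n + 1) ^ d)) \<le> int ((b + B) * (?n + 1) ^ Suc d)"
      by (simp only: of_nat_le_iff)
    with main[OF that] show ?thesis by linarith
  qed
  then show ?case by blast
qed

end

section \<open>Machines from towers\<close>

text \<open>
  The machine loads the vector of \<open>\<one>\<close>, moves to the right end of the input, and reads it from right
  to left.  In this direction every letter acts by left multiplication, as does the removal of
  the syllables in the phase \<open>Emit\<close>.  The argument is the current coset of \<open>K\<close>.
\<close>

datatype 'a phase = Initial | Seek | Read "'a set" | Emit "'a set" | Halt

datatype 'a operation = Load | Keep | Multiply 'a

lemma find_append_None: "(\<And>x. x \<in> set xs \<Longrightarrow> \<not> P x) \<Longrightarrow> find P (xs @ ys) = find P ys"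
  by (induction xs) auto

lemma sum_selected:
  fixes g :: 'a
  assumes "finite A"
  shows "(\<Sum>\<psi>\<in>A. (if \<psi> = \<chi> then 1 else 0) * \<psi> g) = (if \<chi> \<in> A then \<chi> g else (0::int))"
proof -
  have "(\<Sum>\<psi>\<in>A. (if \<psi> = \<chi> then 1 else 0) * \<psi> g) = (\<Sum>\<psi>\<in>A. if \<psi> = \<chi> then \<chi> g else 0)"
    by (rule sum.cong) simp_all
  then show ?thesis using assms by simp
qed

text \<open>
  The letters of the normal form are taken into \<open>X\<close>: the \<open>t\<close> of the tower and all elements of \<open>T\<close>.
\<close>

locale tower_machine = central_series +
  fixes X :: "'a set" and L :: "('a \<times> ('a \<Rightarrow> int)) list" and T K :: "'a set" and d :: nat
  assumes X: "finite X" "X \<subseteq> carrier G" and X_inv: "\<And>x. x \<in> X \<Longrightarrow> inv x \<in> X"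
    and X_generates: "generate G X = carrier G"
    and T: "finite T" "T \<subseteq> X" and L_X: "fst ` set L \<subseteq> X"
    and tower: "tower (carrier G) L T"
    and poly_L: "\<And>e. e \<in> snd ` set L \<Longrightarrow> poly (carrier G) d e"
    and K: "subgroup K G" "finite_index (carrier G) K" "K \<inter> T = {\<one>}"
begin

abbreviation wv :: "'a list \<Rightarrow> 'a" where "wv \<equiv> word_value G"

lemma wv_closed: "w \<in> lists X \<Longrightarrow> wv w \<in> carrier G"
  using word_value_closed X(2) by blast

lemma X_carrier: "x \<in> X \<Longrightarrow> x \<in> carrier G"
  using X(2) by blast

section \<open>The coordinate functions\<close>

fun differences :: "'a list \<Rightarrow> ('a \<Rightarrow> int) \<Rightarrow> 'a \<Rightarrow> int" where
  "differences [] e = e"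
| "differences (x # u) e = diff x (differences u e)"

definition coordinates :: "('a \<Rightarrow> int) set" where
  "coordinates = (\<lambda>(u, e). differences u e) ` ({u. set u \<subseteq> X \<and> length u \<le> d} \<times> snd ` set L)"

lemma finite_coordinates: "finite coordinates"
  unfolding coordinates_def using X(1) by (intro finite_imageI finite_cartesian_product finite_lists_length_le) auto

lemma exponent_in_coordinates: "e \<in> snd ` set L \<Longrightarrow> e \<in> coordinates"
  unfolding coordinates_def by (rule image_eqI[of _ _ "([], e)"]) auto

lemma poly_differences: "set u \<subseteq> X \<Longrightarrow> poly (carrier G) k e \<Longrightarrow> poly (carrier G) k (differences u e)"
  by (induction u) (auto intro!: poly_diff[OF subgroup_self] X_carrier)

lemma poly_differences_length:
  "set u \<subseteq> X \<Longrightarrow> length u \<le> k \<Longrightarrow> poly (carrier G) k e \<Longrightarrow> poly (carrier G) (k - length u) (differences u e)"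
proof (induction u)
  case (Cons x u)
  then have "poly (carrier G) (Suc (k - length (x # u))) (differences u e)" by (simp add: Suc_diff_Suc)
  then show ?case using Cons.prems(1) X_carrier by simp
qed simp

lemma poly_coordinate: "\<phi> \<in> coordinates \<Longrightarrow> poly (carrier G) d \<phi>"
proof -
  assume "\<phi> \<in> coordinates"
  then obtain u e where "set u \<subseteq> X" "e \<in> snd ` set L" "\<phi> = differences u e"
    unfolding coordinates_def by auto
  then show ?thesis using poly_differences[OF _ poly_L] by simp
qed

text \<open>
  The coordinates are closed under differences, since longer differences than those listed are zero.
  By \<open>\<phi> (x g) = \<phi> g + (diff x \<phi>) g\<close>, left multiplication by \<open>x\<close> is then linear in the coordinates.
\<close>

lemma diff_coordinate:
  assumes "\<phi> \<in> coordinates" "x \<in> X"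
  shows "diff x \<phi> \<in> coordinates \<or> (\<forall>g\<in>carrier G. diff x \<phi> g = 0)"
proof -
  obtain u e where u: "set u \<subseteq> X" "length u \<le> d" "e \<in> snd ` set L" "\<phi> = differences u e"
    using assms(1) unfolding coordinates_def by auto
  show ?thesis
  proof (cases "length u < d")
    case True
    have "diff x \<phi> = (\<lambda>(u, e). differences u e) (x # u, e)" by (simp add: u)
    moreover have "(x # u, e) \<in> {u. set u \<subseteq> X \<and> length u \<le> d} \<times> snd ` set L"
      using u assms(2) True by simp
    ultimately show ?thesis unfolding coordinates_def by (intro disjI1) (rule image_eqI)
  next
    case False
    then have "poly (carrier G) 0 \<phi>"
      using poly_differences_length[OF u(1,2) poly_L[OF u(3)]] u(2,4) by simp
    then show ?thesis using X_carrier[OF assms(2)] by (simp add: diff_def)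
  qed
qed

definition coordinate_vector :: "'a \<Rightarrow> ('a \<Rightarrow> int) \<Rightarrow> int" where
  "coordinate_vector g = (\<lambda>\<phi>. if \<phi> \<in> coordinates then \<phi> g else 0)"

section \<open>The cosets\<close>

definition coset :: "'a \<Rightarrow> 'a set" where
  "coset g = (\<lambda>k. g \<otimes> k) ` K"

definition shift :: "'a \<Rightarrow> 'a set \<Rightarrow> 'a set" where
  "shift x q = (\<lambda>y. x \<otimes> y) ` q"

lemma K_carrier: "k \<in> K \<Longrightarrow> k \<in> carrier G"
  by (rule subgroup.mem_carrier[OF K(1)])

lemma shift_coset:
  assumes "x \<in> carrier G" "g \<in> carrier G"
  shows "shift x (coset g) = coset (x \<otimes> g)"
  unfolding shift_def coset_def image_image using assms by (intro image_cong) (simp_all add: m_assoc K_carrier)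

lemma coset_eqI:
  assumes "x \<in> carrier G" "y \<in> carrier G" "inv x \<otimes> y \<in> K"
  shows "coset y = coset x"
proof -
  have sub: "coset v \<subseteq> coset u" if "u \<in> carrier G" "v \<in> carrier G" "inv u \<otimes> v \<in> K" for u v
  proof
    fix z assume "z \<in> coset v"
    then obtain k where k: "k \<in> K" "z = v \<otimes> k" by (auto simp: coset_def)
    then have "z = u \<otimes> ((inv u \<otimes> v) \<otimes> k)" using that K_carrier[OF k(1)] by (simp add: group_simps)
    then show "z \<in> coset u"
      unfolding coset_def using subgroup.m_closed[OF K(1) that(3) k(1)] by blast
  qed
  have "inv y \<otimes> x = inv (inv x \<otimes> y)" using assms by (simp add: inv_mult_group)
  then have "inv y \<otimes> x \<in> K" using subgroup.m_inv_closed[OF K(1) assms(3)] by simp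
  then show ?thesis using sub assms by blast
qed

lemma coset_eqD:
  assumes "x \<in> carrier G" "y \<in> carrier G" "coset y = coset x"
  shows "inv x \<otimes> y \<in> K"
proof -
  have "y \<in> coset y" unfolding coset_def
    using subgroup.one_closed[OF K(1)] assms(2) by (intro image_eqI[of _ _ \<one>]) simp_all
  then obtain k where "k \<in> K" "y = x \<otimes> k" using assms(3) by (auto simp: coset_def)
  then show ?thesis using assms(1) K_carrier[of k] by (simp add: inv_cancel)
qed

definition cosets :: "'a set set" where
  "cosets = coset ` carrier G"

lemma finite_cosets: "finite cosets"
proof -
  obtain R where R: "finite R" "R \<subseteq> carrier G" "\<And>x. x \<in> carrier G \<Longrightarrow> \<exists>r\<in>R. inv r \<otimes> x \<in> K"
    using K(2) unfolding finite_index_def by blast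
  have "cosets \<subseteq> coset ` R"
  proof
    fix q assume "q \<in> cosets"
    then obtain x where x: "x \<in> carrier G" "q = coset x" by (auto simp: cosets_def)
    obtain r where r: "r \<in> R" "inv r \<otimes> x \<in> K" using R(3)[OF x(1)] by blast
    then have "q = coset r" using coset_eqI[of r x] x R(2) by blast
    then show "q \<in> coset ` R" using r(1) by (rule image_eqI)
  qed
  then show ?thesis by (rule finite_subset) (simp add: R(1))
qed

text \<open>
  Cosets that do not meet \<open>T\<close> give the empty word; at the end of a run the coset does meet \<open>T\<close>.
\<close>

definition torsion_letter :: "'a set \<Rightarrow> 'a list" where
  "torsion_letter q = (if \<exists>h\<in>T. coset h = q then [THE h. h \<in> T \<and> coset h = q] else [])"

lemma coset_inj_torsion: "\<lbrakk>g \<in> T; h \<in> T; coset g = coset h\<rbrakk> \<Longrightarrow> g = h"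
proof -
  assume *: "g \<in> T" "h \<in> T" "coset g = coset h"
  have c: "g \<in> carrier G" "h \<in> carrier G" using * T(2) X_carrier by auto
  have "inv h \<otimes> g \<in> K" by (rule coset_eqD[OF c(2,1) *(3)])
  moreover have "inv h \<otimes> g \<in> T"
  proof -
    have "subgroup T G" by (rule tower_subgroup[OF subgroup_self tower])
    then show ?thesis by (intro subgroup.m_closed subgroup.m_inv_closed *)
  qed
  ultimately have "inv h \<otimes> g = \<one>" using K(3) by blast
  then have "h \<otimes> (inv h \<otimes> g) = h" using c by simp
  then show "g = h" using inv_cancel(2)[OF c(2,1)] by simp
qed

lemma torsion_letter_coset: "g \<in> T \<Longrightarrow> torsion_letter (coset g) = [g]"
proof -
  assume g: "g \<in> T"
  have "(THE h. h \<in> T \<and> coset h = coset g) = g"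
    by (rule the_equality) (use g coset_inj_torsion in simp_all)
  then show ?thesis using g by (auto simp: torsion_letter_def)
qed

lemma torsion_letter_in: "torsion_letter q \<in> lists X \<and> length (torsion_letter q) \<le> 1"
proof (cases "\<exists>h\<in>T. coset h = q")
  case True
  then obtain h where "h \<in> T" "q = coset h" by blast
  then show ?thesis using torsion_letter_coset[of h] T(2) by auto
qed (simp add: torsion_letter_def)

section \<open>The machine\<close>

definition syllable_letter :: "'a \<Rightarrow> int \<Rightarrow> 'a" where
  "syllable_letter t k = (if k > 0 then t else inv t)"

text \<open>
  The rows of \<open>Multiply x\<close> express \<open>\<phi> (x g) = \<phi> g + (diff x \<phi>) g\<close>.  The two summands also give the
  correct matrix if \<open>diff x \<phi> = \<phi>\<close>, or if \<open>diff x \<phi>\<close> is not a coordinate and hence is zero.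
\<close>

fun matrix :: "'a operation \<Rightarrow> ('a \<Rightarrow> int) \<Rightarrow> ('a \<Rightarrow> int) \<Rightarrow> int" where
  "matrix Load \<phi> \<psi> = 0"
| "matrix Keep \<phi> \<psi> = (if \<psi> = \<phi> then 1 else 0)"
| "matrix (Multiply x) \<phi> \<psi> = (if \<psi> = \<phi> then 1 else 0) + (if \<psi> = diff x \<phi> then 1 else 0)"

fun load_vector :: "'a operation \<Rightarrow> ('a \<Rightarrow> int) \<Rightarrow> int" where
  "load_vector Load \<phi> = \<phi> \<one>"
| "load_vector _ \<phi> = 0"

fun transition :: "'a phase \<Rightarrow> 'a input_symbol \<Rightarrow> (('a \<Rightarrow> int) \<Rightarrow> int) \<Rightarrow>
    'a phase \<times> 'a operation \<times> direction \<times> 'a list" where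
  "transition Initial c \<sigma> = (Seek, Load, Move_Right, [])"
| "transition Seek Right_End \<sigma> = (Read (coset \<one>), Keep, Move_Left, [])"
| "transition Seek c \<sigma> = (Seek, Keep, Move_Right, [])"
| "transition (Read q) (Letter x) \<sigma> = (Read (shift x q), Multiply x, Move_Left, [])"
| "transition (Read q) c \<sigma> = (Emit q, Keep, Stay, [])"
| "transition (Emit q) c \<sigma> = (case find (\<lambda>(t, e). \<sigma> e \<noteq> 0) L of
      None \<Rightarrow> (Halt, Keep, Stay, torsion_letter q)
    | Some (t, e) \<Rightarrow> (let y = syllable_letter t (\<sigma> e)
        in (Emit (shift (inv y) q), Multiply (inv y), Stay, [y])))"
| "transition Halt c \<sigma> = (Halt, Keep, Stay, [])"

definition phases :: "'a phase set" where
  "phases = {Initial, Seek, Halt} \<union> Read ` cosets \<union> Emit ` cosets"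

lemma syllable_letter_in: "t \<in> X \<Longrightarrow> syllable_letter t k \<in> X"
  using X_inv by (simp add: syllable_letter_def)

lemma shift_in: "x \<in> X \<Longrightarrow> q \<in> cosets \<Longrightarrow> shift x q \<in> cosets"
  using shift_coset X_carrier by (auto simp: cosets_def)

lemma find_in: "find P L = Some (t, e) \<Longrightarrow> (t, e) \<in> set L \<and> P (t, e)"
  by (auto simp: find_Some_iff)

sublocale machine: linear_machine X X phases Initial "{Halt}" coordinates "{Load, Keep} \<union> Multiply ` X"
  matrix load_vector transition 1
proof
  show "finite phases" using finite_cosets by (simp add: phases_def)
  fix p s \<sigma> p' u dir out
  assume p: "p \<in> phases - {Halt}" and s: "s \<in> tape_alphabet X"
    and tr: "transition p s \<sigma> = (p', u, dir, out)"
  show "p' \<in> phases \<and> u \<in> {Load, Keep} \<union> Multiply ` X \<and> out \<in> lists X \<and> length out \<le> 1"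
  proof (cases p)
    case Initial
    then show ?thesis using tr by (auto simp: phases_def)
  next
    case Seek
    then show ?thesis using tr by (cases s) (auto simp: phases_def cosets_def)
  next
    case (Read q)
    then have q: "q \<in> cosets" using p by (auto simp: phases_def)
    show ?thesis
    proof (cases s)
      case (Letter x)
      then have "x \<in> X" using s by (auto simp: tape_alphabet_def)
      then show ?thesis using tr Read Letter shift_in[OF _ q] by (auto simp: phases_def)
    qed (use tr Read q in \<open>auto simp: phases_def\<close>)
  next
    case (Emit q)
    then have q: "q \<in> cosets" using p by (auto simp: phases_def)
    show ?thesis
    proof (cases "find (\<lambda>(t, e). \<sigma> e \<noteq> 0) L")
      case None
      then show ?thesis using tr Emit torsion_letter_in[of q] by (auto simp: phases_def)
    next
      case (Some te)
      obtain t e where te: "te = (t, e)" by (cases te)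
      define y where "y = syllable_letter t (\<sigma> e)"
      have "t \<in> X" using find_in[of _ t e] Some te L_X by force
      then have y: "y \<in> X" "inv y \<in> X" unfolding y_def using syllable_letter_in X_inv by auto
      have "p' = Emit (shift (inv y) q)" "u = Multiply (inv y)" "out = [y]"
        using tr Emit Some te by (simp_all add: y_def Let_def)
      then show ?thesis using y shift_in[OF y(2) q] by (simp add: phases_def)
    qed
  next
    case Halt
    then show ?thesis using p by simp
  qed
qed (use X(1) finite_coordinates in \<open>auto simp: phases_def\<close>)

lemma update_Load: "machine.update Load v (machine.offset Load) = coordinate_vector \<one>"
  by (rule ext) (simp add: machine.update_def machine.offset_def coordinate_vector_def)

lemma update_Keep:
  "machine.update Keep (coordinate_vector g) (machine.offset Keep) = coordinate_vector g"
  by (rule ext) (simp add: machine.update_def machine.offset_def coordinate_vector_def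
      sum_selected[OF finite_coordinates])

lemma update_Multiply:
  assumes x: "x \<in> X" and g: "g \<in> carrier G"
  shows "machine.update (Multiply x) (coordinate_vector g) (machine.offset (Multiply x)) =
    coordinate_vector (x \<otimes> g)"
proof
  fix \<phi>
  show "machine.update (Multiply x) (coordinate_vector g) (machine.offset (Multiply x)) \<phi> =
    coordinate_vector (x \<otimes> g) \<phi>"
  proof (cases "\<phi> \<in> coordinates")
    case True
    have "machine.update (Multiply x) (coordinate_vector g) (machine.offset (Multiply x)) \<phi> =
        (\<Sum>\<psi>\<in>coordinates. ((if \<psi> = \<phi> then 1 else 0) + (if \<psi> = diff x \<phi> then 1 else 0)) * \<psi> g)"
      using True by (simp add: machine.update_def machine.offset_def coordinate_vector_def cong: sum.cong)
    also have "\<dots> = \<phi> g + (if diff x \<phi> \<in> coordinates then diff x \<phi> g else 0)"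
      unfolding distrib_right sum.distrib sum_selected[OF finite_coordinates] using True by simp
    also have "\<dots> = \<phi> g + diff x \<phi> g" using diff_coordinate[OF True x] g by auto
    also have "\<dots> = coordinate_vector (x \<otimes> g) \<phi>"
      using True by (simp add: coordinate_vector_def diff_def)
    finally show ?thesis .
  qed (simp add: machine.update_def coordinate_vector_def)
qed

section \<open>The normal form\<close>

text \<open>
  Defined on elements rather than on words, so that the words obtained form a normal form as soon as
  each of them represents the element that it is made from.
\<close>

fun spell :: "('a \<times> ('a \<Rightarrow> int)) list \<Rightarrow> 'a \<Rightarrow> 'a list" where
  "spell [] g = [g]"
| "spell ((t, e) # L') g =
    (let y = syllable_letter t (e g); k = nat \<bar>e g\<bar>
     in replicate k y @ spell L' (inv y [^] k \<otimes> g))"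

lemma syllable_letter_props:
  assumes N: "subgroup N G" and e: "additive N e" and t: "t \<in> N" "e t = 1"
  shows "syllable_letter t k \<in> N" and "e (inv (syllable_letter t k)) = (if k > 0 then -1 else 1)"
  using t subgroup.m_inv_closed[OF N t(1)] additive_inv[OF N e t(1)] subgroup.mem_carrier[OF N t(1)]
  by (simp_all add: syllable_letter_def)

lemma peel_syllable:
  assumes N: "subgroup N G" and e: "additive N e" and t: "t \<in> N" "e t = 1" and g: "g \<in> N"
  shows "inv (syllable_letter t (e g)) [^] nat \<bar>e g\<bar> \<otimes> g \<in> kernel_of N e"
proof -
  let ?y = "inv (syllable_letter t (e g))"
  have y: "?y \<in> N" "e ?y = (if e g > 0 then -1 else 1)"
    using syllable_letter_props[OF N e t, of "e g"] subgroup.m_inv_closed[OF N] by simp_all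
  define k where "k = nat \<bar>e g\<bar>"
  have p: "e (?y [^] k) = int k * e ?y" "?y [^] k \<in> N"
    using additive_nat_pow[OF N e y(1), of k] by blast+
  have "e (?y [^] k) = - e g" unfolding p(1) y(2) by (simp add: k_def abs_if)
  then have "e (?y [^] k \<otimes> g) = 0" using additiveD[OF e p(2) g] by simp
  then show ?thesis using subgroup.m_closed[OF N p(2) g] unfolding k_def[symmetric] kernel_of_def by blast
qed

lemma spell_correct:
  "\<lbrakk>subgroup N G; tower N L' T; fst ` set L' \<subseteq> X; g \<in> N\<rbrakk> \<Longrightarrow>
    spell L' g \<in> lists X \<and> wv (spell L' g) = g"
proof (induction L' arbitrary: N g)
  case Nil
  then show ?case using T(2) X_carrier by auto
next
  case (Cons p L')
  obtain t e where p: "p = (t, e)" by (cases p)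
  have N: "subgroup N G" and g: "g \<in> N" by fact+
  have t: "t \<in> N" "e t = 1" and e: "additive N e" and tow: "tower (kernel_of N e) L' T"
    using Cons.prems(2) by (simp_all add: p)
  define y where "y = syllable_letter t (e g)"
  define k where "k = nat \<bar>e g\<bar>"
  have y: "y \<in> X" unfolding y_def using Cons.prems(3) by (intro syllable_letter_in) (simp add: p)
  then have yc: "y \<in> carrier G" by (rule X_carrier)
  have gc: "g \<in> carrier G" by (rule subgroup.mem_carrier[OF N g])
  have g': "inv y [^] k \<otimes> g \<in> kernel_of N e"
    unfolding y_def k_def by (rule peel_syllable[OF N e t g])
  have "fst ` set L' \<subseteq> X" using Cons.prems(3) by simp
  then have IH: "spell L' (inv y [^] k \<otimes> g) \<in> lists X" "wv (spell L' (inv y [^] k \<otimes> g)) = inv y [^] k \<otimes> g"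
    using Cons.IH[OF subgroup_kernel[OF N e] tow _ g'] by auto
  have s: "spell (p # L') g = replicate k y @ spell L' (inv y [^] k \<otimes> g)"
    by (simp add: p y_def k_def Let_def)
  have r: "replicate k y \<in> lists X" using y by (simp add: in_lists_conv_set)
  have "wv (spell (p # L') g) = y [^] k \<otimes> (inv y [^] k \<otimes> g)"
    unfolding s word_value_append[OF X(2) IH(1) r] IH(2) word_value_replicate[OF yc] ..
  also have "\<dots> = g" using yc gc by (simp add: nat_pow_inv inv_cancel)
  finally show ?case using s r IH(1) by simp
qed

section \<open>Runs of the machine\<close>

definition fits :: "nat \<Rightarrow> 'a phase \<times> nat \<times> (('a \<Rightarrow> int) \<Rightarrow> int) \<times> 'a list \<Rightarrow> bool" where
  "fits B = (\<lambda>(p, i, v, out). \<forall>j. \<bar>v j\<bar> \<le> int B)"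

definition growth_constant :: "nat \<Rightarrow> bool" where
  "growth_constant c \<longleftrightarrow>
     (\<forall>\<phi>\<in>coordinates. \<forall>w\<in>lists X. \<bar>\<phi> (wv w)\<bar> \<le> int (c * (length w + 1) ^ d))"

lemma growth_constant_exists: "\<exists>c. growth_constant c"
proof -
  have "\<exists>C::nat. \<forall>w\<in>lists X. \<bar>\<phi> (wv w)\<bar> \<le> int (C * (length w + 1) ^ d)" if "\<phi> \<in> coordinates" for \<phi>
    by (rule poly_growth[OF X poly_coordinate[OF that]])
  then obtain c :: "('a \<Rightarrow> int) \<Rightarrow> nat" where
    c: "\<And>\<phi> w. \<phi> \<in> coordinates \<Longrightarrow> w \<in> lists X \<Longrightarrow> \<bar>\<phi> (wv w)\<bar> \<le> int (c \<phi> * (length w + 1) ^ d)"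
    by metis
  have "growth_constant (sum c coordinates)" unfolding growth_constant_def
  proof (intro ballI)
    fix \<phi> w assume \<phi>: "\<phi> \<in> coordinates" and w: "w \<in> lists X"
    have "c \<phi> \<le> sum c coordinates" using finite_coordinates \<phi> by (intro member_le_sum) auto
    then have "c \<phi> * (length w + 1) ^ d \<le> sum c coordinates * (length w + 1) ^ d" by (rule mult_le_mono1)
    then have "int (c \<phi> * (length w + 1) ^ d) \<le> int (sum c coordinates * (length w + 1) ^ d)"
      by (simp only: of_nat_le_iff)
    then show "\<bar>\<phi> (wv w)\<bar> \<le> int (sum c coordinates * (length w + 1) ^ d)" using c[OF \<phi> w] by linarith
  qed
  then show ?thesis ..
qed

lemma fits_word:
  assumes "growth_constant c" "u \<in> lists X" "c * (length u + 1) ^ d \<le> B"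
  shows "fits B (p, i, coordinate_vector (wv u), out)"
proof -
  have "\<bar>coordinate_vector (wv u) j\<bar> \<le> int B" for j
  proof (cases "j \<in> coordinates")
    case True
    then have "\<bar>j (wv u)\<bar> \<le> int (c * (length u + 1) ^ d)"
      using assms(1,2) unfolding growth_constant_def by blast
    also have "\<dots> \<le> int B" using assms(3) by (simp only: of_nat_le_iff)
    finally show ?thesis using True by (simp add: coordinate_vector_def)
  qed (simp add: coordinate_vector_def)
  then show ?thesis by (simp add: fits_def)
qed

lemma vector_exponent: "e \<in> snd ` set L \<Longrightarrow> coordinate_vector g e = e g"
  using exponent_in_coordinates by (simp add: coordinate_vector_def)

abbreviation runs :: "'a list \<Rightarrow> nat \<Rightarrow> 'a phase \<times> nat \<times> (('a \<Rightarrow> int) \<Rightarrow> int) \<times> 'a list \<Rightarrow>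
    'a phase \<times> nat \<times> (('a \<Rightarrow> int) \<Rightarrow> int) \<times> 'a list \<Rightarrow> bool" where
  "runs w B \<equiv> leads (machine.mstep w) (fits B)"

abbreviation emitting :: "'a \<Rightarrow> 'a list \<Rightarrow> 'a phase \<times> nat \<times> (('a \<Rightarrow> int) \<Rightarrow> int) \<times> 'a list" where
  "emitting g out \<equiv> (Emit (coset g), 0, coordinate_vector g, out)"

abbreviation reading :: "'a \<Rightarrow> nat \<Rightarrow> 'a phase \<times> nat \<times> (('a \<Rightarrow> int) \<Rightarrow> int) \<times> 'a list" where
  "reading g i \<equiv> (Read (coset g), i, coordinate_vector g, [])"

lemma mstep_Emit:
  assumes L: "L = pre @ (t, e) # L'" and zero: "\<And>e'. e' \<in> snd ` set pre \<Longrightarrow> e' g = 0"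
    and nz: "e g \<noteq> 0" and g: "g \<in> carrier G" and y: "y = syllable_letter t (e g)"
  shows "machine.mstep w (emitting g out) =
    (emitting (inv y \<otimes> g) (out @ [y]))"
proof -
  let ?\<sigma> = "\<lambda>j. sgn (coordinate_vector g j)"
  have pre: "?\<sigma> e' = 0" if "(t', e') \<in> set pre" for t' e'
  proof -
    have pre: "e' \<in> snd ` set pre" using that by force
    then have "e' \<in> snd ` set L" by (auto simp: L)
    then show ?thesis by (simp add: vector_exponent zero[OF pre])
  qed
  have "e \<in> snd ` set L" by (simp add: L)
  then have v: "coordinate_vector g e = e g" by (rule vector_exponent)
  then have e: "?\<sigma> e = sgn (e g)" by simp
  have "find (\<lambda>(t, e). ?\<sigma> e \<noteq> 0) (pre @ (t, e) # L') = find (\<lambda>(t, e). ?\<sigma> e \<noteq> 0) ((t, e) # L')"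
    by (rule find_append_None) (use pre in auto)
  also have "\<dots> = Some (t, e)" using v nz by (simp add: sgn_if)
  finally have f: "find (\<lambda>(t, e). ?\<sigma> e \<noteq> 0) L = Some (t, e)" by (simp only: L)
  have yX: "syllable_letter t (e g) \<in> X" using L_X by (intro syllable_letter_in) (simp add: L)
  have s: "syllable_letter t (?\<sigma> e) = y" unfolding e y by (simp add: syllable_letter_def)
  have iy: "inv y \<in> X" using yX X_inv by (simp add: y)
  show ?thesis
    using update_Multiply[OF iy g] shift_coset[OF X_carrier[OF iy] g] by (simp add: f s Let_def)
qed

text \<open>
  The bound refers to the word length: dividing off a letter lengthens a word for the current element
  by one, hence the summand \<open>k\<close>.
\<close>

lemma peel_run:
  assumes C: "growth_constant c" and L: "L = pre @ (t, e) # L'"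
    and N: "subgroup N G" and e: "additive N e" and t: "t \<in> N" "e t = 1"
    and zero: "\<And>e' x. e' \<in> snd ` set pre \<Longrightarrow> x \<in> N \<Longrightarrow> e' x = 0"
  shows "\<lbrakk>u \<in> lists X; wv u \<in> N; nat \<bar>e (wv u)\<bar> = k; y = syllable_letter t (e (wv u));
      c * (length u + k + 1) ^ d \<le> B\<rbrakk> \<Longrightarrow>
    runs w B (emitting (wv u) out)
      (emitting (inv y [^] k \<otimes> wv u) (out @ replicate k y))"
proof (induction k arbitrary: u out)
  case 0
  have "wv u \<in> carrier G" using 0(1) by (rule wv_closed)
  then show ?case using 0 fits_word[OF C 0(1), of B] by (simp add: leads.refl)
next
  case (Suc k)
  let ?g = "wv u"
  have gc: "?g \<in> carrier G" using Suc.prems(1) by (rule wv_closed)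
  have nz: "e ?g \<noteq> 0" using Suc.prems(3) by auto
  have yX: "y \<in> X" unfolding Suc.prems(4) using L_X by (intro syllable_letter_in) (simp add: L)
  have iyX: "inv y \<in> X" by (rule X_inv[OF yX])
  have yc: "y \<in> carrier G" by (rule X_carrier[OF yX])
  have iyN: "inv y \<in> N" and ey: "e (inv y) = (if e ?g > 0 then -1 else 1)"
    unfolding Suc.prems(4) using syllable_letter_props[OF N e t, of "e ?g"] subgroup.m_inv_closed[OF N]
    by simp_all
  have step: "machine.mstep w (emitting ?g out) =
      (emitting (wv (inv y # u)) (out @ [y]))"
    using mstep_Emit[of pre t e L' ?g y w out, OF L _ nz gc Suc.prems(4)] zero[OF _ Suc.prems(2)]
    by (simp only: word_value_Cons)
  have u': "inv y # u \<in> lists X" using iyX Suc.prems(1) by simp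
  have gN: "wv (inv y # u) \<in> N" using subgroup.m_closed[OF N iyN Suc.prems(2)] by simp
  have eg: "e (wv (inv y # u)) = e ?g + (if e ?g > 0 then -1 else 1)"
    using additiveD[OF e iyN Suc.prems(2)] ey by simp
  have k': "nat \<bar>e (wv (inv y # u))\<bar> = k" unfolding eg using Suc.prems(3) by (auto split: if_splits)
  have pw: "inv y [^] k \<otimes> wv (inv y # u) = inv y [^] Suc k \<otimes> ?g"
    using yc gc by (simp add: m_assoc)
  have small: "c * (length (inv y # u) + k + 1) ^ d \<le> B" using Suc.prems(5) by simp
  have "runs w B
      (emitting (wv (inv y # u)) (out @ [y]))
      (emitting (inv y [^] k \<otimes> wv (inv y # u)) ((out @ [y]) @ replicate k y))"
  proof (cases k)
    case 0
    have "inv y \<otimes> ?g \<in> carrier G" using yc gc by simp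
    moreover have "c * (length (inv y # u) + 1) ^ d \<le> B" using small 0 by simp
    ultimately show ?thesis using fits_word[OF C u'] 0 by (simp add: leads.refl)
  next
    case (Suc k1)
    then have "e (wv (inv y # u)) > 0 \<longleftrightarrow> e ?g > 0" using k' eg nz by auto
    then have "y = syllable_letter t (e (wv (inv y # u)))"
      using Suc.prems(4) by (simp add: syllable_letter_def)
    from Suc.IH[OF u' gN k' this small] show ?thesis .
  qed
  then have rest: "runs w B (machine.mstep w (emitting ?g out))
      (emitting (inv y [^] Suc k \<otimes> ?g) (out @ replicate (Suc k) y))"
    unfolding step pw by simp
  have "c * (length u + 1) ^ d \<le> c * (length u + Suc k + 1) ^ d"
    by (intro mult_le_mono2 power_mono) simp_all
  then have "c * (length u + 1) ^ d \<le> B" using Suc.prems(5) by (rule le_trans)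
  from leads.step[OF fits_word[OF C Suc.prems(1) this] rest] show ?case .
qed

text \<open>
  The words \<open>u\<close> serve only to bound the vectors: they represent the element that is
  left, and have at most the length that \<open>grow\<close> allows for.
\<close>

lemma emit_run:
  assumes C: "growth_constant c"
  shows "\<lbrakk>L = pre @ L'; subgroup N G; tower N L' T; \<And>e' x. e' \<in> snd ` set pre \<Longrightarrow> x \<in> N \<Longrightarrow> e' x = 0;
      u \<in> lists X; wv u \<in> N; length u \<le> m; c * (grow c d (length L') m + 1) ^ d \<le> B\<rbrakk> \<Longrightarrow>
    \<exists>v. runs w B (emitting (wv u) out)
      (Halt, 0, v, out @ spell L' (wv u))"
proof (induction L' arbitrary: pre N u m out)
  case Nil
  let ?g = "wv u"
  have gT: "?g \<in> T" using Nil.prems by simp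
  have "find (\<lambda>(t, e). sgn (coordinate_vector ?g e) \<noteq> 0) L = None"
  proof -
    have "coordinate_vector ?g e = 0" if "(t, e) \<in> set L" for t e
    proof -
      have e: "e \<in> snd ` set L" using that by force
      then have "e \<in> snd ` set pre" using Nil.prems(1) by simp
      then show ?thesis unfolding vector_exponent[OF e] by (rule Nil.prems(4)) (rule Nil.prems(6))
    qed
    then show ?thesis by (auto simp: find_None_iff)
  qed
  then have step: "machine.mstep w (emitting ?g out) =
      (Halt, 0, coordinate_vector ?g, out @ [?g])"
    using torsion_letter_coset[OF gT] update_Keep by simp
  have "c * (length u + 1) ^ d \<le> c * (grow c d (length ([] :: ('a \<times> ('a \<Rightarrow> int)) list)) m + 1) ^ d"
    using Nil.prems(7) by (intro mult_le_mono2 power_mono) simp_all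
  then have small: "c * (length u + 1) ^ d \<le> B" using Nil.prems(8) by (rule le_trans)
  have "runs w B (emitting ?g out)
      (Halt, 0, coordinate_vector ?g, out @ [?g])"
  proof (rule leads.step)
    show "runs w B (machine.mstep w (emitting ?g out))
      (Halt, 0, coordinate_vector ?g, out @ [?g])"
      unfolding step by (rule leads.refl[of "fits B", OF fits_word[OF C Nil.prems(5) small]])
  qed (rule fits_word[OF C Nil.prems(5) small])
  then show ?case by (intro exI) (simp only: spell.simps)
next
  case (Cons p L')
  obtain t e where p: "p = (t, e)" by (cases p)
  note N = Cons.prems(2)
  have t: "t \<in> N" "e t = 1" and e: "additive N e" and tow: "tower (kernel_of N e) L' T"
    using Cons.prems(3) by (simp_all add: p)
  let ?g = "wv u"
  define y where "y = syllable_letter t (e ?g)"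
  define k where "k = nat \<bar>e ?g\<bar>"
  define m' where "m' = m + c * (m + 1) ^ d"
  have L: "L = pre @ (t, e) # L'" using Cons.prems(1) by (simp add: p)
  have eL: "e \<in> coordinates" by (rule exponent_in_coordinates) (simp add: L)
  have yX: "y \<in> X" unfolding y_def using L_X by (intro syllable_letter_in) (simp add: L)
  have u: "u \<in> lists X" by fact
  have k: "k \<le> c * (m + 1) ^ d"
  proof -
    have "\<bar>e ?g\<bar> \<le> int (c * (length u + 1) ^ d)" using C eL u unfolding growth_constant_def by blast
    then have "k \<le> c * (length u + 1) ^ d" unfolding k_def by linarith
    also have "\<dots> \<le> c * (m + 1) ^ d" using Cons.prems(7) by (intro mult_le_mono2 power_mono) simp_all
    finally show ?thesis .
  qed
  have len: "length u + k \<le> m'" using k Cons.prems(7) by (simp add: m'_def)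
  have B': "c * (grow c d (length L') m' + 1) ^ d \<le> B" using Cons.prems(8) by (simp add: m'_def)
  have "length u + k \<le> grow c d (length L') m'" using len grow_ge by (rule le_trans)
  then have "c * (length u + k + 1) ^ d \<le> c * (grow c d (length L') m' + 1) ^ d"
    by (intro mult_le_mono2 power_mono) simp_all
  then have small: "c * (length u + k + 1) ^ d \<le> B" using B' by (rule le_trans)
  have run1: "runs w B (emitting ?g out)
      (emitting (inv y [^] k \<otimes> ?g) (out @ replicate k y))"
  proof (rule peel_run[where pre = pre and t = t and e = e and L' = L' and N = N, OF C L N e t])
    show "e' x = 0" if "e' \<in> snd ` set pre" "x \<in> N" for e' x by (rule Cons.prems(4)[OF that])
  qed (fact u Cons.prems(6) k_def[symmetric] y_def small)+
  define u' where "u' = replicate k (inv y) @ u"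
  have u': "u' \<in> lists X" using u X_inv[OF yX] by (auto simp: u'_def)
  have "replicate k (inv y) \<in> lists X" using X_inv[OF yX] by auto
  then have g': "wv u' = inv y [^] k \<otimes> ?g"
    unfolding u'_def
    by (simp only: word_value_append[OF X(2) u] word_value_replicate[OF X_carrier[OF X_inv[OF yX]]])
  have gN': "wv u' \<in> kernel_of N e"
    unfolding g' y_def k_def by (rule peel_syllable[OF N e t Cons.prems(6)])
  have "\<exists>v. runs w B
      (emitting (wv u') (out @ replicate k y))
      (Halt, 0, v, (out @ replicate k y) @ spell L' (wv u'))"
  proof (rule Cons.IH)
    show "L = (pre @ [(t, e)]) @ L'" by (simp add: L)
    show "subgroup (kernel_of N e) G" by (rule subgroup_kernel[OF N e])
    show "e' x = 0" if "e' \<in> snd ` set (pre @ [(t, e)])" "x \<in> kernel_of N e" for e' x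
      using that Cons.prems(4)[of e' x] by (auto simp: kernel_of_def)
    show "length u' \<le> m'" using len by (simp add: u'_def)
  qed (use tow u' gN' B' in simp_all)
  then obtain v where run2: "runs w B
      (emitting (wv u') (out @ replicate k y))
      (Halt, 0, v, (out @ replicate k y) @ spell L' (wv u'))" by (rule exE)
  have "spell (p # L') ?g = replicate k y @ spell L' (wv u')"
    by (simp add: p g' y_def k_def Let_def)
  then show ?case using leads_trans[OF run1 run2[unfolded g']] unfolding g' by (intro exI) simp
qed

lemma read_run:
  assumes C: "growth_constant c" and w: "w \<in> lists X" and B: "c * (length w + 1) ^ d \<le> B"
  shows "k \<le> length w \<Longrightarrow> runs w B
    (reading (wv (drop k w)) k)
    (emitting (wv w) [])"
proof -
  have fit: "fits B (p, i, coordinate_vector (wv (drop k w)), out)" for p i out k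
  proof (rule fits_word[OF C])
    show "drop k w \<in> lists X" using w by (auto dest: in_set_dropD)
    have "c * (length (drop k w) + 1) ^ d \<le> c * (length w + 1) ^ d"
      by (intro mult_le_mono2 power_mono) simp_all
    then show "c * (length (drop k w) + 1) ^ d \<le> B" using B by (rule le_trans)
  qed
  show "k \<le> length w \<Longrightarrow> runs w B
    (reading (wv (drop k w)) k)
    (emitting (wv w) [])"
  proof (induction k)
    case 0
    have step: "machine.mstep w (reading (wv w) 0) =
        (emitting (wv w) [])"
      using update_Keep by (simp add: scanned_def)
    show ?case
    proof (rule leads.step)
      show "fits B (reading (wv (drop 0 w)) 0)" by (rule fit)
      have "fits B (emitting (wv w) [])" using fit[of _ _ 0] by simp
      then show "runs w B
          (machine.mstep w (reading (wv (drop 0 w)) 0))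
          (emitting (wv w) [])"
        unfolding drop_0 step by (rule leads.refl[of "fits B"])
    qed
  next
    case (Suc k)
    let ?v = "drop (Suc k) w"
    have k: "k < length w" using Suc.prems by simp
    have x: "w ! k \<in> X" using w k by (simp add: in_lists_conv_set)
    have v: "wv ?v \<in> carrier G" using w by (intro wv_closed) (auto dest: in_set_dropD)
    have dr: "wv (drop k w) = w ! k \<otimes> wv ?v" using k by (simp flip: Cons_nth_drop_Suc)
    have step: "machine.mstep w (reading (wv ?v) (Suc k)) =
        (reading (wv (drop k w)) k)"
      unfolding dr using k update_Multiply[OF x v] shift_coset[OF X_carrier[OF x] v]
      by (simp add: scanned_def)
    show ?case
    proof (rule leads.step)
      show "runs w B
          (machine.mstep w (reading (wv ?v) (Suc k)))
          (emitting (wv w) [])"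
        unfolding step by (rule Suc.IH) (use k in simp)
    qed (rule fit)
  qed
qed

lemma seek_run:
  assumes C: "growth_constant c" and B: "c \<le> B"
  shows "k \<le> length w \<Longrightarrow> runs w B
    (Seek, Suc (length w) - k, coordinate_vector \<one>, []) (reading \<one> (length w))"
proof (induction k)
  have fit: "fits B (p, i, coordinate_vector \<one>, out)" for p i out
    using fits_word[OF C, of "[]" B p i out] B by simp
  case 0
  have step: "machine.mstep w (Seek, Suc (length w) - 0, coordinate_vector \<one>, []) =
      (reading \<one> (length w))"
    using update_Keep by (simp add: scanned_def)
  show ?case
  proof (rule leads.step)
    show "runs w B (machine.mstep w (Seek, Suc (length w) - 0, coordinate_vector \<one>, []))
      (reading \<one> (length w))"
      unfolding step by (rule leads.refl[of "fits B", OF fit])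
  qed (rule fit)
next
  have fit: "fits B (p, i, coordinate_vector \<one>, out)" for p i out
    using fits_word[OF C, of "[]" B p i out] B by simp
  case (Suc k)
  have "scanned w (Suc (length w) - Suc k) = Letter (w ! (length w - k - 1))"
    using Suc.prems by (simp add: scanned_def)
  moreover have "min (Suc (Suc (length w) - Suc k)) (length w + 1) = Suc (length w) - k"
    using Suc.prems by simp
  ultimately have step: "machine.mstep w (Seek, Suc (length w) - Suc k, coordinate_vector \<one>, []) =
      (Seek, Suc (length w) - k, coordinate_vector \<one>, [])"
    using update_Keep by simp
  show ?case
  proof (rule leads.step)
    show "runs w B
      (machine.mstep w (Seek, Suc (length w) - Suc k, coordinate_vector \<one>, []))
      (reading \<one> (length w))"
      unfolding step by (rule Suc.IH) (use Suc.prems in simp)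
  qed (rule fit)
qed

lemma full_run:
  assumes C: "growth_constant c" and w: "w \<in> lists X"
    and B: "c * (grow c d (length L) (length w) + 1) ^ d \<le> B"
  shows "\<exists>v. runs w B machine.start (Halt, 0, v, spell L (wv w))"
proof -
  have "c * (length w + 1) ^ d \<le> c * (grow c d (length L) (length w) + 1) ^ d"
    using grow_ge by (intro mult_le_mono2 power_mono) simp_all
  then have B1: "c * (length w + 1) ^ d \<le> B" using B by (rule le_trans)
  have "c * 1 \<le> c * (length w + 1) ^ d" by (rule mult_le_mono2[OF one_le_power]) simp
  then have B0: "c \<le> B" using B1 unfolding mult_1_right by (rule le_trans)
  have step: "machine.mstep w machine.start = (Seek, Suc (length w) - length w, coordinate_vector \<one>, [])"
    using update_Load by (simp add: machine.start_def)
  have "fits B machine.start" by (simp add: fits_def machine.start_def)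
  moreover have "runs w B (machine.mstep w machine.start)
      (reading \<one> (length w))"
    unfolding step by (rule seek_run[OF C B0]) simp
  ultimately have "runs w B machine.start
      (reading \<one> (length w))" by (rule leads.step)
  moreover have "runs w B (reading \<one> (length w))
      (emitting (wv w) [])"
    using read_run[OF C w B1, of "length w"] by simp
  ultimately have run1: "runs w B machine.start
      (emitting (wv w) [])" by (rule leads_trans)
  have "\<exists>v. runs w B (emitting (wv w) [])
      (Halt, 0, v, [] @ spell L (wv w))"
    by (rule emit_run[OF C, of "[]" L "carrier G" w "length w"])
      (use tower w wv_closed B subgroup_self in simp_all)
  then obtain v where "runs w B
      (emitting (wv w) []) (Halt, 0, v, spell L (wv w))" by auto
  from leads_trans[OF run1 this] show ?thesis by (rule exI[of _ v])
qed

text \<open>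
  The output is a function of the element that the input represents, and itself represents this
  element.  For such a function the set of all outputs is a normal form.
\<close>

theorem has_logspace_normal_form: "has_logspace_normal_form G"
proof -
  define f where "f w = spell L (wv w)" for w
  have spell: "spell L g \<in> lists X" "wv (spell L g) = g" if "g \<in> carrier G" for g
    using spell_correct[OF subgroup_self tower L_X that] by auto
  obtain c where C: "growth_constant c" using growth_constant_exists by blast
  obtain C' D' where g: "\<And>m. grow c d (length L) m \<le> C' * (m + 1) ^ D'"
    using grow_polynomial by blast
  have f: "f \<in> lists X \<rightarrow> lists X" using spell wv_closed by (auto simp: f_def)
  have computable: "logspace_computable X X f"
  proof (rule machine.logspace_computable_if_polynomial[OF f])
    fix w assume w: "w \<in> lists X"
    let ?B = "c * (C' + 1) ^ d * (length w + 1) ^ (D' * d)"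
    have "\<exists>v. leads (machine.mstep w) (fits ?B) machine.start (Halt, 0, v, f w)"
      unfolding f_def by (rule full_run[OF C w poly_growth_comp[OF g]])
    then show "\<exists>p i v. p \<in> {Halt} \<and> leads (machine.mstep w)
        (\<lambda>(p, i, v, out). \<forall>j. \<bar>v j\<bar> \<le> int ?B) machine.start (p, i, v, f w)"
      unfolding fits_def by blast
  qed
  have normal: "normal_form G X (f ` lists X)"
    unfolding normal_form_def
  proof
    show "f ` lists X \<subseteq> lists X" using f by blast
    have val: "wv (f w) = wv w" if "w \<in> lists X" for w
      unfolding f_def by (rule spell(2)[OF wv_closed[OF that]])
    show "bij_betw wv (f ` lists X) (carrier G)"
      unfolding bij_betw_def
    proof
      show "inj_on wv (f ` lists X)"
      proof (rule inj_onI)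
        fix a b assume "a \<in> f ` lists X" "b \<in> f ` lists X" and eq: "wv a = wv b"
        then obtain u v where "u \<in> lists X" "a = f u" "v \<in> lists X" "b = f v" by blast
        then show "a = b" using eq val by (simp add: f_def)
      qed
      show "wv ` f ` lists X = carrier G"
      proof
        show "wv ` f ` lists X \<subseteq> carrier G"
        proof
          fix g assume "g \<in> wv ` f ` lists X"
          then obtain w where w: "w \<in> lists X" "g = wv (f w)" by blast
          show "g \<in> carrier G" unfolding w(2) val[OF w(1)] by (rule wv_closed[OF w(1)])
        qed
        show "carrier G \<subseteq> wv ` f ` lists X"
        proof
          fix g assume "g \<in> carrier G"
          then have "g \<in> generate G X" by (simp add: X_generates)
          from generate_word[OF X(2) X_inv this] obtain w where w: "w \<in> lists X" "wv w = g" by blast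
          have "wv (f w) = g" using val[OF w(1)] w(2) by (rule trans)
          then show "g \<in> wv ` f ` lists X" using imageI[OF imageI[OF w(1)], of wv f] by (simp only:)
        qed
      qed
    qed
  qed
  have value_f: "\<forall>w\<in>lists X. f w \<in> f ` lists X \<and> wv (f w) = wv w"
    using spell(2)[OF wv_closed] by (simp add: f_def)
  have "logspace_normal_form_function G X f"
    unfolding logspace_normal_form_function_def
    by (intro conjI exI[of _ "f ` lists X"] computable normal value_f)
  moreover have "symmetric_generating_set G X"
    using X(2) X_inv X_generates by (simp add: symmetric_generating_set_def)
  ultimately show ?thesis
    unfolding has_logspace_normal_form_def by (intro exI[of _ X] exI[of _ f] conjI X(1))
qed

end

text \<open>
  The generating set is enlarged by the letters of the normal form, and one degree bound is chosen for
  all functions of the tower.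
\<close>

lemma (in group) nilpotent_has_logspace_normal_form:
  assumes "finitely_generated G" "nilpotent G"
  shows "has_logspace_normal_form G"
proof -
  obtain C a s where cs: "central_series G C a s" using central_series_exists[OF assms] by blast
  interpret central_series G C a s by (rule cs)
  obtain L T K where L: "tower (carrier G) L T" and T: "finite T"
    and pol: "\<forall>e\<in>snd ` set L. \<exists>d. poly (carrier G) d e"
    and K: "subgroup K G" "finite_index (carrier G) K" "K \<inter> T = {\<one>}"
    using tower_exists[OF subgroup_self] by blast
  from bchoice[OF pol] obtain D where D: "\<forall>e\<in>snd ` set L. poly (carrier G) (D e) e" ..
  define d where "d = sum D (snd ` set L)"
  have poly_d: "poly (carrier G) d e" if "e \<in> snd ` set L" for e
  proof (rule poly_mono[OF _ subgroup_self])
    show "D e \<le> d" unfolding d_def using that by (intro member_le_sum) auto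
    show "poly (carrier G) (D e) e" using D that by blast
  qed
  obtain S where S: "S \<subseteq> carrier G" "finite S" "generate G S = carrier G"
    using assms(1) unfolding finitely_generated_def by auto
  define Y where "Y = S \<union> T \<union> fst ` set L"
  define X where "X = Y \<union> (\<lambda>x. inv x) ` Y"
  have tc: "fst ` set L \<subseteq> carrier G" using tower_letters[OF L] .
  have Tc: "T \<subseteq> carrier G" by (rule tower_subset[OF L])
  have Y: "Y \<subseteq> carrier G" "finite Y" using S T tc Tc by (auto simp: Y_def)
  have X: "X \<subseteq> carrier G" "finite X" using Y by (auto simp: X_def)
  have "tower_machine G C a s X L T K d"
  proof (intro tower_machine.intro cs tower_machine_axioms.intro L K T X poly_d)
    show "inv x \<in> X" if "x \<in> X" for x
      using that Y(1) by (auto simp: X_def)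
    have "carrier G \<subseteq> generate G X"
      using mono_generate[of S X] S(3) by (auto simp: X_def Y_def)
    moreover have "generate G X \<subseteq> carrier G" by (rule generate_incl[OF X(1)])
    ultimately show "generate G X = carrier G" by blast
  qed (auto simp: X_def Y_def)
  then show ?thesis by (rule tower_machine.has_logspace_normal_form)
qed

section \<open>Transport to a group of natural numbers\<close>

lemma (in group) finitely_generated_countable:
  assumes "finitely_generated G"
  shows "countable (carrier G)"
proof -
  obtain S where S: "S \<subseteq> carrier G" "finite S" "generate G S = carrier G"
    using assms unfolding finitely_generated_def by auto
  define X where "X = S \<union> (\<lambda>x. inv x) ` S"
  have X: "X \<subseteq> carrier G" "finite X" using S by (auto simp: X_def)
  have inv: "inv x \<in> X" if "x \<in> X" for x using that S(1) by (auto simp: X_def)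
  have "carrier G \<subseteq> word_value G ` lists X"
  proof
    fix g assume "g \<in> carrier G"
    then have "g \<in> generate G S" using S(3) by simp
    moreover have "generate G S \<subseteq> generate G X" by (rule mono_generate) (simp add: X_def)
    ultimately have "g \<in> generate G X" by (rule subsetD[rotated])
    from generate_word[OF X(1) inv this] obtain w where "w \<in> lists X" "word_value G w = g" by blast
    then show "g \<in> word_value G ` lists X" by (intro image_eqI[of _ _ w]) simp_all
  qed
  moreover have "countable (lists X)" using X(2) by (intro countable_lists countable_finite)
  ultimately show ?thesis by (rule countable_subset[OF _ countable_image])
qed

lemma (in group_hom) lower_central_image:
  assumes surj: "h ` carrier G = carrier H"
  shows "lower_central H k = h ` lower_central G k"
proof (induction k)
  case 0
  then show ?case using surj by simp
next
  case (Suc k)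
  have sub: "lower_central G k \<subseteq> carrier G" using G.lower_central_carrier by blast
  have comm: "H.commutator (h x) (h y) = h (G.commutator x y)" if "x \<in> lower_central G k" "y \<in> carrier G" for x y
    using that G.lower_central_carrier by (simp add: G.commutator_def H.commutator_def)
  have "{H.commutator x y | x y. x \<in> lower_central H k \<and> y \<in> carrier H} =
      h ` {G.commutator x y | x y. x \<in> lower_central G k \<and> y \<in> carrier G}" (is "?A = h ` ?B")
  proof
    show "?A \<subseteq> h ` ?B"
    proof
      fix z assume "z \<in> ?A"
      then obtain x y where xy: "x \<in> lower_central H k" "y \<in> carrier H" "z = H.commutator x y" by blast
      obtain x' where x': "x' \<in> lower_central G k" "x = h x'" using xy(1) Suc by blast
      obtain y' where y': "y' \<in> carrier G" "y = h y'" using xy(2) surj by blast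
      have "z = h (G.commutator x' y')" using comm[OF x'(1) y'(1)] xy(3) x'(2) y'(2) by simp
      moreover have "G.commutator x' y' \<in> ?B" using x'(1) y'(1) by blast
      ultimately show "z \<in> h ` ?B" by (rule image_eqI)
    qed
    show "h ` ?B \<subseteq> ?A"
    proof
      fix z assume "z \<in> h ` ?B"
      then obtain x y where xy: "x \<in> lower_central G k" "y \<in> carrier G" "z = h (G.commutator x y)" by blast
      then have "z = H.commutator (h x) (h y)" using comm by simp
      moreover have "h x \<in> lower_central H k" using Suc xy(1) by blast
      moreover have "h y \<in> carrier H" using xy(2) by (rule hom_closed)
      ultimately show "z \<in> ?A" by blast
    qed
  qed
  moreover have "?B \<subseteq> carrier G" using sub by auto
  ultimately show ?case
    unfolding G.lower_central_Suc H.lower_central_Suc by (simp only: generate_img)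
qed

theorem corollary49:
  fixes G :: "('a, 'm) monoid_scheme"
  assumes "group G"
    and "finitely_generated G"
    and "nilpotent G"
  shows "logspace_embeddable G"
proof -
  interpret group G by fact
  have count: "countable (carrier G)" by (rule finitely_generated_countable[OF assms(2)])
  define h where "h = to_nat_on (carrier G)"
  define h' where "h' = inv_into (carrier G) h"
  define H :: "nat monoid" where
    "H = \<lparr>carrier = h ` carrier G, mult = (\<lambda>x y. h (h' x \<otimes>\<^bsub>G\<^esub> h' y)), one = h \<one>\<^bsub>G\<^esub>\<rparr>"
  have surj: "h ` carrier G = carrier H" by (simp add: H_def)
  have inj: "inj_on h (carrier G)" unfolding h_def by (rule inj_on_to_nat_on[OF count])
  have h': "h' (h x) = x" if "x \<in> carrier G" for x
    unfolding h'_def using inj that by (rule inv_into_f_f)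
  have hom: "h \<in> hom G H" using h' by (auto simp: hom_def H_def)
  then have iso: "h \<in> iso G H" using inj by (auto simp: iso_def bij_betw_def H_def)
  have "group (H\<lparr>one := h \<one>\<^bsub>G\<^esub>\<rparr>)" by (rule iso_imp_img_group[OF iso])
  moreover have "H\<lparr>one := h \<one>\<^bsub>G\<^esub>\<rparr> = H" by (simp add: H_def)
  ultimately have H: "group H" by (simp only:)
  interpret H: group H by (rule H)
  interpret h: group_hom G H h
    by (rule group_hom.intro[OF assms(1) H group_hom_axioms.intro[OF hom]])
  obtain S where S: "S \<subseteq> carrier G" "finite S" "generate G S = carrier G"
    using assms(2) unfolding finitely_generated_def by auto
  have "finitely_generated H"
    unfolding finitely_generated_def
  proof (intro exI conjI)
    show "h ` S \<subseteq> carrier H" using S(1) surj by blast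
    show "finite (h ` S)" using S(2) by simp
    show "generate H (h ` S) = carrier H" using h.generate_img[OF S(1)] S(3) surj by simp
  qed
  moreover have "nilpotent H"
  proof -
    obtain k where "lower_central G k = {\<one>\<^bsub>G\<^esub>}" using assms(3) unfolding nilpotent_def by auto
    then have "lower_central H k = {\<one>\<^bsub>H\<^esub>}" using h.lower_central_image[OF surj, of k] by simp
    then show ?thesis unfolding nilpotent_def by blast
  qed
  ultimately have "has_logspace_normal_form H" by (rule H.nilpotent_has_logspace_normal_form)
  moreover have "h \<in> mon G H" using hom inj by (simp add: mon_def)
  ultimately show ?thesis using H unfolding logspace_embeddable_def by blast
qed

end
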